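(* Let $\Gamma=(V,E)$ be a hypergraph with quantum automorphism group $\mathrm{Aut}^+(\Gamma)$ and dual hypergraph $\Gamma^*$. (1) If $\Gamma$ has no multi-edges, then $\mathrm{Aut}^+(\Gamma)\subseteq S_V^+$. (2) If $\Gamma^*$ has no multi-edges, then $\mathrm{Aut}^+(\Gamma)\subseteq S_E^+$.
   Context: A (directed) hypergraph $\Gamma=(V,E)$ consists of a finite vertex set $V$, a finite edge set $E$ and maps $s,r:E\to\mathcal P(V)$ (power set; empty values and repeated edges are allowed). Its incidence matrices $A_s,A_r\in\mathbb C^{V\times E}$ are given by $(A_s)_{ve}=1$ if $v\in s(e)$ and $0$ otherwise, and $(A_r)_{ve}=1$ if $v\in r(e)$ and $0$ otherwise. $\Gamma$ has no multi-edges if $s(e_1)=s(e_2)$ and $r(e_1)=r(e_2)$ imply $e_1=e_2$ for all $e_1,e_2\in E$. The dual hypergraph $\Gamma^*$ has vertex set $E$, edge set $V$ and source and range maps $s^*(v)=\{e\in E: v\in s(e)\}$, $r^*(v)=\{e\in E: v\in r(e)\}$. For a finite set $X$ and a unital $C^*$-algebra $\mathcal A$, a matrix $u=(u_{ij})\in\mathcal A\otimes\mathbb C^{X\times X}$ is a magic unitary if $u_{ij}^2=u_{ij}^*=u_{ij}$ for all $i,j\in X$ and $\sum_{j\in X}u_{ij}=\sum_{j\in X}u_{ji}=1$ for all $i\in X$. A compact matrix quantum group $G=(\mathcal A,u)$ consists of a unital $C^*$-algebra $\mathcal A=:C(G)$ and a matrix $u=(u_{ij})_{i,j\in I}$ over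 $\mathcal A$ ($I$ a finite set) such that $\mathcal A$ is generated by the $u_{ij}$, $u$ is unitary and $(u_{ij}^* )_{i,j}$ is invertible, and there is a unital $*$-homomorphism $\Delta:\mathcal A\to\mathcal A\otimes\mathcal A$ (minimal tensor product) with $\Delta(u_{ij})=\sum_{k\in I} u_{ik}\otimes u_{kj}$. For compact matrix quantum groups $G,H$, a unital $*$-homomorphism $\varphi:C(G)\to C(H)$ with $(\varphi\otimes\varphi)\circ\Delta_G=\Delta_H\circ\varphi$ is called a morphism of compact quantum groups; $H\subseteq G$ means that there is a surjective such $\varphi:C(G)\to C(H)$. $S_X^+=(\mathcal A,u)$, where $\mathcal A$ is the universal unital $C^*$-algebra generated by the entries of a magic unitary $u=(u_{ij})_{i,j\in X}$. The quantum automorphism group of $\Gamma$ is the compact matrix quantum group $\mathrm{Aut}^+(\Gamma)=(\mathcal A,u_V\oplus u_E)$, where $\mathcal A$ is the universal unital $C^*$-algebra with generators $u_{vw}$ ($v,w\in V$) and $u_{ef}$ ($e,f\in E$) subject to: $u_V=(u_{vw})_{v,w\in V}$ and $u_E=(u_{ef})_{e,f\in E}$ are magic unitaries, $A_su_E=u_VA_s$ and $A_ru_E=u_VA_r$. Here $u_V\oplus u_E$ is the block diagonal matrix indexed by $V\sqcup E$. *)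

theory Defs
  imports Complex_Main "HOL-Algebra.Module" "HOL-Algebra.Subrings" "HOL-Library.Poly_Mapping"
begin

section \<open>Hypergraphs\<close>

record ('v, 'e) pre_hypergraph =
  verts :: "'v set"
  edges :: "'e set"
  src :: "'e \<Rightarrow> 'v set"
  rng :: "'e \<Rightarrow> 'v set"

definition hypergraph :: "('v, 'e) pre_hypergraph \<Rightarrow> bool" where
  "hypergraph \<Gamma> \<longleftrightarrow> finite (verts \<Gamma>) \<and> finite (edges \<Gamma>) \<and>
     (\<forall>e\<in>edges \<Gamma>. src \<Gamma> e \<subseteq> verts \<Gamma> \<and> rng \<Gamma> e \<subseteq> verts \<Gamma>)"

definition no_multi_edges :: "('v, 'e) pre_hypergraph \<Rightarrow> bool" where
  "no_multi_edges \<Gamma> \<longleftrightarrow>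
     (\<forall>e\<in>edges \<Gamma>. \<forall>f\<in>edges \<Gamma>. src \<Gamma> e = src \<Gamma> f \<and> rng \<Gamma> e = rng \<Gamma> f \<longrightarrow> e = f)"

definition dual :: "('v, 'e) pre_hypergraph \<Rightarrow> ('e, 'v) pre_hypergraph" where
  "dual \<Gamma> = \<lparr> verts = edges \<Gamma>, edges = verts \<Gamma>,
     src = (\<lambda>v. {e \<in> edges \<Gamma>. v \<in> src \<Gamma> e}), rng = (\<lambda>v. {e \<in> edges \<Gamma>. v \<in> rng \<Gamma> e}) \<rparr>"

definition src_incidence :: "('v, 'e) pre_hypergraph \<Rightarrow> 'v \<Rightarrow> 'e \<Rightarrow> complex" where
  "src_incidence \<Gamma> v e = (if v \<in> src \<Gamma> e then 1 else 0)"

definition rng_incidence :: "('v, 'e) pre_hypergraph \<Rightarrow> 'v \<Rightarrow> 'e \<Rightarrow> complex" where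
  "rng_incidence \<Gamma> v e = (if v \<in> rng \<Gamma> e then 1 else 0)"


section \<open>Unital C*-algebras\<close>

record 'a star_algebra = "(complex, 'a) module" +
  adj :: "'a \<Rightarrow> 'a"

record 'a cstar_algebra = "'a star_algebra" +
  nrm :: "'a \<Rightarrow> real"

definition cauchy_seqs :: "('a, 'm) star_algebra_scheme \<Rightarrow> ('a \<Rightarrow> real) \<Rightarrow> (nat \<Rightarrow> 'a) set" where
  "cauchy_seqs P N = {x. (\<forall>n. x n \<in> carrier P) \<and>
     (\<forall>\<epsilon>>0. \<exists>M. \<forall>m\<ge>M. \<forall>n\<ge>M. N (x m \<ominus>\<^bsub>P\<^esub> x n) < \<epsilon>)}"

text \<open>The zero algebra is admitted.\<close>

locale unital_cstar_algebra = ring A for A :: "('a, 'm) cstar_algebra_scheme" (structure) +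
  assumes smult_closed: "x \<in> carrier A \<Longrightarrow> c \<odot> x \<in> carrier A"
    and smult_l_distr: "x \<in> carrier A \<Longrightarrow> (c + d) \<odot> x = c \<odot> x \<oplus> d \<odot> x"
    and smult_r_distr: "\<lbrakk>x \<in> carrier A; y \<in> carrier A\<rbrakk> \<Longrightarrow> c \<odot> (x \<oplus> y) = c \<odot> x \<oplus> c \<odot> y"
    and smult_smult: "x \<in> carrier A \<Longrightarrow> (c * d) \<odot> x = c \<odot> (d \<odot> x)"
    and smult_one: "x \<in> carrier A \<Longrightarrow> 1 \<odot> x = x"
    and smult_mult_left: "\<lbrakk>x \<in> carrier A; y \<in> carrier A\<rbrakk> \<Longrightarrow> (c \<odot> x) \<otimes> y = c \<odot> (x \<otimes> y)"
    and smult_mult_right: "\<lbrakk>x \<in> carrier A; y \<in> carrier A\<rbrakk> \<Longrightarrow> x \<otimes> (c \<odot> y) = c \<odot> (x \<otimes> y)"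
    and adj_closed: "x \<in> carrier A \<Longrightarrow> adj A x \<in> carrier A"
    and adj_adj: "x \<in> carrier A \<Longrightarrow> adj A (adj A x) = x"
    and adj_add: "\<lbrakk>x \<in> carrier A; y \<in> carrier A\<rbrakk> \<Longrightarrow> adj A (x \<oplus> y) = adj A x \<oplus> adj A y"
    and adj_smult: "x \<in> carrier A \<Longrightarrow> adj A (c \<odot> x) = cnj c \<odot> adj A x"
    and adj_mult: "\<lbrakk>x \<in> carrier A; y \<in> carrier A\<rbrakk> \<Longrightarrow> adj A (x \<otimes> y) = adj A y \<otimes> adj A x"
    and nrm_eq_0_iff: "x \<in> carrier A \<Longrightarrow> nrm A x = 0 \<longleftrightarrow> x = \<zero>"
    and nrm_add: "\<lbrakk>x \<in> carrier A; y \<in> carrier A\<rbrakk> \<Longrightarrow> nrm A (x \<oplus> y) \<le> nrm A x + nrm A y"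
    and nrm_smult: "x \<in> carrier A \<Longrightarrow> nrm A (c \<odot> x) = cmod c * nrm A x"
    and nrm_mult: "\<lbrakk>x \<in> carrier A; y \<in> carrier A\<rbrakk> \<Longrightarrow> nrm A (x \<otimes> y) \<le> nrm A x * nrm A y"
    and nrm_cstar: "x \<in> carrier A \<Longrightarrow> nrm A (adj A x \<otimes> x) = (nrm A x)\<^sup>2"
    and complete: "s \<in> cauchy_seqs A (nrm A) \<Longrightarrow>
      \<exists>l\<in>carrier A. (\<lambda>n. nrm A (s n \<ominus> l)) \<longlonglongrightarrow> 0"

definition star_hom ::
  "('a, 'm) star_algebra_scheme \<Rightarrow> ('b, 'n) star_algebra_scheme \<Rightarrow> ('a \<Rightarrow> 'b) \<Rightarrow> bool" where
  "star_hom A B \<phi> \<longleftrightarrow> \<phi> \<in> ring_hom A B \<and>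
     (\<forall>c. \<forall>x\<in>carrier A. \<phi> (c \<odot>\<^bsub>A\<^esub> x) = c \<odot>\<^bsub>B\<^esub> \<phi> x) \<and>
     (\<forall>x\<in>carrier A. \<phi> (adj A x) = adj B (\<phi> x))"

definition closed_star_subalgebra :: "('a, 'm) cstar_algebra_scheme \<Rightarrow> 'a set \<Rightarrow> bool" where
  "closed_star_subalgebra A B \<longleftrightarrow> subring B A \<and>
     (\<forall>c. \<forall>x\<in>B. c \<odot>\<^bsub>A\<^esub> x \<in> B) \<and> (\<forall>x\<in>B. adj A x \<in> B) \<and>
     (\<forall>x l. (\<forall>n::nat. x n \<in> B) \<and> l \<in> carrier A \<and> (\<lambda>n. nrm A (x n \<ominus>\<^bsub>A\<^esub> l)) \<longlonglongrightarrow> 0 \<longrightarrow> l \<in> B)"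

definition generated_by :: "('a, 'm) cstar_algebra_scheme \<Rightarrow> 'a set \<Rightarrow> bool" where
  "generated_by A S \<longleftrightarrow> S \<subseteq> carrier A \<and>
     (\<forall>B. closed_star_subalgebra A B \<and> S \<subseteq> B \<longrightarrow> B = carrier A)"


section \<open>Hausdorff completion of a *-algebra with respect to a C*-seminorm\<close>

definition null_rel ::
  "('a, 'm) star_algebra_scheme \<Rightarrow> ('a \<Rightarrow> real) \<Rightarrow> ((nat \<Rightarrow> 'a) \<times> (nat \<Rightarrow> 'a)) set" where
  "null_rel P N = {(x, y). x \<in> cauchy_seqs P N \<and> y \<in> cauchy_seqs P N \<and>
     (\<lambda>n. N (x n \<ominus>\<^bsub>P\<^esub> y n)) \<longlonglongrightarrow> 0}"

definition seq_class ::
  "('a, 'm) star_algebra_scheme \<Rightarrow> ('a \<Rightarrow> real) \<Rightarrow> (nat \<Rightarrow> 'a) \<Rightarrow> (nat \<Rightarrow> 'a) set" where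
  "seq_class P N x = null_rel P N `` {x}"

definition seq_rep :: "(nat \<Rightarrow> 'a) set \<Rightarrow> nat \<Rightarrow> 'a" where
  "seq_rep X = (SOME x. x \<in> X)"

definition completion ::
  "('a, 'm) star_algebra_scheme \<Rightarrow> ('a \<Rightarrow> real) \<Rightarrow> (nat \<Rightarrow> 'a) set cstar_algebra" where
  "completion P N =
    \<lparr> carrier = cauchy_seqs P N // null_rel P N,
      monoid.mult = (\<lambda>X Y. seq_class P N (\<lambda>n. seq_rep X n \<otimes>\<^bsub>P\<^esub> seq_rep Y n)),
      one = seq_class P N (\<lambda>n. \<one>\<^bsub>P\<^esub>),
      zero = seq_class P N (\<lambda>n. \<zero>\<^bsub>P\<^esub>),
      add = (\<lambda>X Y. seq_class P N (\<lambda>n. seq_rep X n \<oplus>\<^bsub>P\<^esub> seq_rep Y n)),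
      smult = (\<lambda>c X. seq_class P N (\<lambda>n. c \<odot>\<^bsub>P\<^esub> seq_rep X n)),
      adj = (\<lambda>X. seq_class P N (\<lambda>n. adj P (seq_rep X n))),
      nrm = (\<lambda>X. lim (\<lambda>n. N (seq_rep X n))) \<rparr>"

definition to_completion ::
  "('a, 'm) star_algebra_scheme \<Rightarrow> ('a \<Rightarrow> real) \<Rightarrow> 'a \<Rightarrow> (nat \<Rightarrow> 'a) set" where
  "to_completion P N a = seq_class P N (\<lambda>n. a)"


section \<open>Universal unital C*-algebras\<close>

text \<open>
  The complex monoid algebra of a monoid \<open>M\<close> with involution \<open>i\<close> (an anti-automorphism of
  order two), consisting of the finite formal linear combinations of elements of \<open>M\<close>.
\<close>

definition monoid_star_algebra ::
  "('k, 'm) monoid_scheme \<Rightarrow> ('k \<Rightarrow> 'k) \<Rightarrow> ('k \<Rightarrow>\<^sub>0 complex) star_algebra" where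
  "monoid_star_algebra M i =
    \<lparr> carrier = {f. Poly_Mapping.keys f \<subseteq> carrier M},
      monoid.mult = (\<lambda>f g. \<Sum>a\<in>Poly_Mapping.keys f. \<Sum>b\<in>Poly_Mapping.keys g.
        Poly_Mapping.single (a \<otimes>\<^bsub>M\<^esub> b) (Poly_Mapping.lookup f a * Poly_Mapping.lookup g b)),
      one = Poly_Mapping.single \<one>\<^bsub>M\<^esub> 1,
      zero = 0,
      add = (+),
      smult = (\<lambda>c f. Poly_Mapping.map ((*) c) f),
      adj = (\<lambda>f. \<Sum>a\<in>Poly_Mapping.keys f.
        Poly_Mapping.single (i a) (cnj (Poly_Mapping.lookup f a))) \<rparr>"

text \<open>
  The free unital *-algebra on a set \<open>X\<close> of generators: its monomials are the words in the letters
  \<open>(g, False)\<close>, standing for the generator \<open>g\<close>, and \<open>(g, True)\<close>, standing for its adjoint.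
\<close>

definition free_star_algebra :: "'g set \<Rightarrow> (('g \<times> bool) list \<Rightarrow>\<^sub>0 complex) star_algebra" where
  "free_star_algebra X = monoid_star_algebra
     \<lparr> carrier = lists (X \<times> UNIV), monoid.mult = (@), one = [] \<rparr>
     (\<lambda>w. rev (map (map_prod id Not) w))"

definition free_gen :: "'g \<Rightarrow> (('g \<times> bool) list \<Rightarrow>\<^sub>0 complex)" where
  "free_gen g = Poly_Mapping.single [(g, False)] 1"

definition cstar_seminorm :: "('a, 'm) star_algebra_scheme \<Rightarrow> ('a \<Rightarrow> real) \<Rightarrow> bool" where
  "cstar_seminorm P p \<longleftrightarrow>
     (\<forall>x\<in>carrier P. \<forall>y\<in>carrier P.
        p (x \<oplus>\<^bsub>P\<^esub> y) \<le> p x + p y \<and> p (x \<otimes>\<^bsub>P\<^esub> y) \<le> p x * p y) \<and>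
     (\<forall>c. \<forall>x\<in>carrier P. p (c \<odot>\<^bsub>P\<^esub> x) = cmod c * p x) \<and>
     (\<forall>x\<in>carrier P. p (adj P x \<otimes>\<^bsub>P\<^esub> x) = (p x)\<^sup>2)"

text \<open>
  A relation \<open>a = b\<close> is given by the element \<open>a - b\<close>. The universal C*-algebra exists if the supremum
  below is finite, which is the case if the relations force the generators to be projections.
\<close>

definition universal_seminorm :: "('a, 'm) star_algebra_scheme \<Rightarrow> 'a set \<Rightarrow> 'a \<Rightarrow> real" where
  "universal_seminorm P R x = Sup {p x | p. cstar_seminorm P p \<and> (\<forall>r\<in>R. p r = 0)}"

definition universal_cstar_algebra ::
  "'g set \<Rightarrow> (('g \<times> bool) list \<Rightarrow>\<^sub>0 complex) set
    \<Rightarrow> (nat \<Rightarrow> (('g \<times> bool) list \<Rightarrow>\<^sub>0 complex)) set cstar_algebra" where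
  "universal_cstar_algebra X R =
     completion (free_star_algebra X) (universal_seminorm (free_star_algebra X) R)"

definition universal_gen ::
  "'g set \<Rightarrow> (('g \<times> bool) list \<Rightarrow>\<^sub>0 complex) set \<Rightarrow> 'g
    \<Rightarrow> (nat \<Rightarrow> (('g \<times> bool) list \<Rightarrow>\<^sub>0 complex)) set" where
  "universal_gen X R g =
     to_completion (free_star_algebra X) (universal_seminorm (free_star_algebra X) R) (free_gen g)"


section \<open>The minimal tensor product\<close>

definition state :: "('a, 'm) cstar_algebra_scheme \<Rightarrow> ('a \<Rightarrow> complex) \<Rightarrow> bool" where
  "state A \<sigma> \<longleftrightarrow>
     (\<forall>x\<in>carrier A. \<forall>y\<in>carrier A. \<sigma> (x \<oplus>\<^bsub>A\<^esub> y) = \<sigma> x + \<sigma> y) \<and>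
     (\<forall>c. \<forall>x\<in>carrier A. \<sigma> (c \<odot>\<^bsub>A\<^esub> x) = c * \<sigma> x) \<and>
     (\<forall>x\<in>carrier A. Im (\<sigma> (adj A x \<otimes>\<^bsub>A\<^esub> x)) = 0 \<and> Re (\<sigma> (adj A x \<otimes>\<^bsub>A\<^esub> x)) \<ge> 0) \<and>
     (\<forall>x\<in>carrier A. cmod (\<sigma> x) \<le> nrm A x) \<and>
     \<sigma> \<one>\<^bsub>A\<^esub> = 1"

text \<open>
  The free complex vector space on \<open>A \<times> B\<close>, with \<open>(a, b) (c, d) = (a c, b d)\<close> and
  \<open>(a, b)\<^sup>* = (a\<^sup>*, b\<^sup>*)\<close>. It maps onto the algebraic tensor product of \<open>A\<close> and \<open>B\<close>. The kernel is not
  divided out here, since it is the null space of the seminorm defined below.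
\<close>

definition formal_tensor ::
  "('a, 'm) cstar_algebra_scheme \<Rightarrow> ('b, 'n) cstar_algebra_scheme
    \<Rightarrow> ('a \<times> 'b \<Rightarrow>\<^sub>0 complex) star_algebra" where
  "formal_tensor A B = monoid_star_algebra (A \<times>\<times> B) (map_prod (adj A) (adj B))"

definition product_functional ::
  "('a \<Rightarrow> complex) \<Rightarrow> ('b \<Rightarrow> complex) \<Rightarrow> ('a \<times> 'b \<Rightarrow>\<^sub>0 complex) \<Rightarrow> complex" where
  "product_functional \<sigma> \<tau> x =
     (\<Sum>(a, b)\<in>Poly_Mapping.keys x. Poly_Mapping.lookup x (a, b) * \<sigma> a * \<tau> b)"

text \<open>
  The spatial norm of \<open>x\<close> is the supremum over all states \<open>\<sigma>\<close>, \<open>\<tau>\<close> of the operator norms of \<open>x\<close> in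
  the tensor product of the GNS representations of \<open>\<sigma>\<close> and \<open>\<tau>\<close> (the direct sum of the GNS
  representations of all states being faithful). The vectors of that representation of the form
  \<open>y \<xi>\<close>, with \<open>\<xi>\<close> the product of the two cyclic vectors, are dense, and the inner product of two of
  them is \<open>\<langle>y \<xi>, z \<xi>\<rangle> = (\<sigma> \<otimes> \<tau>) (y\<^sup>* z)\<close>. The element \<open>0\<close> only matters if there are no states.
\<close>

definition spatial_seminorm ::
  "('a, 'm) cstar_algebra_scheme \<Rightarrow> ('b, 'n) cstar_algebra_scheme
    \<Rightarrow> ('a \<times> 'b \<Rightarrow>\<^sub>0 complex) \<Rightarrow> real" where
  "spatial_seminorm A B x = (let P = formal_tensor A B in
     Sup (insert 0
       {sqrt (Re (product_functional \<sigma> \<tau> (adj P (x \<otimes>\<^bsub>P\<^esub> y) \<otimes>\<^bsub>P\<^esub> (x \<otimes>\<^bsub>P\<^esub> y)))) | \<sigma> \<tau> y.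
          state A \<sigma> \<and> state B \<tau> \<and> y \<in> carrier P \<and>
          product_functional \<sigma> \<tau> (adj P y \<otimes>\<^bsub>P\<^esub> y) = 1}))"

definition min_tensor ::
  "('a, 'm) cstar_algebra_scheme \<Rightarrow> ('b, 'n) cstar_algebra_scheme
    \<Rightarrow> (nat \<Rightarrow> ('a \<times> 'b \<Rightarrow>\<^sub>0 complex)) set cstar_algebra" where
  "min_tensor A B = completion (formal_tensor A B) (spatial_seminorm A B)"

definition elementary_tensor ::
  "('a, 'm) cstar_algebra_scheme \<Rightarrow> ('b, 'n) cstar_algebra_scheme
    \<Rightarrow> 'a \<Rightarrow> 'b \<Rightarrow> (nat \<Rightarrow> ('a \<times> 'b \<Rightarrow>\<^sub>0 complex)) set" where
  "elementary_tensor A B a b =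
     to_completion (formal_tensor A B) (spatial_seminorm A B) (Poly_Mapping.single (a, b) 1)"


section \<open>Compact matrix quantum groups\<close>

record ('i, 'a) matrix_quantum_group =
  func_alg :: "'a cstar_algebra"
  index_set :: "'i set"
  fund :: "'i \<Rightarrow> 'i \<Rightarrow> 'a"

definition inverse_matrices ::
  "('a, 'm) ring_scheme \<Rightarrow> 'i set \<Rightarrow> ('i \<Rightarrow> 'i \<Rightarrow> 'a) \<Rightarrow> ('i \<Rightarrow> 'i \<Rightarrow> 'a) \<Rightarrow> bool" where
  "inverse_matrices A I u w \<longleftrightarrow> (\<forall>i\<in>I. \<forall>j\<in>I.
     (\<Oplus>\<^bsub>A\<^esub>k\<in>I. u i k \<otimes>\<^bsub>A\<^esub> w k j) = (if i = j then \<one>\<^bsub>A\<^esub> else \<zero>\<^bsub>A\<^esub>) \<and>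
     (\<Oplus>\<^bsub>A\<^esub>k\<in>I. w i k \<otimes>\<^bsub>A\<^esub> u k j) = (if i = j then \<one>\<^bsub>A\<^esub> else \<zero>\<^bsub>A\<^esub>))"

definition comultiplication ::
  "('i, 'a) matrix_quantum_group \<Rightarrow> ('a \<Rightarrow> (nat \<Rightarrow> ('a \<times> 'a \<Rightarrow>\<^sub>0 complex)) set) \<Rightarrow> bool" where
  "comultiplication G \<Delta> \<longleftrightarrow> (let A = func_alg G; I = index_set G; u = fund G; T = min_tensor A A in
     star_hom A T \<Delta> \<and>
     (\<forall>i\<in>I. \<forall>j\<in>I. \<Delta> (u i j) = (\<Oplus>\<^bsub>T\<^esub>k\<in>I. elementary_tensor A A (u i k) (u k j))))"

definition compact_matrix_quantum_group :: "('i, 'a) matrix_quantum_group \<Rightarrow> bool" where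
  "compact_matrix_quantum_group G \<longleftrightarrow> (let A = func_alg G; I = index_set G; u = fund G in
     unital_cstar_algebra A \<and> finite I \<and>
     generated_by A {u i j | i j. i \<in> I \<and> j \<in> I} \<and>
     inverse_matrices A I u (\<lambda>i j. adj A (u j i)) \<and>
     (\<exists>w. (\<forall>i\<in>I. \<forall>j\<in>I. w i j \<in> carrier A) \<and> inverse_matrices A I (\<lambda>i j. adj A (u i j)) w) \<and>
     (\<exists>\<Delta>. comultiplication G \<Delta>))"

text \<open>
  The comultiplications \<open>\<Delta>\<^sub>G\<close>, \<open>\<Delta>\<^sub>H\<close> and the tensor product \<open>\<Phi>\<close> of \<open>\<phi>\<close> with itself are uniquely
  determined on the respective carriers, because unital *-homomorphisms between C*-algebras are
  continuous; hence the existential quantifier.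
\<close>

definition cqg_morphism ::
  "('i, 'a) matrix_quantum_group \<Rightarrow> ('j, 'b) matrix_quantum_group \<Rightarrow> ('a \<Rightarrow> 'b) \<Rightarrow> bool" where
  "cqg_morphism G H \<phi> \<longleftrightarrow> (let A = func_alg G; B = func_alg H in
     star_hom A B \<phi> \<and>
     (\<exists>\<Delta>\<^sub>G \<Delta>\<^sub>H \<Phi>. comultiplication G \<Delta>\<^sub>G \<and> comultiplication H \<Delta>\<^sub>H \<and>
        star_hom (min_tensor A A) (min_tensor B B) \<Phi> \<and>
        (\<forall>a\<in>carrier A. \<forall>b\<in>carrier A.
           \<Phi> (elementary_tensor A A a b) = elementary_tensor B B (\<phi> a) (\<phi> b)) \<and>
        (\<forall>x\<in>carrier A. \<Phi> (\<Delta>\<^sub>G x) = \<Delta>\<^sub>H (\<phi> x))))"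

definition quantum_subgroup ::
  "('j, 'b) matrix_quantum_group \<Rightarrow> ('i, 'a) matrix_quantum_group \<Rightarrow> bool"
  (infix \<open>\<subseteq>\<^sub>q\<close> 50) where
  "H \<subseteq>\<^sub>q G \<longleftrightarrow> compact_matrix_quantum_group H \<and> compact_matrix_quantum_group G \<and>
     (\<exists>\<phi>. cqg_morphism G H \<phi> \<and> \<phi> ` carrier (func_alg G) = carrier (func_alg H))"


section \<open>Quantum permutation groups and quantum automorphism groups of hypergraphs\<close>

definition magic_unitary_relations ::
  "('a, 'm) star_algebra_scheme \<Rightarrow> 'x set \<Rightarrow> ('x \<Rightarrow> 'x \<Rightarrow> 'a) \<Rightarrow> 'a set" where
  "magic_unitary_relations F X u =
     {u i j \<otimes>\<^bsub>F\<^esub> u i j \<ominus>\<^bsub>F\<^esub> u i j | i j. i \<in> X \<and> j \<in> X} \<union>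
     {adj F (u i j) \<ominus>\<^bsub>F\<^esub> u i j | i j. i \<in> X \<and> j \<in> X} \<union>
     {(\<Oplus>\<^bsub>F\<^esub>j\<in>X. u i j) \<ominus>\<^bsub>F\<^esub> \<one>\<^bsub>F\<^esub> | i. i \<in> X} \<union>
     {(\<Oplus>\<^bsub>F\<^esub>j\<in>X. u j i) \<ominus>\<^bsub>F\<^esub> \<one>\<^bsub>F\<^esub> | i. i \<in> X}"

definition quantum_permutation_group ::
  "'x set \<Rightarrow> ('x, (nat \<Rightarrow> ((('x \<times> 'x) \<times> bool) list \<Rightarrow>\<^sub>0 complex)) set) matrix_quantum_group" where
  "quantum_permutation_group X = (let
     gens = X \<times> X;
     rels = magic_unitary_relations (free_star_algebra gens) X (\<lambda>i j. free_gen (i, j)) in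
     \<lparr> func_alg = universal_cstar_algebra gens rels,
       index_set = X,
       fund = (\<lambda>i j. universal_gen gens rels (i, j)) \<rparr>)"

text \<open>The relations \<open>A u\<^sub>E = u\<^sub>V A\<close> for a matrix \<open>A\<close> of scalars.\<close>

definition intertwiner_relations ::
  "('a, 'm) star_algebra_scheme \<Rightarrow> 'v set \<Rightarrow> 'e set \<Rightarrow> ('v \<Rightarrow> 'e \<Rightarrow> complex)
    \<Rightarrow> ('v \<Rightarrow> 'v \<Rightarrow> 'a) \<Rightarrow> ('e \<Rightarrow> 'e \<Rightarrow> 'a) \<Rightarrow> 'a set" where
  "intertwiner_relations F V E A uV uE =
     {(\<Oplus>\<^bsub>F\<^esub>e\<in>E. A v e \<odot>\<^bsub>F\<^esub> uE e f) \<ominus>\<^bsub>F\<^esub> (\<Oplus>\<^bsub>F\<^esub>w\<in>V. A w f \<odot>\<^bsub>F\<^esub> uV v w) | v f. v \<in> V \<and> f \<in> E}"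

definition quantum_automorphism_relations ::
  "('v, 'e) pre_hypergraph
    \<Rightarrow> (((('v \<times> 'v) + ('e \<times> 'e)) \<times> bool) list \<Rightarrow>\<^sub>0 complex) set" where
  "quantum_automorphism_relations \<Gamma> = (let
     V = verts \<Gamma>; E = edges \<Gamma>;
     F = free_star_algebra ((V \<times> V) <+> (E \<times> E));
     uV = (\<lambda>v w. free_gen (Inl (v, w)));
     uE = (\<lambda>e f. free_gen (Inr (e, f))) in
     magic_unitary_relations F V uV \<union>
     magic_unitary_relations F E uE \<union>
     intertwiner_relations F V E (src_incidence \<Gamma>) uV uE \<union>
     intertwiner_relations F V E (rng_incidence \<Gamma>) uV uE)"

definition quantum_automorphism_group ::
  "('v, 'e) pre_hypergraph \<Rightarrow>
    ('v + 'e, (nat \<Rightarrow> (((('v \<times> 'v) + ('e \<times> 'e)) \<times> bool) list \<Rightarrow>\<^sub>0 complex)) set)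
      matrix_quantum_group" where
  "quantum_automorphism_group \<Gamma> = (let
     V = verts \<Gamma>; E = edges \<Gamma>;
     gens = (V \<times> V) <+> (E \<times> E);
     rels = quantum_automorphism_relations \<Gamma>;
     A = universal_cstar_algebra gens rels in
     \<lparr> func_alg = A,
       index_set = V <+> E,
       fund = (\<lambda>i j. case (i, j) of
           (Inl v, Inl w) \<Rightarrow> universal_gen gens rels (Inl (v, w))
         | (Inr e, Inr f) \<Rightarrow> universal_gen gens rels (Inr (e, f))
         | _ \<Rightarrow> \<zero>\<^bsub>A\<^esub>) \<rparr>)"

end

theory Submission
  imports Defs "HOL-Algebra.RingHom" "HOL-Library.Complex_Order"
    "HOL-Computational_Algebra.Polynomial"
begin

text \<open>
  Projections in a C*-algebra that sum up to \<open>1\<close> are pairwise orthogonal. By the intertwining relation, the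
  sum of \<open>u\<^sub>v\<^sub>w\<close> over \<open>w \<in> s(f)\<close> is the sum of the orthogonal projections \<open>u\<^sub>e\<^sub>f\<close> with \<open>v \<in> s(e)\<close>, and
  similarly for the ranges. If no two edges have the same source and the same range, these sets of edges
  separate the edges, so every \<open>u\<^sub>e\<^sub>f\<close> is a product of such sums and their complements, and the entries of
  \<open>u\<^sub>V\<close> generate \<open>C(Aut\<^sup>+(\<Gamma>))\<close>. Exchanging the roles of vertices and edges gives the second claim.

  The comultiplications come from the universal property, applied to the convolution
  \<open>\<Sum>\<^sub>k u\<^sub>i\<^sub>k \<otimes> u\<^sub>k\<^sub>j\<close> in the minimal tensor product. That its seminorm is a C*-seminorm rests on the Schur
  product theorem for the positivity of product states.
\<close>


section \<open>Unital *-algebras\<close>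

text \<open>The spectral theory and the positive cone of a C*-algebra are avoided; the C*-identity
  is the only analytic input. Facts that usually rest on them get elementary substitutes.
  Orthogonality: compressing the sum of the p_l, which is 1, by p_j yields a vanishing sum of
  elements p_j p_l p_j with l distinct from j. Every 1 - p_j p_l p_j lies in the unit ball, hence so
  do 1 + h and 1 - h for a small multiple h of one summand, and 1 is an extreme point, so h = 0.
  Closed range: \<open>quantum_subgroup\<close> demands a surjection, whereas generation only gives
  a dense range, so an approximate lifting with bounded norm is iterated. Continuity: contractivity
  accompanies each homomorphism from its construction on, since uniqueness on a completion depends
  on it. Surjectivity enters a second time when the square of the homomorphism is extended to the
  minimal tensor products, because vectors have to be lifted. Both seminorms are suprema of sets of
  reals, so their finiteness needs proof: for the universal one the generators are projections, for
  the spatial one a submultiplicative norm on formal tensors dominates all product states.\<close>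

locale unital_star_algebra = ring P for P :: "('a, 'm) star_algebra_scheme" (structure) +
  assumes smult_closed: "x \<in> carrier P \<Longrightarrow> c \<odot> x \<in> carrier P"
    and smult_l_distr: "x \<in> carrier P \<Longrightarrow> (c + d) \<odot> x = c \<odot> x \<oplus> d \<odot> x"
    and smult_r_distr: "\<lbrakk>x \<in> carrier P; y \<in> carrier P\<rbrakk> \<Longrightarrow> c \<odot> (x \<oplus> y) = c \<odot> x \<oplus> c \<odot> y"
    and smult_smult: "x \<in> carrier P \<Longrightarrow> (c * d) \<odot> x = c \<odot> (d \<odot> x)"
    and smult_one: "x \<in> carrier P \<Longrightarrow> 1 \<odot> x = x"
    and smult_mult_left: "\<lbrakk>x \<in> carrier P; y \<in> carrier P\<rbrakk> \<Longrightarrow> (c \<odot> x) \<otimes> y = c \<odot> (x \<otimes> y)"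
    and smult_mult_right: "\<lbrakk>x \<in> carrier P; y \<in> carrier P\<rbrakk> \<Longrightarrow> x \<otimes> (c \<odot> y) = c \<odot> (x \<otimes> y)"
    and adj_closed: "x \<in> carrier P \<Longrightarrow> adj P x \<in> carrier P"
    and adj_adj: "x \<in> carrier P \<Longrightarrow> adj P (adj P x) = x"
    and adj_add: "\<lbrakk>x \<in> carrier P; y \<in> carrier P\<rbrakk> \<Longrightarrow> adj P (x \<oplus> y) = adj P x \<oplus> adj P y"
    and adj_smult: "x \<in> carrier P \<Longrightarrow> adj P (c \<odot> x) = cnj c \<odot> adj P x"
    and adj_mult: "\<lbrakk>x \<in> carrier P; y \<in> carrier P\<rbrakk> \<Longrightarrow> adj P (x \<otimes> y) = adj P y \<otimes> adj P x"
begin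

lemma smult_zero_left: "x \<in> carrier P \<Longrightarrow> 0 \<odot> x = \<zero>"
  using smult_l_distr[of x 0 0] by (metis add_0 add.l_cancel_one' smult_closed)

lemma smult_zero_right: "c \<odot> \<zero> = \<zero>"
  by (metis add.l_cancel_one' l_zero smult_closed smult_r_distr zero_closed)

lemma smult_minus_one: "x \<in> carrier P \<Longrightarrow> (-1) \<odot> x = \<ominus> x"
  using smult_l_distr[of x "-1" 1] smult_zero_left[of x]
  by (simp add: smult_one smult_closed minus_equality)

lemma smult_a_inv: "x \<in> carrier P \<Longrightarrow> c \<odot> (\<ominus> x) = \<ominus> (c \<odot> x)"
  by (metis mult.commute smult_closed smult_minus_one smult_smult)

lemma smult_diff: "\<lbrakk>x \<in> carrier P; y \<in> carrier P\<rbrakk> \<Longrightarrow> c \<odot> (x \<ominus> y) = c \<odot> x \<ominus> c \<odot> y"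
  by (simp add: a_minus_def smult_a_inv smult_r_distr)

lemma adj_zero: "adj P \<zero> = \<zero>"
  by (metis add.l_cancel_one' l_zero adj_closed adj_add zero_closed)

lemma adj_one: "adj P \<one> = \<one>"
  by (metis adj_adj adj_closed adj_mult l_one one_closed r_one)

lemma adj_a_inv: "x \<in> carrier P \<Longrightarrow> adj P (\<ominus> x) = \<ominus> adj P x"
  using adj_smult[of x "-1"] by (simp add: smult_minus_one adj_closed)

lemma adj_diff: "\<lbrakk>x \<in> carrier P; y \<in> carrier P\<rbrakk> \<Longrightarrow> adj P (x \<ominus> y) = adj P x \<ominus> adj P y"
  by (simp add: a_minus_def adj_a_inv adj_add)

lemma diff_eq_zero_iff: "\<lbrakk>x \<in> carrier P; y \<in> carrier P\<rbrakk> \<Longrightarrow> x \<ominus> y = \<zero> \<longleftrightarrow> x = y"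
  by (metis a_minus_def minus_equality minus_minus r_neg a_inv_closed)

lemma smult_finsum:
  assumes "finite I" "\<And>i. i \<in> I \<Longrightarrow> f i \<in> carrier P"
  shows "c \<odot> (\<Oplus>i\<in>I. f i) = (\<Oplus>i\<in>I. c \<odot> f i)"
  using assms
  by (induction I) (auto simp: smult_zero_right smult_r_distr smult_closed Pi_iff finsum_closed)

lemma adj_finsum:
  assumes "finite I" "\<And>i. i \<in> I \<Longrightarrow> f i \<in> carrier P"
  shows "adj P (\<Oplus>i\<in>I. f i) = (\<Oplus>i\<in>I. adj P (f i))"
  using assms by (induction I) (auto simp: adj_zero adj_add adj_closed Pi_iff finsum_closed)

lemma finsum_smult_mult_finsum_smult:
  assumes "finite I" "finite J" "\<And>i. i \<in> I \<Longrightarrow> f i \<in> carrier P" "\<And>j. j \<in> J \<Longrightarrow> g j \<in> carrier P"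
  shows "(\<Oplus>i\<in>I. f i) \<otimes> (\<Oplus>j\<in>J. g j) = (\<Oplus>i\<in>I. \<Oplus>j\<in>J. f i \<otimes> g j)"
  using assms by (subst finsum_ldistr) (auto simp: finsum_rdistr Pi_iff finsum_closed intro!: finsum_cong')

lemma finsum_finsum_swap:
  assumes "finite I" "finite J" "\<And>i j. i \<in> I \<Longrightarrow> j \<in> J \<Longrightarrow> f i j \<in> carrier P"
  shows "(\<Oplus>i\<in>I. \<Oplus>j\<in>J. f i j) = (\<Oplus>j\<in>J. \<Oplus>i\<in>I. f i j)"
  using assms(1,3)
proof (induction I)
  case empty
  then show ?case by (simp add: finsum_zero)
next
  case (insert i I)
  have "(\<Oplus>j\<in>J. \<Oplus>i\<in>insert i I. f i j) = (\<Oplus>j\<in>J. f i j \<oplus> (\<Oplus>i\<in>I. f i j))"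
    using insert by (intro finsum_cong') (auto simp: Pi_iff intro!: finsum_closed)
  also have "\<dots> = (\<Oplus>j\<in>J. f i j) \<oplus> (\<Oplus>j\<in>J. \<Oplus>i\<in>I. f i j)"
    using insert by (intro finsum_addf) (auto simp: Pi_iff intro!: finsum_closed)
  finally show ?case
    using insert by (simp add: Pi_iff finsum_closed)
qed

lemma finsum_superset:
  assumes "finite J" "I \<subseteq> J" "\<And>i. i \<in> I \<Longrightarrow> f i \<in> carrier P" "\<And>i. i \<in> J - I \<Longrightarrow> f i = \<zero>"
  shows "(\<Oplus>i\<in>J. f i) = (\<Oplus>i\<in>I. f i)"
proof (rule add.finprod_mono_neutral_cong_right)
  show "f \<in> J \<rightarrow> carrier P"
    using assms(3,4) by (metis DiffI Pi_I zero_closed)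
qed (use assms in auto)

lemma finsum_single:
  assumes "finite I" "i \<in> I" "f i \<in> carrier P" "\<And>j. j \<in> I - {i} \<Longrightarrow> f j = \<zero>"
  shows "(\<Oplus>j\<in>I. f j) = f i"
  using finsum_superset[of I "{i}" f] assms by simp

end

sublocale unital_cstar_algebra \<subseteq> star?: unital_star_algebra A
  by unfold_locales
    (auto simp: smult_closed smult_l_distr smult_r_distr smult_smult smult_one smult_mult_left
      smult_mult_right adj_closed adj_adj adj_add adj_smult adj_mult)

locale star_homomorphism = A: unital_star_algebra A + B: unital_star_algebra B
  for A :: "('a, 'm) star_algebra_scheme" and B :: "('b, 'n) star_algebra_scheme" +
  fixes \<phi> :: "'a \<Rightarrow> 'b"
  assumes star_hom: "star_hom A B \<phi>"

sublocale star_homomorphism \<subseteq> ring_hom_ring A B \<phi>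
  using star_hom by (auto simp: star_hom_def ring_hom_ring_def ring_hom_ring_axioms_def
      A.ring_axioms B.ring_axioms)

context star_homomorphism
begin

lemma hom_smult: "x \<in> carrier A \<Longrightarrow> \<phi> (c \<odot>\<^bsub>A\<^esub> x) = c \<odot>\<^bsub>B\<^esub> \<phi> x"
  and hom_adj: "x \<in> carrier A \<Longrightarrow> \<phi> (adj A x) = adj B (\<phi> x)"
  using star_hom by (auto simp: star_hom_def)

lemma hom_diff: "\<lbrakk>x \<in> carrier A; y \<in> carrier A\<rbrakk> \<Longrightarrow> \<phi> (x \<ominus>\<^bsub>A\<^esub> y) = \<phi> x \<ominus>\<^bsub>B\<^esub> \<phi> y"
  by (simp add: a_minus_def)

lemma hom_finsum:
  "(\<And>i. i \<in> I \<Longrightarrow> f i \<in> carrier A) \<Longrightarrow> \<phi> (\<Oplus>\<^bsub>A\<^esub>i\<in>I. f i) = (\<Oplus>\<^bsub>B\<^esub>i\<in>I. \<phi> (f i))"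
  by (induction I rule: infinite_finite_induct)
    (auto simp: A.finsum_infinite B.finsum_infinite Pi_iff A.finsum_closed)

end

lemma star_hom_comp:
  "star_hom A B f \<Longrightarrow> star_hom B C g \<Longrightarrow> star_hom A C (\<lambda>x. g (f x))"
  by (auto simp: star_hom_def ring_hom_def Pi_iff)


section \<open>Monoid *-algebras\<close>

locale star_monoid = monoid M for M (structure) +
  fixes i :: "'k \<Rightarrow> 'k"
  assumes invol_closed: "x \<in> carrier M \<Longrightarrow> i x \<in> carrier M"
    and invol_invol: "x \<in> carrier M \<Longrightarrow> i (i x) = x"
    and invol_mult: "\<lbrakk>x \<in> carrier M; y \<in> carrier M\<rbrakk> \<Longrightarrow> i (x \<otimes> y) = i y \<otimes> i x"

lemma monoid_star_algebra_simps:
  "carrier (monoid_star_algebra M i) = {f. Poly_Mapping.keys f \<subseteq> carrier M}"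
  "\<one>\<^bsub>monoid_star_algebra M i\<^esub> = Poly_Mapping.single \<one>\<^bsub>M\<^esub> 1"
  "\<zero>\<^bsub>monoid_star_algebra M i\<^esub> = 0"
  "x \<oplus>\<^bsub>monoid_star_algebra M i\<^esub> y = x + y"
  "c \<odot>\<^bsub>monoid_star_algebra M i\<^esub> x = Poly_Mapping.map ((*) c) x"
  by (simp_all add: monoid_star_algebra_def)

lemma lookup_map_mult: "Poly_Mapping.lookup (Poly_Mapping.map ((*) c) f) k = c * Poly_Mapping.lookup f k"
  for f :: "'k \<Rightarrow>\<^sub>0 complex"
  by transfer (simp add: when_def)

lemma map_mult_single: "Poly_Mapping.map ((*) c) (Poly_Mapping.single a d) = Poly_Mapping.single a (c * d)"
  for d :: complex
  by (rule poly_mapping_eqI) (simp add: lookup_map_mult lookup_single when_def)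

lemma map_mult_plus: "Poly_Mapping.map ((*) c) (f + g) = Poly_Mapping.map ((*) c) f + Poly_Mapping.map ((*) c) g"
  for f g :: "'k \<Rightarrow>\<^sub>0 complex"
  by (rule poly_mapping_eqI) (simp add: lookup_map_mult lookup_add algebra_simps)

lemma sum_keys_superset:
  assumes "finite K" "Poly_Mapping.keys f \<subseteq> K" "\<And>k. k \<in> K \<Longrightarrow> F k 0 = 0"
  shows "(\<Sum>k\<in>Poly_Mapping.keys f. F k (Poly_Mapping.lookup f k)) = (\<Sum>k\<in>K. F k (Poly_Mapping.lookup f k))"
  using assms by (intro sum.mono_neutral_left) (auto simp: in_keys_iff)

context star_monoid
begin

abbreviation P where "P \<equiv> monoid_star_algebra M i"

lemma single_closed: "a \<in> carrier M \<Longrightarrow> Poly_Mapping.single a c \<in> carrier P"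
  by (simp add: monoid_star_algebra_simps)

lemma plus_closed: "f \<in> carrier P \<Longrightarrow> g \<in> carrier P \<Longrightarrow> f + g \<in> carrier P"
  using Poly_Mapping.keys_add[of f g] by (auto simp: monoid_star_algebra_simps)

lemma sum_closed: "(\<And>k. k \<in> K \<Longrightarrow> f k \<in> carrier P) \<Longrightarrow> (\<Sum>k\<in>K. f k) \<in> carrier P"
  by (induction K rule: infinite_finite_induct) (auto simp: plus_closed, auto simp: monoid_star_algebra_simps)

text \<open>Reduces identities between linear or bilinear operations to monomials. The zero element
  has no case of its own, being the monomial with coefficient 0.\<close>

lemma monoid_algebra_induct [consumes 1, case_names single plus]:
  assumes "f \<in> carrier P"
    and "\<And>a c. a \<in> carrier M \<Longrightarrow> Q (Poly_Mapping.single a c)"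
    and "\<And>f g. \<lbrakk>f \<in> carrier P; g \<in> carrier P; Q f; Q g\<rbrakk> \<Longrightarrow> Q (f + g)"
  shows "Q f"
proof -
  have "Q (\<Sum>k\<in>K. Poly_Mapping.single k (Poly_Mapping.lookup f k))" if "finite K" "K \<subseteq> carrier M" for K
    using that
  proof (induction K)
    case empty
    then show ?case using assms(2)[OF one_closed, of 0] by simp
  next
    case (insert k K)
    then show ?case by (auto intro!: assms(2,3) sum_closed single_closed)
  qed
  moreover have "(\<Sum>k\<in>Poly_Mapping.keys f. Poly_Mapping.single k (Poly_Mapping.lookup f k)) = f"
    by (rule poly_mapping_eqI) (auto simp: lookup_sum lookup_single when_def in_keys_iff)
  ultimately show ?thesis
    using assms(1) by (metis finite_keys monoid_star_algebra_simps(1) mem_Collect_eq)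
qed

lemma mult_eq: "f \<otimes>\<^bsub>P\<^esub> g = (\<Sum>a\<in>Poly_Mapping.keys f. \<Sum>b\<in>Poly_Mapping.keys g.
        Poly_Mapping.single (a \<otimes> b) (Poly_Mapping.lookup f a * Poly_Mapping.lookup g b))"
  and adj_eq: "adj P f = (\<Sum>a\<in>Poly_Mapping.keys f. Poly_Mapping.single (i a) (cnj (Poly_Mapping.lookup f a)))"
  by (simp_all add: monoid_star_algebra_def)

lemma mult_single_single:
  "Poly_Mapping.single a c \<otimes>\<^bsub>P\<^esub> Poly_Mapping.single b d = Poly_Mapping.single (a \<otimes> b) (c * d)"
  by (simp add: mult_eq)

lemma adj_single: "adj P (Poly_Mapping.single a c) = Poly_Mapping.single (i a) (cnj c)"
  by (simp add: adj_eq)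

lemma mult_plus_left: "(f + g) \<otimes>\<^bsub>P\<^esub> h = f \<otimes>\<^bsub>P\<^esub> h + g \<otimes>\<^bsub>P\<^esub> h"
  unfolding mult_eq
  by (rule setsum_keys_plus_distrib) (auto simp: algebra_simps single_add sum.distrib)

lemma mult_plus_right: "h \<otimes>\<^bsub>P\<^esub> (f + g) = h \<otimes>\<^bsub>P\<^esub> f + h \<otimes>\<^bsub>P\<^esub> g"
  unfolding mult_eq sum.distrib[symmetric]
  by (intro sum.cong refl setsum_keys_plus_distrib) (auto simp: algebra_simps single_add)

lemma adj_plus: "adj P (f + g) = adj P f + adj P g"
  unfolding adj_eq by (rule setsum_keys_plus_distrib) (auto simp: single_add)

lemma mult_closed: "f \<in> carrier P \<Longrightarrow> g \<in> carrier P \<Longrightarrow> f \<otimes>\<^bsub>P\<^esub> g \<in> carrier P"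
  unfolding mult_eq by (intro sum_closed single_closed m_closed) (auto simp: monoid_star_algebra_simps)

lemma adj_P_closed: "f \<in> carrier P \<Longrightarrow> adj P f \<in> carrier P"
  unfolding adj_eq by (intro sum_closed single_closed invol_closed) (auto simp: monoid_star_algebra_simps)

lemma mult_P_assoc:
  assumes "f \<in> carrier P" "g \<in> carrier P" "h \<in> carrier P"
  shows "f \<otimes>\<^bsub>P\<^esub> g \<otimes>\<^bsub>P\<^esub> h = f \<otimes>\<^bsub>P\<^esub> (g \<otimes>\<^bsub>P\<^esub> h)"
  using assms(1)
proof (induction f rule: monoid_algebra_induct)
  case (single a c)
  from assms(2) show ?case
  proof (induction g rule: monoid_algebra_induct)
    case (single b d)
    from assms(3) show ?case
      by (induction h rule: monoid_algebra_induct)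
        (use \<open>a \<in> carrier M\<close> \<open>b \<in> carrier M\<close> in
          \<open>simp_all add: mult_single_single mult_plus_left mult_plus_right m_assoc mult.assoc\<close>)
  qed (simp_all add: mult_plus_left mult_plus_right)
qed (simp_all add: mult_plus_left mult_plus_right)

lemma adj_P_mult:
  assumes "f \<in> carrier P" "g \<in> carrier P"
  shows "adj P (f \<otimes>\<^bsub>P\<^esub> g) = adj P g \<otimes>\<^bsub>P\<^esub> adj P f"
  using assms(1)
proof (induction f rule: monoid_algebra_induct)
  case (single a c)
  from assms(2) show ?case
    by (induction g rule: monoid_algebra_induct)
      (use \<open>a \<in> carrier M\<close> in \<open>simp_all add: mult_single_single mult_plus_left mult_plus_right adj_plus
        adj_single invol_mult mult.commute\<close>)
qed (simp_all add: mult_plus_left mult_plus_right adj_plus)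

lemma smult_P_mult_left:
  "f \<in> carrier P \<Longrightarrow> g \<in> carrier P \<Longrightarrow> (c \<odot>\<^bsub>P\<^esub> f) \<otimes>\<^bsub>P\<^esub> g = c \<odot>\<^bsub>P\<^esub> (f \<otimes>\<^bsub>P\<^esub> g)"
proof (induction f rule: monoid_algebra_induct)
  case (single a d)
  from single(2) show ?case
    by (induction g rule: monoid_algebra_induct)
      (use \<open>a \<in> carrier M\<close> in \<open>simp_all add: mult_single_single mult_plus_left mult_plus_right
        map_mult_single monoid_star_algebra_simps map_mult_plus mult.assoc\<close>)
qed (simp_all add: mult_plus_left mult_plus_right monoid_star_algebra_simps map_mult_plus)

lemma smult_P_mult_right:
  "f \<in> carrier P \<Longrightarrow> g \<in> carrier P \<Longrightarrow> f \<otimes>\<^bsub>P\<^esub> (c \<odot>\<^bsub>P\<^esub> g) = c \<odot>\<^bsub>P\<^esub> (f \<otimes>\<^bsub>P\<^esub> g)"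
proof (induction f rule: monoid_algebra_induct)
  case (single a d)
  from single(2) show ?case
    by (induction g rule: monoid_algebra_induct)
      (use \<open>a \<in> carrier M\<close> in \<open>simp_all add: mult_single_single mult_plus_left mult_plus_right
        map_mult_single monoid_star_algebra_simps map_mult_plus mult.left_commute\<close>)
qed (simp_all add: mult_plus_left mult_plus_right monoid_star_algebra_simps map_mult_plus)

lemma star_algebra: "unital_star_algebra P"
proof -
  have "abelian_group P"
  proof (rule abelian_groupI)
    fix f assume "f \<in> carrier P"
    then show "\<exists>y\<in>carrier P. y \<oplus>\<^bsub>P\<^esub> f = \<zero>\<^bsub>P\<^esub>"
      by (intro bexI[of _ "- f"]) (auto simp: monoid_star_algebra_simps in_keys_iff subset_iff)
  qed (auto simp: plus_closed monoid_star_algebra_simps(3-) add_ac, simp add: monoid_star_algebra_simps)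
  moreover have "monoid P"
  proof (rule monoidI)
    fix f assume "f \<in> carrier P"
    then show "\<one>\<^bsub>P\<^esub> \<otimes>\<^bsub>P\<^esub> f = f" "f \<otimes>\<^bsub>P\<^esub> \<one>\<^bsub>P\<^esub> = f"
      by (induction f rule: monoid_algebra_induct)
        (simp_all add: monoid_star_algebra_simps(2) mult_single_single mult_plus_left mult_plus_right)
  qed (auto simp: mult_closed mult_P_assoc monoid_star_algebra_simps(2) single_closed)
  ultimately have "ring P"
    by (intro ringI) (auto simp: monoid_star_algebra_simps(4) mult_plus_left mult_plus_right
        dest: monoid.m_closed abelian_groupE)
  then interpret ring P .
  show ?thesis
  proof unfold_locales
    show "adj P (adj P f) = f" if "f \<in> carrier P" for f
      using that by (induction f rule: monoid_algebra_induct) (simp_all add: adj_single adj_plus invol_invol)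
    show "adj P (c \<odot>\<^bsub>P\<^esub> f) = cnj c \<odot>\<^bsub>P\<^esub> adj P f" if "f \<in> carrier P" for f c
      using that by (induction f rule: monoid_algebra_induct)
        (simp_all add: adj_single adj_plus monoid_star_algebra_simps map_mult_plus map_mult_single)
    show "c \<odot>\<^bsub>P\<^esub> f \<in> carrier P" if "f \<in> carrier P" for f c
      using that by (auto simp: monoid_star_algebra_simps in_keys_iff lookup_map_mult subset_iff)
  qed (simp_all add: smult_P_mult_left smult_P_mult_right adj_P_closed adj_P_mult adj_plus
      monoid_star_algebra_simps(4), simp_all add: monoid_star_algebra_simps map_mult_plus
      poly_mapping_eq_iff fun_eq_iff lookup_add lookup_map_mult algebra_simps)
qed

end

text \<open>The linear extension of a map on the monoid. It serves twice: for the evaluation of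
  words in an algebra, and for the square of a homomorphism on formal tensors.\<close>

definition monoid_lift :: "('b, 'n) star_algebra_scheme \<Rightarrow> ('k \<Rightarrow> 'b) \<Rightarrow> ('k \<Rightarrow>\<^sub>0 complex) \<Rightarrow> 'b" where
  "monoid_lift B h f = (\<Oplus>\<^bsub>B\<^esub>a\<in>Poly_Mapping.keys f. Poly_Mapping.lookup f a \<odot>\<^bsub>B\<^esub> h a)"

locale star_monoid_hom = star_monoid M i + B: unital_star_algebra B
  for M (structure) and i :: "'k \<Rightarrow> 'k" and B :: "('b, 'n) star_algebra_scheme" +
  fixes h :: "'k \<Rightarrow> 'b"
  assumes h_closed: "a \<in> carrier M \<Longrightarrow> h a \<in> carrier B"
    and h_one: "h \<one> = \<one>\<^bsub>B\<^esub>"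
    and h_mult: "\<lbrakk>a \<in> carrier M; b \<in> carrier M\<rbrakk> \<Longrightarrow> h (a \<otimes> b) = h a \<otimes>\<^bsub>B\<^esub> h b"
    and h_invol: "a \<in> carrier M \<Longrightarrow> h (i a) = adj B (h a)"
begin

text \<open>Lets two elements be summed over the union of their supports, as additivity
  requires.\<close>

lemma lift_superset:
  assumes "finite K" "K \<subseteq> carrier M" "Poly_Mapping.keys f \<subseteq> K"
  shows "monoid_lift B h f = (\<Oplus>\<^bsub>B\<^esub>a\<in>K. Poly_Mapping.lookup f a \<odot>\<^bsub>B\<^esub> h a)"
  unfolding monoid_lift_def
  using assms by (intro B.finsum_superset[symmetric])
    (auto simp: B.smult_closed h_closed in_keys_iff subset_iff intro!: B.smult_zero_left)

lemma lift_single: "a \<in> carrier M \<Longrightarrow> monoid_lift B h (Poly_Mapping.single a c) = c \<odot>\<^bsub>B\<^esub> h a"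
  by (subst lift_superset[of "{a}"]) (auto simp: B.smult_closed h_closed)

lemma lift_closed: "f \<in> carrier P \<Longrightarrow> monoid_lift B h f \<in> carrier B"
  unfolding monoid_lift_def
  by (intro B.finsum_closed) (auto simp: monoid_star_algebra_simps B.smult_closed h_closed subset_iff)

lemma lift_plus:
  assumes "f \<in> carrier P" "g \<in> carrier P"
  shows "monoid_lift B h (f + g) = monoid_lift B h f \<oplus>\<^bsub>B\<^esub> monoid_lift B h g"
proof -
  let ?K = "Poly_Mapping.keys f \<union> Poly_Mapping.keys g"
  have K: "?K \<subseteq> carrier M" using assms by (auto simp: monoid_star_algebra_simps)
  have "monoid_lift B h (f + g) = (\<Oplus>\<^bsub>B\<^esub>a\<in>?K. Poly_Mapping.lookup (f + g) a \<odot>\<^bsub>B\<^esub> h a)"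
    using K Poly_Mapping.keys_add[of f g] by (intro lift_superset) auto
  also have "\<dots> = (\<Oplus>\<^bsub>B\<^esub>a\<in>?K. Poly_Mapping.lookup f a \<odot>\<^bsub>B\<^esub> h a \<oplus>\<^bsub>B\<^esub> Poly_Mapping.lookup g a \<odot>\<^bsub>B\<^esub> h a)"
    using K by (intro B.finsum_cong') (auto simp: lookup_add B.smult_closed h_closed B.smult_l_distr subset_iff)
  also have "\<dots> = (\<Oplus>\<^bsub>B\<^esub>a\<in>?K. Poly_Mapping.lookup f a \<odot>\<^bsub>B\<^esub> h a) \<oplus>\<^bsub>B\<^esub>
      (\<Oplus>\<^bsub>B\<^esub>a\<in>?K. Poly_Mapping.lookup g a \<odot>\<^bsub>B\<^esub> h a)"
    using K by (intro B.finsum_addf) (auto simp: B.smult_closed h_closed)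
  also have "\<dots> = monoid_lift B h f \<oplus>\<^bsub>B\<^esub> monoid_lift B h g"
    using K by (simp add: lift_superset[of ?K])
  finally show ?thesis .
qed

lemma lift_mult:
  assumes "f \<in> carrier P" "g \<in> carrier P"
  shows "monoid_lift B h (f \<otimes>\<^bsub>P\<^esub> g) = monoid_lift B h f \<otimes>\<^bsub>B\<^esub> monoid_lift B h g"
  using assms(1)
proof (induction f rule: monoid_algebra_induct)
  case (single a c)
  from assms(2) show ?case
    by (induction g rule: monoid_algebra_induct)
      (use \<open>a \<in> carrier M\<close> in \<open>simp_all add: mult_single_single mult_plus_right lift_single h_mult
        B.smult_smult[symmetric] mult.commute B.smult_mult_left B.smult_mult_right B.smult_closed h_closed lift_plus
        single_closed mult_closed lift_closed B.r_distr\<close>)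
qed (use assms(2) in \<open>simp_all add: mult_plus_left lift_plus lift_closed mult_closed B.l_distr\<close>)

lemma lift_star_hom: "star_hom P B (monoid_lift B h)"
  unfolding star_hom_def
proof (intro conjI ballI allI)
  show "monoid_lift B h \<in> ring_hom P B"
    by (rule ring_hom_memI)
      (auto simp: lift_closed lift_mult lift_plus lift_single h_one B.smult_one monoid_star_algebra_simps(2,4))
  show "monoid_lift B h (c \<odot>\<^bsub>P\<^esub> f) = c \<odot>\<^bsub>B\<^esub> monoid_lift B h f" if "f \<in> carrier P" for f c
  proof -
    interpret P: unital_star_algebra P by (rule star_algebra)
    from that show ?thesis
    proof (induction f rule: monoid_algebra_induct)
      case (plus f g)
      then show ?case
        using P.smult_r_distr[of f g c] P.smult_closed[of _ c]
        by (simp add: monoid_star_algebra_simps(4) lift_plus lift_closed B.smult_r_distr)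
    qed (simp add: monoid_star_algebra_simps(5) map_mult_single lift_single B.smult_smult h_closed)
  qed
  show "monoid_lift B h (adj P f) = adj B (monoid_lift B h f)" if "f \<in> carrier P" for f
    using that by (induction f rule: monoid_algebra_induct)
      (simp_all add: adj_single lift_single h_invol B.adj_smult h_closed invol_closed adj_plus lift_plus
        adj_P_closed lift_closed B.adj_add)
qed

end


section \<open>Free *-algebras\<close>

abbreviation word_monoid :: "'g set \<Rightarrow> ('g \<times> bool) list monoid" where
  "word_monoid X \<equiv> \<lparr> carrier = lists (X \<times> UNIV), monoid.mult = (@), one = [] \<rparr>"

abbreviation word_star :: "('g \<times> bool) list \<Rightarrow> ('g \<times> bool) list" where
  "word_star w \<equiv> rev (map (map_prod id Not) w)"

lemma star_monoid_words: "star_monoid (word_monoid X) word_star"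
proof unfold_locales
  show "word_star (word_star w) = w" for w :: "('g \<times> bool) list"
    by (induction w) auto
qed (auto simp: lists_eq_set)

lemma free_star_algebra: "unital_star_algebra (free_star_algebra X)"
  unfolding free_star_algebra_def by (rule star_monoid.star_algebra[OF star_monoid_words])

lemma free_gen_closed: "g \<in> X \<Longrightarrow> free_gen g \<in> carrier (free_star_algebra X)"
  by (auto simp: free_star_algebra_def free_gen_def monoid_star_algebra_simps)

primrec word_eval :: "('b, 'n) star_algebra_scheme \<Rightarrow> ('g \<Rightarrow> 'b) \<Rightarrow> ('g \<times> bool) list \<Rightarrow> 'b" where
  "word_eval B u [] = \<one>\<^bsub>B\<^esub>"
| "word_eval B u (l # w) = (if snd l then adj B (u (fst l)) else u (fst l)) \<otimes>\<^bsub>B\<^esub> word_eval B u w"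

definition free_lift :: "('b, 'n) star_algebra_scheme \<Rightarrow> ('g \<Rightarrow> 'b)
    \<Rightarrow> (('g \<times> bool) list \<Rightarrow>\<^sub>0 complex) \<Rightarrow> 'b" where
  "free_lift B u = monoid_lift B (word_eval B u)"

context unital_star_algebra
begin

text \<open>\<open>word_eval\<close> turns concatenation into products and \<open>word_star\<close>
  into the adjoint, so it is a homomorphism of monoids with involution, and its linear extension is
  the required one.\<close>

lemma
  assumes "\<And>g. g \<in> X \<Longrightarrow> u g \<in> carrier P"
  shows free_lift_hom: "star_homomorphism (free_star_algebra X) P (free_lift P u)"
    and free_lift_gen: "g \<in> X \<Longrightarrow> free_lift P u (free_gen g) = u g"
proof -
  have closed: "word_eval P u w \<in> carrier P" if "set w \<subseteq> X \<times> UNIV" for w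
    using that by (induction w) (auto simp: assms adj_closed)
  have append: "word_eval P u (v @ w) = word_eval P u v \<otimes> word_eval P u w"
    if "set v \<subseteq> X \<times> UNIV" "set w \<subseteq> X \<times> UNIV" for v w
    using that by (induction v) (auto simp: assms adj_closed closed m_assoc)
  have star: "word_eval P u (word_star w) = adj P (word_eval P u w)" if "set w \<subseteq> X \<times> UNIV" for w
    using that
  proof (induction w)
    case (Cons l w)
    then have "set (word_star w) \<subseteq> X \<times> UNIV" "set [map_prod id Not l] \<subseteq> X \<times> UNIV"
      by auto
    from append[OF this] have "word_eval P u (word_star (l # w)) =
        word_eval P u (word_star w) \<otimes> word_eval P u [map_prod id Not l]"
      by simp
    with Cons show ?case
      by (cases l) (auto simp: id_def adj_mult adj_adj adj_closed closed assms)
  qed (simp add: adj_one)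
  interpret star_monoid "word_monoid X" word_star
    by (rule star_monoid_words)
  interpret star_monoid_hom "word_monoid X" word_star P "word_eval P u"
    by unfold_locales (auto simp: closed append star lists_eq_set)
  show "star_homomorphism (free_star_algebra X) P (free_lift P u)"
    unfolding free_star_algebra_def free_lift_def star_homomorphism_def star_homomorphism_axioms_def
    using lift_star_hom star_algebra unital_star_algebra_axioms by blast
  show "free_lift P u (free_gen g) = u g" if "g \<in> X"
    using that assms[of g] by (simp add: free_lift_def free_gen_def lift_single smult_one)
qed

end

text \<open>Every word is a product of letters, and a letter is a generator or its adjoint. With
  this rule later arguments never look at words again.\<close>

lemma free_star_algebra_induct [consumes 1, case_names gen one smult add mult adj]:
  assumes x: "x \<in> carrier (free_star_algebra X)" 
    and gen: "\<And>g. g \<in> X \<Longrightarrow> Q (free_gen g)"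
    and one: "Q \<one>\<^bsub>free_star_algebra X\<^esub>"
    and smult: "\<And>c x. x \<in> carrier (free_star_algebra X) \<Longrightarrow> Q x \<Longrightarrow> Q (c \<odot>\<^bsub>free_star_algebra X\<^esub> x)"
    and add: "\<And>x y. x \<in> carrier (free_star_algebra X) \<Longrightarrow> y \<in> carrier (free_star_algebra X) \<Longrightarrow> Q x \<Longrightarrow> Q y \<Longrightarrow> Q (x \<oplus>\<^bsub>free_star_algebra X\<^esub> y)"
    and mult: "\<And>x y. x \<in> carrier (free_star_algebra X) \<Longrightarrow> y \<in> carrier (free_star_algebra X) \<Longrightarrow> Q x \<Longrightarrow> Q y \<Longrightarrow> Q (x \<otimes>\<^bsub>free_star_algebra X\<^esub> y)"
    and adj: "\<And>x. x \<in> carrier (free_star_algebra X) \<Longrightarrow> Q x \<Longrightarrow> Q (adj (free_star_algebra X) x)"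
  shows "Q x"
proof -
  let ?F = "free_star_algebra X"
  interpret star_monoid "word_monoid X" word_star
    by (rule star_monoid_words)
  have F: "?F = P" by (simp add: free_star_algebra_def)
  have word: "Q (Poly_Mapping.single w 1)" if "w \<in> lists (X \<times> UNIV)" for w
    using that
  proof (induction w)
    case Nil
    then show ?case using one by (simp add: F monoid_star_algebra_simps)
  next
    case (Cons l w)
    obtain g b where l: "l = (g, b)" "g \<in> X" using Cons by auto
    have "adj ?F (free_gen g) = Poly_Mapping.single [(g, True)] 1"
      unfolding F free_gen_def by (simp add: adj_single)
    then have "Q (Poly_Mapping.single [l] 1)"
      using gen[OF l(2)] adj[OF free_gen_closed[OF l(2)]] l by (cases b) (auto simp: free_gen_def)
    moreover have "Poly_Mapping.single (l # w) 1 = Poly_Mapping.single [l] 1 \<otimes>\<^bsub>?F\<^esub> Poly_Mapping.single w 1"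
      unfolding F by (simp add: mult_single_single)
    ultimately show ?case
      using mult[of "Poly_Mapping.single [l] 1" "Poly_Mapping.single w 1"] Cons l
      by (auto simp: F monoid_star_algebra_simps)
  qed
  have "Poly_Mapping.single w c = c \<odot>\<^bsub>?F\<^esub> Poly_Mapping.single w 1" for w c
    by (simp add: F monoid_star_algebra_simps map_mult_single)
  then have single: "Q (Poly_Mapping.single w c)" if "w \<in> lists (X \<times> UNIV)" for w c
    using smult[of "Poly_Mapping.single w 1" c] word[OF that] that by (simp add: F monoid_star_algebra_simps)
  have "x \<in> carrier P" using x by (simp add: F)
  then show ?thesis
    by (induction x rule: monoid_algebra_induct)
      (use single add in \<open>auto simp: F monoid_star_algebra_simps(4)\<close>)
qed


section \<open>C*-seminorms and completions\<close>

locale seminormed_star_algebra = unital_star_algebra P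
  for P :: "('a, 'm) star_algebra_scheme" (structure) +
  fixes N :: "'a \<Rightarrow> real"
  assumes cstar_seminorm: "cstar_seminorm P N"
begin

lemma
  assumes "x \<in> carrier P"
  shows N_smult: "N (c \<odot> x) = cmod c * N x"
    and N_cstar: "N (adj P x \<otimes> x) = (N x)\<^sup>2"
    and N_add: "y \<in> carrier P \<Longrightarrow> N (x \<oplus> y) \<le> N x + N y"
    and N_mult: "y \<in> carrier P \<Longrightarrow> N (x \<otimes> y) \<le> N x * N y"
  using cstar_seminorm assms by (auto simp: cstar_seminorm_def)

lemma N_zero: "N \<zero> = 0"
  using N_smult[OF zero_closed, of 0] by (simp add: smult_zero_right)

lemma N_a_inv: "x \<in> carrier P \<Longrightarrow> N (\<ominus> x) = N x"
  using N_smult[of x "-1"] by (simp add: smult_minus_one)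

lemma N_nonneg: "x \<in> carrier P \<Longrightarrow> 0 \<le> N x"
  using N_add[of x "\<ominus> x"] by (simp add: r_neg N_zero N_a_inv)

lemma N_diff: "\<lbrakk>x \<in> carrier P; y \<in> carrier P\<rbrakk> \<Longrightarrow> N (x \<ominus> y) \<le> N x + N y"
  using N_add[of x "\<ominus> y"] by (simp add: a_minus_def N_a_inv)

lemma N_diff_commute: "\<lbrakk>x \<in> carrier P; y \<in> carrier P\<rbrakk> \<Longrightarrow> N (x \<ominus> y) = N (y \<ominus> x)"
  using N_a_inv[of "x \<ominus> y"] by (simp add: a_minus_def minus_add a_comm)

lemma diff_add_diff: "\<lbrakk>x \<in> carrier P; y \<in> carrier P; z \<in> carrier P\<rbrakk> \<Longrightarrow> (x \<ominus> y) \<oplus> (y \<ominus> z) = x \<ominus> z"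
  by (simp add: a_minus_def a_assoc) (metis a_assoc a_inv_closed l_neg l_zero)

lemma N_triangle:
  "\<lbrakk>x \<in> carrier P; y \<in> carrier P; z \<in> carrier P\<rbrakk> \<Longrightarrow> N (x \<ominus> z) \<le> N (x \<ominus> y) + N (y \<ominus> z)"
  using N_add[of "x \<ominus> y" "y \<ominus> z"] by (simp add: diff_add_diff)

lemma diff_zero: "x \<in> carrier P \<Longrightarrow> x \<ominus> \<zero> = x"
  by (simp add: a_minus_def)

lemma N_abs_diff: "\<lbrakk>x \<in> carrier P; y \<in> carrier P\<rbrakk> \<Longrightarrow> \<bar>N x - N y\<bar> \<le> N (x \<ominus> y)"
  using N_triangle[of x y \<zero>] N_triangle[of y x \<zero>] by (simp add: N_diff_commute diff_zero)

text \<open>The C*-identity and submultiplicativity bound the square of \<open>N x\<close> by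
  \<open>N (adj P x) * N x\<close>; cancelling gives one inequality, and applying it to the adjoint
  gives the other.\<close>

lemma N_adj: "x \<in> carrier P \<Longrightarrow> N (adj P x) = N x"
proof -
  have *: "N x \<le> N (adj P x)" if "x \<in> carrier P" for x
  proof (cases "N x = 0")
    case True
    then show ?thesis using N_nonneg[of "adj P x"] that by (simp add: adj_closed)
  next
    case False
    have "N x * N x \<le> N (adj P x) * N x"
      using N_cstar[OF that] N_mult[of "adj P x" x] that by (simp add: power2_eq_square adj_closed)
    then show ?thesis using False N_nonneg[OF that] by simp
  qed
  assume "x \<in> carrier P"
  then show ?thesis using *[of x] *[of "adj P x"] by (simp add: adj_closed adj_adj)
qed

text \<open>As 1 is its own adjoint and square, its seminorm is an idempotent real number. It can be
  0, as in the zero algebra, hence no equality.\<close>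

lemma N_one_le: "N \<one> \<le> 1"
proof -
  have "N \<one> = N \<one> * N \<one>"
    using N_cstar[OF one_closed] by (simp add: adj_one power2_eq_square)
  then show ?thesis
    by (metis mult_cancel_right1 order_refl zero_le_one)
qed

lemma N_finsum: "(\<And>i. i \<in> I \<Longrightarrow> f i \<in> carrier P) \<Longrightarrow> N (\<Oplus>i\<in>I. f i) \<le> (\<Sum>i\<in>I. N (f i))"
proof (induction I rule: infinite_finite_induct)
  case (insert i I)
  then have "N (\<Oplus>i\<in>insert i I. f i) \<le> N (f i) + N (\<Oplus>i\<in>I. f i)"
    by (simp add: Pi_iff N_add finsum_closed)
  also have "\<dots> \<le> N (f i) + (\<Sum>i\<in>I. N (f i))"
    using insert by simp
  finally show ?case using insert by simp
qed (auto simp: N_zero finsum_infinite)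

text \<open>The filter is a parameter so that one set of rules serves twice: along
  \<open>sequentially\<close> it expresses that two sequences have the same class in the completion,
  along the product filter it is the Cauchy condition.\<close>

definition near :: "'i filter \<Rightarrow> ('i \<Rightarrow> 'a) \<Rightarrow> ('i \<Rightarrow> 'a) \<Rightarrow> bool" where
  "near F x y \<longleftrightarrow> (\<forall>i. x i \<in> carrier P) \<and> (\<forall>i. y i \<in> carrier P) \<and>
     ((\<lambda>i. N (x i \<ominus> y i)) \<longlongrightarrow> 0) F"

lemma near_bound:
  assumes "\<And>i. x i \<in> carrier P" "\<And>i. y i \<in> carrier P"
    and "\<And>i. N (x i \<ominus> y i) \<le> f i" "(f \<longlongrightarrow> 0) F"
  shows "near F x y"
  unfolding near_def using assms
  by (auto intro!: tendsto_sandwich[OF _ _ tendsto_const assms(4)] always_eventually N_nonneg)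

lemma nearD: "near F x y \<Longrightarrow> ((\<lambda>i. N (x i \<ominus> y i)) \<longlongrightarrow> 0) F"
  and near_closed: "near F x y \<Longrightarrow> x i \<in> carrier P" "near F x y \<Longrightarrow> y i \<in> carrier P"
  by (auto simp: near_def)

lemma near_refl: "(\<And>i. x i \<in> carrier P) \<Longrightarrow> near F x x"
  by (simp add: near_def a_minus_def r_neg N_zero)

lemma near_sym: "near F x y \<Longrightarrow> near F y x"
  by (rule near_bound[of _ _ "\<lambda>i. N (x i \<ominus> y i)"]) (auto simp: near_def intro: eq_refl N_diff_commute)

lemma near_trans: "near F x y \<Longrightarrow> near F y z \<Longrightarrow> near F x z"
  by (rule near_bound[of _ _ "\<lambda>i. N (x i \<ominus> y i) + N (y i \<ominus> z i)"])
    (auto simp: near_def N_triangle intro!: tendsto_eq_intros)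

lemma near_add:
  assumes "near F x y" "near F x' y'"
  shows "near F (\<lambda>i. x i \<oplus> x' i) (\<lambda>i. y i \<oplus> y' i)"
proof (rule near_bound[of _ _ "\<lambda>i. N (x i \<ominus> y i) + N (x' i \<ominus> y' i)"])
  fix i
  note c = near_closed[OF assms(1), of i] near_closed[OF assms(2), of i]
  have "(x i \<oplus> x' i) \<ominus> (y i \<oplus> y' i) = (x i \<ominus> y i) \<oplus> (x' i \<ominus> y' i)"
    using c by (simp add: a_minus_def minus_add a_ac)
  then show "N ((x i \<oplus> x' i) \<ominus> (y i \<oplus> y' i)) \<le> N (x i \<ominus> y i) + N (x' i \<ominus> y' i)"
    using c by (simp add: N_add)
qed (use assms in \<open>auto simp: near_def intro!: tendsto_eq_intros\<close>)

lemma near_smult: "near F x y \<Longrightarrow> near F (\<lambda>i. c \<odot> x i) (\<lambda>i. c \<odot> y i)"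
  by (rule near_bound[of _ _ "\<lambda>i. cmod c * N (x i \<ominus> y i)"])
    (auto simp: near_def smult_closed smult_diff[symmetric] N_smult intro!: tendsto_eq_intros)

lemma near_a_inv: "near F x y \<Longrightarrow> near F (\<lambda>i. \<ominus> x i) (\<lambda>i. \<ominus> y i)"
  using near_smult[of F x y "-1"] near_closed[of F x y] by (simp add: smult_minus_one)

lemma near_adj: "near F x y \<Longrightarrow> near F (\<lambda>i. adj P (x i)) (\<lambda>i. adj P (y i))"
  by (rule near_bound[of _ _ "\<lambda>i. N (x i \<ominus> y i)"])
    (auto simp: near_def adj_closed adj_diff[symmetric] N_adj)

text \<open>From x x' - y y' = (x - y) x' + y (x' - y'): this splitting only needs bounds for x' and
  for y.\<close>

lemma near_mult:
  assumes "near F x y" "near F x' y'" and B: "\<And>i. N (x' i) \<le> B" "\<And>i. N (y i) \<le> C"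
  shows "near F (\<lambda>i. x i \<otimes> x' i) (\<lambda>i. y i \<otimes> y' i)"
proof (rule near_bound[of _ _ "\<lambda>i. N (x i \<ominus> y i) * B + C * N (x' i \<ominus> y' i)"])
  fix i
  note c = near_closed[OF assms(1), of i] near_closed[OF assms(2), of i]
  have "x i \<otimes> x' i \<ominus> y i \<otimes> y' i = (x i \<otimes> x' i \<ominus> y i \<otimes> x' i) \<oplus> (y i \<otimes> x' i \<ominus> y i \<otimes> y' i)"
    using c by (simp add: diff_add_diff)
  also have "\<dots> = (x i \<ominus> y i) \<otimes> x' i \<oplus> y i \<otimes> (x' i \<ominus> y' i)"
    using c by (simp add: a_minus_def l_distr r_distr l_minus r_minus)
  finally have "N (x i \<otimes> x' i \<ominus> y i \<otimes> y' i) \<le> N ((x i \<ominus> y i) \<otimes> x' i) + N (y i \<otimes> (x' i \<ominus> y' i))"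
    using c by (simp add: N_add)
  also have "\<dots> \<le> N (x i \<ominus> y i) * N (x' i) + N (y i) * N (x' i \<ominus> y' i)"
    using c by (intro add_mono N_mult) auto
  also have "\<dots> \<le> N (x i \<ominus> y i) * B + C * N (x' i \<ominus> y' i)"
    using c B by (intro add_mono mult_left_mono mult_right_mono N_nonneg) auto
  finally show "N (x i \<otimes> x' i \<ominus> y i \<otimes> y' i) \<le> N (x i \<ominus> y i) * B + C * N (x' i \<ominus> y' i)" .
qed (use assms in \<open>auto simp: near_def intro!: tendsto_eq_intros\<close>)

lemma near_norm: "near F x y \<Longrightarrow> (\<lambda>i. N (x i)) = f \<Longrightarrow> ((\<lambda>i. N (y i)) \<longlongrightarrow> l) F \<Longrightarrow> (f \<longlongrightarrow> l) F"
proof -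
  assume xy: "near F x y" "(\<lambda>i. N (x i)) = f" and l: "((\<lambda>i. N (y i)) \<longlongrightarrow> l) F"
  have "((\<lambda>i. N (x i) - N (y i)) \<longlongrightarrow> 0) F"
    by (rule tendsto_0_le[OF nearD[OF xy(1)], of _ 1])
      (use xy in \<open>auto simp: near_def intro!: always_eventually order_trans[OF N_abs_diff]\<close>)
  from tendsto_add[OF this l] show ?thesis using xy by auto
qed

lemma cauchy_seqs_iff_near:
  "x \<in> cauchy_seqs P N \<longleftrightarrow> near (sequentially \<times>\<^sub>F sequentially) (\<lambda>(m, n). x m) (\<lambda>(m, n). x n)"
  unfolding near_def cauchy_seqs_def tendsto_iff eventually_prod_sequentially dist_real_def
  by (auto simp: N_nonneg) metis+

lemma cauchy_seqs_closed: "x \<in> cauchy_seqs P N \<Longrightarrow> x n \<in> carrier P"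
  by (auto simp: cauchy_seqs_def)

lemma cauchy_seqs_norm:
  assumes "x \<in> cauchy_seqs P N"
  shows "convergent (\<lambda>n. N (x n))"
proof (rule Cauchy_convergent, rule metric_CauchyI)
  fix \<epsilon> :: real assume "\<epsilon> > 0"
  with assms obtain M where M: "\<And>m n. m \<ge> M \<Longrightarrow> n \<ge> M \<Longrightarrow> N (x m \<ominus> x n) < \<epsilon>"
    unfolding cauchy_seqs_def by blast
  show "\<exists>M. \<forall>m\<ge>M. \<forall>n\<ge>M. dist (N (x m)) (N (x n)) < \<epsilon>"
  proof (intro exI[of _ M] allI impI)
    fix m n assume "m \<ge> M" "n \<ge> M"
    then show "dist (N (x m)) (N (x n)) < \<epsilon>"
      using N_abs_diff[of "x m" "x n"] M[of m n] assms by (auto simp: dist_real_def cauchy_seqs_def)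
  qed
qed

lemma cauchy_seqs_bounded:
  assumes "x \<in> cauchy_seqs P N"
  shows "\<exists>B. \<forall>n. N (x n) \<le> B"
  using convergent_imp_Bseq[OF cauchy_seqs_norm[OF assms]] unfolding Bseq_def
  by (metis abs_le_D1 real_norm_def)

lemma cauchy_seqs_const: "a \<in> carrier P \<Longrightarrow> (\<lambda>n. a) \<in> cauchy_seqs P N"
  by (simp add: cauchy_seqs_def a_minus_def r_neg N_zero)

lemma
  assumes "x \<in> cauchy_seqs P N"
  shows cauchy_seqs_smult: "(\<lambda>n. c \<odot> x n) \<in> cauchy_seqs P N"
    and cauchy_seqs_adj: "(\<lambda>n. adj P (x n)) \<in> cauchy_seqs P N"
    and cauchy_seqs_a_inv: "(\<lambda>n. \<ominus> x n) \<in> cauchy_seqs P N"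
    and cauchy_seqs_add: "y \<in> cauchy_seqs P N \<Longrightarrow> (\<lambda>n. x n \<oplus> y n) \<in> cauchy_seqs P N"
  using assms near_smult[of "sequentially \<times>\<^sub>F sequentially" "\<lambda>(m, n). x m" "\<lambda>(m, n). x n"]
    near_adj[of "sequentially \<times>\<^sub>F sequentially" "\<lambda>(m, n). x m" "\<lambda>(m, n). x n"]
    near_a_inv[of "sequentially \<times>\<^sub>F sequentially" "\<lambda>(m, n). x m" "\<lambda>(m, n). x n"]
    near_add[of "sequentially \<times>\<^sub>F sequentially" "\<lambda>(m, n). x m" "\<lambda>(m, n). x n"
      "\<lambda>(m, n). y m" "\<lambda>(m, n). y n"]
  unfolding cauchy_seqs_iff_near by (simp_all add: case_prod_unfold)

lemma cauchy_seqs_diff: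
  "x \<in> cauchy_seqs P N \<Longrightarrow> y \<in> cauchy_seqs P N \<Longrightarrow> (\<lambda>n. x n \<ominus> y n) \<in> cauchy_seqs P N"
  using cauchy_seqs_add[OF _ cauchy_seqs_a_inv, of x y] by (simp add: a_minus_def)

lemma cauchy_seqs_mult:
  assumes "x \<in> cauchy_seqs P N" "y \<in> cauchy_seqs P N"
  shows "(\<lambda>n. x n \<otimes> y n) \<in> cauchy_seqs P N"
proof -
  obtain B C where B: "\<And>n. N (x n) \<le> B" "\<And>n. N (y n) \<le> C"
    using cauchy_seqs_bounded[OF assms(1)] cauchy_seqs_bounded[OF assms(2)] by blast
  show ?thesis
    using near_mult[of "sequentially \<times>\<^sub>F sequentially" "\<lambda>(m, n). x m" "\<lambda>(m, n). x n"
      "\<lambda>(m, n). y m" "\<lambda>(m, n). y n" C B] assms B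
    unfolding cauchy_seqs_iff_near by (simp add: case_prod_unfold)
qed

section \<open>The completion as a C*-algebra\<close>

lemma null_rel_iff: "(x, y) \<in> null_rel P N \<longleftrightarrow>
    x \<in> cauchy_seqs P N \<and> y \<in> cauchy_seqs P N \<and> near sequentially x y"
  by (auto simp: null_rel_def near_def cauchy_seqs_closed)

lemma equiv_null_rel: "equiv (cauchy_seqs P N) (null_rel P N)"
proof (rule equivI)
  show "refl_on (cauchy_seqs P N) (null_rel P N)"
    by (auto simp: refl_on_def null_rel_iff near_refl cauchy_seqs_closed)
  show "sym (null_rel P N)"
    by (auto intro!: symI simp: null_rel_iff near_sym)
  show "trans (null_rel P N)"
    by (auto intro!: transI simp: null_rel_iff intro: near_trans)
qed (auto simp: null_rel_iff)

lemma seq_class_eq_iff: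
  "x \<in> cauchy_seqs P N \<Longrightarrow> y \<in> cauchy_seqs P N \<Longrightarrow>
    seq_class P N x = seq_class P N y \<longleftrightarrow> near sequentially x y"
  unfolding seq_class_def
  by (subst eq_equiv_class_iff[OF equiv_null_rel]) (auto simp: null_rel_iff)

text \<open>The operations of \<open>completion\<close> work on representatives picked by
  \<open>SOME\<close>. Whichever member is picked, it differs from x by a null sequence, and this is
  all that the rules for \<open>cls\<close> use.\<close>

lemma
  assumes "x \<in> cauchy_seqs P N"
  shows seq_rep_cauchy: "seq_rep (seq_class P N x) \<in> cauchy_seqs P N"
    and seq_rep_near: "near sequentially (seq_rep (seq_class P N x)) x"
proof -
  have "x \<in> seq_class P N x"
    using assms by (auto simp: seq_class_def null_rel_iff near_refl cauchy_seqs_closed)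
  then have "seq_rep (seq_class P N x) \<in> seq_class P N x"
    unfolding seq_rep_def by (rule someI[where P = "\<lambda>y. y \<in> seq_class P N x"])
  then have "(x, seq_rep (seq_class P N x)) \<in> null_rel P N"
    by (simp add: seq_class_def)
  then show "seq_rep (seq_class P N x) \<in> cauchy_seqs P N" "near sequentially (seq_rep (seq_class P N x)) x"
    by (auto simp: null_rel_iff near_sym)
qed

abbreviation K where "K \<equiv> completion P N"
abbreviation cls where "cls \<equiv> seq_class P N"

lemma completion_carrier: "carrier K = cls ` cauchy_seqs P N"
  by (auto simp: completion_def quotient_def seq_class_def)

lemma completion_cases:
  assumes "X \<in> carrier K"
  obtains x where "x \<in> cauchy_seqs P N" "X = cls x"
  using assms by (auto simp: completion_carrier)

lemma cls_closed: "x \<in> cauchy_seqs P N \<Longrightarrow> cls x \<in> carrier K"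
  by (auto simp: completion_carrier)

lemma cls_add: "x \<in> cauchy_seqs P N \<Longrightarrow> y \<in> cauchy_seqs P N \<Longrightarrow>
    cls x \<oplus>\<^bsub>K\<^esub> cls y = cls (\<lambda>n. x n \<oplus> y n)"
  by (simp add: completion_def seq_class_eq_iff cauchy_seqs_add seq_rep_cauchy seq_rep_near near_add)

lemma cls_mult:
  assumes "x \<in> cauchy_seqs P N" "y \<in> cauchy_seqs P N"
  shows "cls x \<otimes>\<^bsub>K\<^esub> cls y = cls (\<lambda>n. x n \<otimes> y n)"
proof -
  obtain B C where B: "\<And>n. N (x n) \<le> B" "\<And>n. N (seq_rep (cls y) n) \<le> C"
    using cauchy_seqs_bounded[OF assms(1)] cauchy_seqs_bounded[OF seq_rep_cauchy[OF assms(2)]] by blast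
  from near_mult[OF seq_rep_near[OF assms(1)] seq_rep_near[OF assms(2)] B(2,1)] assms show ?thesis
    by (simp add: completion_def seq_class_eq_iff cauchy_seqs_mult seq_rep_cauchy)
qed

lemma cls_smult: "x \<in> cauchy_seqs P N \<Longrightarrow> c \<odot>\<^bsub>K\<^esub> cls x = cls (\<lambda>n. c \<odot> x n)"
  by (simp add: completion_def seq_class_eq_iff cauchy_seqs_smult seq_rep_cauchy seq_rep_near near_smult)

lemma cls_adj: "x \<in> cauchy_seqs P N \<Longrightarrow> adj K (cls x) = cls (\<lambda>n. adj P (x n))"
  by (simp add: completion_def seq_class_eq_iff cauchy_seqs_adj seq_rep_cauchy seq_rep_near near_adj)

lemma completion_one: "\<one>\<^bsub>K\<^esub> = cls (\<lambda>n. \<one>)" and completion_zero: "\<zero>\<^bsub>K\<^esub> = cls (\<lambda>n. \<zero>)"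
  by (simp_all add: completion_def)

lemma cls_nrm:
  assumes "x \<in> cauchy_seqs P N"
  shows "(\<lambda>n. N (x n)) \<longlonglongrightarrow> nrm K (cls x)"
proof -
  have "(\<lambda>n. N (seq_rep (cls x) n)) \<longlonglongrightarrow> nrm K (cls x)"
    using cauchy_seqs_norm[OF seq_rep_cauchy[OF assms]]
    by (simp add: completion_def convergent_LIMSEQ_iff)
  then show ?thesis
    by (rule near_norm[OF near_sym[OF seq_rep_near[OF assms]] refl])
qed

lemma cls_nrm_eqI: "x \<in> cauchy_seqs P N \<Longrightarrow> (\<lambda>n. N (x n)) \<longlonglongrightarrow> l \<Longrightarrow> nrm K (cls x) = l"
  using cls_nrm LIMSEQ_unique by blast

lemma completion_star_algebra: "unital_star_algebra K"
proof -
  note cauchy = cauchy_seqs_const[OF one_closed] cauchy_seqs_const[OF zero_closed] cauchy_seqs_add cauchy_seqs_mult cauchy_seqs_smult cauchy_seqs_adj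
    cauchy_seqs_a_inv
  note cls = cls_add cls_mult cls_smult cls_adj completion_one completion_zero
  have "abelian_group K"
  proof (rule abelian_groupI)
    fix X Y Z assume XYZ: "X \<in> carrier K" "Y \<in> carrier K" "Z \<in> carrier K"
    then obtain x y z where x: "x \<in> cauchy_seqs P N" "X = cls x" "y \<in> cauchy_seqs P N" "Y = cls y"
      "z \<in> cauchy_seqs P N" "Z = cls z" by (auto elim!: completion_cases)
    show "X \<oplus>\<^bsub>K\<^esub> Y \<in> carrier K" "X \<oplus>\<^bsub>K\<^esub> Y = Y \<oplus>\<^bsub>K\<^esub> X"
      "X \<oplus>\<^bsub>K\<^esub> Y \<oplus>\<^bsub>K\<^esub> Z = X \<oplus>\<^bsub>K\<^esub> (Y \<oplus>\<^bsub>K\<^esub> Z)" "\<zero>\<^bsub>K\<^esub> \<oplus>\<^bsub>K\<^esub> X = X"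
      using x by (simp_all add: cls cls_closed cauchy cauchy_seqs_closed a_ac)
    show "\<exists>Y\<in>carrier K. Y \<oplus>\<^bsub>K\<^esub> X = \<zero>\<^bsub>K\<^esub>"
      using x by (intro bexI[of _ "cls (\<lambda>n. \<ominus> x n)"])
        (simp_all add: cls cls_closed cauchy l_neg cauchy_seqs_closed)
  qed (simp add: cls cls_closed cauchy)
  moreover have "monoid K"
  proof (rule monoidI)
    fix X Y Z assume XYZ: "X \<in> carrier K" "Y \<in> carrier K" "Z \<in> carrier K"
    then obtain x y z where x: "x \<in> cauchy_seqs P N" "X = cls x" "y \<in> cauchy_seqs P N" "Y = cls y"
      "z \<in> cauchy_seqs P N" "Z = cls z" by (auto elim!: completion_cases)
    show "X \<otimes>\<^bsub>K\<^esub> Y \<in> carrier K" "X \<otimes>\<^bsub>K\<^esub> Y \<otimes>\<^bsub>K\<^esub> Z = X \<otimes>\<^bsub>K\<^esub> (Y \<otimes>\<^bsub>K\<^esub> Z)"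
      "\<one>\<^bsub>K\<^esub> \<otimes>\<^bsub>K\<^esub> X = X" "X \<otimes>\<^bsub>K\<^esub> \<one>\<^bsub>K\<^esub> = X"
      using x by (simp_all add: cls cls_closed cauchy cauchy_seqs_closed m_assoc)
  qed (simp add: cls cls_closed cauchy)
  ultimately have "ring K"
  proof (rule ringI)
    fix X Y Z assume XYZ: "X \<in> carrier K" "Y \<in> carrier K" "Z \<in> carrier K"
    then obtain x y z where x: "x \<in> cauchy_seqs P N" "X = cls x" "y \<in> cauchy_seqs P N" "Y = cls y"
      "z \<in> cauchy_seqs P N" "Z = cls z" by (auto elim!: completion_cases)
    show "(X \<oplus>\<^bsub>K\<^esub> Y) \<otimes>\<^bsub>K\<^esub> Z = X \<otimes>\<^bsub>K\<^esub> Z \<oplus>\<^bsub>K\<^esub> Y \<otimes>\<^bsub>K\<^esub> Z"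
      "Z \<otimes>\<^bsub>K\<^esub> (X \<oplus>\<^bsub>K\<^esub> Y) = Z \<otimes>\<^bsub>K\<^esub> X \<oplus>\<^bsub>K\<^esub> Z \<otimes>\<^bsub>K\<^esub> Y"
      using x by (simp_all add: cls cauchy cauchy_seqs_closed l_distr r_distr)
  qed
  then interpret K: ring K .
  show ?thesis
  proof unfold_locales
    fix X Y c d assume XY: "X \<in> carrier K" "Y \<in> carrier K"
    then obtain x y where x: "x \<in> cauchy_seqs P N" "X = cls x" "y \<in> cauchy_seqs P N" "Y = cls y"
      by (auto elim!: completion_cases)
    show "c \<odot>\<^bsub>K\<^esub> X \<in> carrier K" "(c + d) \<odot>\<^bsub>K\<^esub> X = c \<odot>\<^bsub>K\<^esub> X \<oplus>\<^bsub>K\<^esub> d \<odot>\<^bsub>K\<^esub> X"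
      "c \<odot>\<^bsub>K\<^esub> (X \<oplus>\<^bsub>K\<^esub> Y) = c \<odot>\<^bsub>K\<^esub> X \<oplus>\<^bsub>K\<^esub> c \<odot>\<^bsub>K\<^esub> Y"
      "(c * d) \<odot>\<^bsub>K\<^esub> X = c \<odot>\<^bsub>K\<^esub> (d \<odot>\<^bsub>K\<^esub> X)" "1 \<odot>\<^bsub>K\<^esub> X = X"
      "(c \<odot>\<^bsub>K\<^esub> X) \<otimes>\<^bsub>K\<^esub> Y = c \<odot>\<^bsub>K\<^esub> (X \<otimes>\<^bsub>K\<^esub> Y)" "X \<otimes>\<^bsub>K\<^esub> (c \<odot>\<^bsub>K\<^esub> Y) = c \<odot>\<^bsub>K\<^esub> (X \<otimes>\<^bsub>K\<^esub> Y)"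
      using x by (simp_all add: cls cls_closed cauchy cauchy_seqs_closed smult_l_distr smult_r_distr
          smult_smult smult_one smult_mult_left smult_mult_right)
    show "adj K X \<in> carrier K" "adj K (adj K X) = X" "adj K (X \<oplus>\<^bsub>K\<^esub> Y) = adj K X \<oplus>\<^bsub>K\<^esub> adj K Y"
      "adj K (c \<odot>\<^bsub>K\<^esub> X) = cnj c \<odot>\<^bsub>K\<^esub> adj K X" "adj K (X \<otimes>\<^bsub>K\<^esub> Y) = adj K Y \<otimes>\<^bsub>K\<^esub> adj K X"
      using x by (simp_all add: cls cls_closed cauchy cauchy_seqs_closed adj_adj adj_add adj_smult adj_mult)
  qed
qed

sublocale K: unital_star_algebra K
  by (rule completion_star_algebra)

lemma cls_a_inv: "x \<in> cauchy_seqs P N \<Longrightarrow> \<ominus>\<^bsub>K\<^esub> cls x = cls (\<lambda>n. \<ominus> x n)"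
  by (rule K.minus_equality)
    (simp_all add: cls_add cls_closed cauchy_seqs_a_inv completion_zero l_neg cauchy_seqs_closed)

lemma cls_diff: "x \<in> cauchy_seqs P N \<Longrightarrow> y \<in> cauchy_seqs P N \<Longrightarrow>
    cls x \<ominus>\<^bsub>K\<^esub> cls y = cls (\<lambda>n. x n \<ominus> y n)"
  by (simp add: a_minus_def cls_add cls_a_inv cauchy_seqs_a_inv)

lemma completion_seminorm: "cstar_seminorm K (nrm K)"
proof -
  have add: "nrm K (X \<oplus>\<^bsub>K\<^esub> Y) \<le> nrm K X + nrm K Y"
    and mult: "nrm K (X \<otimes>\<^bsub>K\<^esub> Y) \<le> nrm K X * nrm K Y" if XY: "X \<in> carrier K" "Y \<in> carrier K" for X Y
  proof -
    obtain x y where x: "x \<in> cauchy_seqs P N" "X = cls x" "y \<in> cauchy_seqs P N" "Y = cls y"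
      using XY by (meson completion_cases)
    show "nrm K (X \<oplus>\<^bsub>K\<^esub> Y) \<le> nrm K X + nrm K Y"
      unfolding x(2,4) cls_add[OF x(1,3)]
      by (rule LIMSEQ_le[OF cls_nrm[OF cauchy_seqs_add] tendsto_add[OF cls_nrm cls_nrm]])
        (use x in \<open>auto simp: N_add cauchy_seqs_closed\<close>)
    show "nrm K (X \<otimes>\<^bsub>K\<^esub> Y) \<le> nrm K X * nrm K Y"
      unfolding x(2,4) cls_mult[OF x(1,3)]
      by (rule LIMSEQ_le[OF cls_nrm[OF cauchy_seqs_mult] tendsto_mult[OF cls_nrm cls_nrm]])
        (use x in \<open>auto simp: N_mult cauchy_seqs_closed\<close>)
  qed
  have smult: "nrm K (c \<odot>\<^bsub>K\<^esub> X) = cmod c * nrm K X"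
    and cstar: "nrm K (adj K X \<otimes>\<^bsub>K\<^esub> X) = (nrm K X)\<^sup>2" if X: "X \<in> carrier K" for c X
  proof -
    obtain x where x: "x \<in> cauchy_seqs P N" "X = cls x"
      using X by (rule completion_cases)
    have "(\<lambda>n. N (c \<odot> x n)) = (\<lambda>n. cmod c * N (x n))"
      using x by (simp add: N_smult cauchy_seqs_closed)
    then show "nrm K (c \<odot>\<^bsub>K\<^esub> X) = cmod c * nrm K X"
      using x by (auto simp: cls_smult intro!: cls_nrm_eqI cauchy_seqs_smult tendsto_mult cls_nrm)
    have "(\<lambda>n. N (adj P (x n) \<otimes> x n)) = (\<lambda>n. (N (x n))\<^sup>2)"
      using x by (simp add: N_cstar cauchy_seqs_closed)
    then show "nrm K (adj K X \<otimes>\<^bsub>K\<^esub> X) = (nrm K X)\<^sup>2"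
      using x by (auto simp: cls_adj cls_mult cauchy_seqs_adj
          intro!: cls_nrm_eqI cauchy_seqs_adj cauchy_seqs_mult tendsto_power cls_nrm)
  qed
  show ?thesis
    by (simp add: cstar_seminorm_def add mult smult cstar)
qed

text \<open>Not a sublocale, which would iterate the completion indefinitely.\<close>

interpretation K: seminormed_star_algebra K "nrm K"
  by unfold_locales (rule completion_seminorm)

abbreviation \<iota> where "\<iota> \<equiv> to_completion P N"

lemma to_completion_closed: "a \<in> carrier P \<Longrightarrow> \<iota> a \<in> carrier K"
  by (simp add: to_completion_def cls_closed cauchy_seqs_const)

lemma nrm_to_completion: "a \<in> carrier P \<Longrightarrow> nrm K (\<iota> a) = N a"
  unfolding to_completion_def by (rule cls_nrm_eqI[OF cauchy_seqs_const]) auto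

sublocale \<iota>: star_homomorphism P K \<iota>
proof unfold_locales
  have "\<iota> \<in> ring_hom P K"
    by (rule ring_hom_memI)
      (simp_all add: to_completion_closed, simp_all add: to_completion_def cls_add cls_mult
        cauchy_seqs_const completion_one)
  then show "star_hom P K \<iota>"
    by (simp add: star_hom_def) (simp add: to_completion_def cls_smult cls_adj cauchy_seqs_const)
qed

text \<open>The norm in question is the limit over m of \<open>N (x n \<ominus> x m)\<close>. The
  Cauchy condition is invoked with \<epsilon> / 2 since a limit only preserves the weak
  inequality.\<close>

lemma to_completion_tendsto:
  assumes x: "x \<in> cauchy_seqs P N"
  shows "(\<lambda>n. nrm K (\<iota> (x n) \<ominus>\<^bsub>K\<^esub> cls x)) \<longlonglongrightarrow> 0"
proof (rule LIMSEQ_I)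
  fix \<epsilon> :: real assume "\<epsilon> > 0"
  then obtain M where M: "\<And>m n. m \<ge> M \<Longrightarrow> n \<ge> M \<Longrightarrow> N (x m \<ominus> x n) < \<epsilon> / 2"
    using x half_gt_zero[of \<epsilon>] unfolding cauchy_seqs_def mem_Collect_eq by blast
  have "nrm K (\<iota> (x n) \<ominus>\<^bsub>K\<^esub> cls x) < \<epsilon>" if n: "n \<ge> M" for n
  proof -
    have c: "(\<lambda>k. x n) \<in> cauchy_seqs P N"
      using x by (intro cauchy_seqs_const) (rule cauchy_seqs_closed)
    have "(\<lambda>m. N (x n \<ominus> x m)) \<longlonglongrightarrow> nrm K (\<iota> (x n) \<ominus>\<^bsub>K\<^esub> cls x)"
      using cls_nrm[OF cauchy_seqs_diff[OF c x]] by (simp add: to_completion_def cls_diff[OF c x])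
    then have "nrm K (\<iota> (x n) \<ominus>\<^bsub>K\<^esub> cls x) \<le> \<epsilon> / 2"
      by (rule LIMSEQ_le_const2) (use M[OF n] in \<open>auto intro!: exI[of _ M] less_imp_le\<close>)
    then show ?thesis using \<open>\<epsilon> > 0\<close> by simp
  qed
  then show "\<exists>M. \<forall>n\<ge>M. norm (nrm K (\<iota> (x n) \<ominus>\<^bsub>K\<^esub> cls x) - 0) < \<epsilon>"
    using x by (auto simp: K.N_nonneg to_completion_closed cauchy_seqs_closed cls_closed)
qed

lemma to_completion_dense:
  assumes "X \<in> carrier K" "\<epsilon> > 0"
  obtains a where "a \<in> carrier P" "nrm K (X \<ominus>\<^bsub>K\<^esub> \<iota> a) < \<epsilon>"
proof -
  obtain x where x: "x \<in> cauchy_seqs P N" "X = cls x"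
    using assms(1) by (rule completion_cases)
  then obtain n where "nrm K (\<iota> (x n) \<ominus>\<^bsub>K\<^esub> cls x) < \<epsilon>"
    using order_tendstoD(2)[OF to_completion_tendsto[OF x(1)] assms(2)]
    by (auto simp: eventually_sequentially)
  then show ?thesis
    using x that[of "x n"] by (simp add: K.N_diff_commute to_completion_closed cauchy_seqs_closed cls_closed)
qed

text \<open>The n-th term is approximated within 1 / (n + 1) by the image of some a n from P. These
  elements form a Cauchy sequence in P, whose class is the limit.\<close>

lemma completion_complete:
  assumes s: "s \<in> cauchy_seqs K (nrm K)"
  shows "\<exists>l\<in>carrier K. (\<lambda>n. nrm K (s n \<ominus>\<^bsub>K\<^esub> l)) \<longlonglongrightarrow> 0"
proof -
  have "\<exists>a. a \<in> carrier P \<and> nrm K (s n \<ominus>\<^bsub>K\<^esub> \<iota> a) < inverse (real (Suc n))" for n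
    using to_completion_dense[of "s n" "inverse (real (Suc n))"] K.cauchy_seqs_closed[OF s, of n] by auto
  then obtain a where a: "\<And>n. a n \<in> carrier P" "\<And>n. nrm K (s n \<ominus>\<^bsub>K\<^esub> \<iota> (a n)) < inverse (real (Suc n))"
    by metis
  have near: "K.near sequentially s (\<lambda>n. \<iota> (a n))"
    by (rule K.near_bound[OF _ _ _ LIMSEQ_inverse_real_of_nat])
      (auto simp del: of_nat_Suc simp: K.cauchy_seqs_closed[OF s] a to_completion_closed less_imp_le)
  have fst: "filterlim fst sequentially (sequentially \<times>\<^sub>F sequentially)"
    and snd: "filterlim snd sequentially (sequentially \<times>\<^sub>F sequentially)"
    by (auto simp: filterlim_iff eventually_prod_sequentially eventually_sequentially)
  have "K.near (sequentially \<times>\<^sub>F sequentially) (\<lambda>(m, n). \<iota> (a m)) (\<lambda>(m, n). s m)"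
    "K.near (sequentially \<times>\<^sub>F sequentially) (\<lambda>(m, n). s n) (\<lambda>(m, n). \<iota> (a n))"
    using K.near_sym[OF near] near filterlim_compose[OF K.nearD[OF near] snd]
      filterlim_compose[OF K.nearD[OF K.near_sym[OF near]] fst]
    unfolding K.near_def by (auto simp: case_prod_unfold)
  then have "K.near (sequentially \<times>\<^sub>F sequentially) (\<lambda>(m, n). \<iota> (a m)) (\<lambda>(m, n). \<iota> (a n))"
    using s[unfolded K.cauchy_seqs_iff_near] by (meson K.near_trans)
  then have "near (sequentially \<times>\<^sub>F sequentially) (\<lambda>(m, n). a m) (\<lambda>(m, n). a n)"
    unfolding K.near_def near_def by (simp add: case_prod_unfold a \<iota>.hom_diff[symmetric] nrm_to_completion)
  then have a_cauchy: "a \<in> cauchy_seqs P N"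
    by (simp add: cauchy_seqs_iff_near)
  have "K.near sequentially (\<lambda>n. \<iota> (a n)) (\<lambda>n. cls a)"
    unfolding K.near_def using to_completion_tendsto[OF a_cauchy] a_cauchy
    by (simp add: a to_completion_closed cls_closed)
  from K.near_trans[OF near this] show ?thesis
    using cls_closed[OF a_cauchy] by (auto dest: K.nearD)
qed

lemma completion_cstar_algebra: "unital_cstar_algebra K"
proof -
  have "nrm K X = 0 \<longleftrightarrow> X = \<zero>\<^bsub>K\<^esub>" if X: "X \<in> carrier K" for X
  proof -
    obtain x where x: "x \<in> cauchy_seqs P N" "X = cls x"
      using X by (rule completion_cases)
    have "(\<lambda>n. N (x n)) \<longlonglongrightarrow> 0 \<longleftrightarrow> X = \<zero>\<^bsub>K\<^esub>"
      unfolding x(2) completion_zero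
      using x(1) by (subst seq_class_eq_iff)
        (auto simp: near_def cauchy_seqs_closed cauchy_seqs_const[OF zero_closed] diff_zero)
    then show ?thesis
      using cls_nrm[OF x(1)] by (auto simp: x(2) LIMSEQ_unique)
  qed
  then show ?thesis
    by unfold_locales
      (auto simp: K.smult_closed K.smult_l_distr K.smult_r_distr K.smult_smult K.smult_one
        K.smult_mult_left K.smult_mult_right K.adj_closed K.adj_adj K.adj_add K.adj_smult K.adj_mult
        K.N_add K.N_smult K.N_mult K.N_cstar completion_complete)
qed

end

sublocale unital_cstar_algebra \<subseteq> norm: seminormed_star_algebra A "nrm A"
  by unfold_locales (auto simp: cstar_seminorm_def nrm_add nrm_mult nrm_smult nrm_cstar)

context unital_cstar_algebra
begin

lemma near_const_eq:
  assumes "norm.near sequentially x (\<lambda>n. l)" "norm.near sequentially x (\<lambda>n. l')"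
  shows "l = l'"
proof -
  have "norm.near sequentially (\<lambda>n. l) (\<lambda>n. l')"
    using assms norm.near_sym norm.near_trans by blast
  then have "l \<in> carrier A" "l' \<in> carrier A" "nrm A (l \<ominus> l') = 0"
    by (auto simp: norm.near_def LIMSEQ_const_iff)
  then show ?thesis by (simp add: nrm_eq_0_iff diff_eq_zero_iff)
qed

end

text \<open>Kept apart from \<open>star_hom\<close> instead of being derived by a spectral radius
  argument: homomorphisms that arise by extension to a completion have the property by construction,
  and composition preserves it.\<close>

definition contractive :: "('a, 'm) cstar_algebra_scheme \<Rightarrow> ('b, 'n) cstar_algebra_scheme \<Rightarrow> ('a \<Rightarrow> 'b) \<Rightarrow> bool" where
  "contractive A B f \<longleftrightarrow> (\<forall>x\<in>carrier A. nrm B (f x) \<le> nrm A x)"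

definition completion_lift :: "('b, 'n) cstar_algebra_scheme \<Rightarrow> ('a \<Rightarrow> 'b) \<Rightarrow> (nat \<Rightarrow> 'a) set \<Rightarrow> 'b" where
  "completion_lift B f X = (SOME l. l \<in> carrier B \<and> (\<lambda>n. nrm B (f (seq_rep X n) \<ominus>\<^bsub>B\<^esub> l)) \<longlonglongrightarrow> 0)"

locale completion_hom = seminormed_star_algebra P N + B: unital_cstar_algebra B + f: star_homomorphism P B f
  for P :: "('a, 'm) star_algebra_scheme" and N and B :: "('b, 'n) cstar_algebra_scheme" and f +
  assumes f_bounded: "x \<in> carrier P \<Longrightarrow> nrm B (f x) \<le> N x"
begin

lemma f_near: "near F x y \<Longrightarrow> B.norm.near F (\<lambda>i. f (x i)) (\<lambda>i. f (y i))"
  by (rule B.norm.near_bound[OF _ _ _ nearD])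
    (auto simp: near_closed f.hom_diff[symmetric] f_bounded)

text \<open>\<open>completion_lift\<close> takes the limit along the chosen representative. As f is
  bounded by N, every other representative has the same image limit, which makes the value
  independent of the choice.\<close>

lemma lift_near:
  assumes x: "x \<in> cauchy_seqs P N"
  shows "B.norm.near sequentially (\<lambda>n. f (x n)) (\<lambda>n. completion_lift B f (cls x))"
proof -
  have "(\<lambda>n. f (seq_rep (cls x) n)) \<in> cauchy_seqs B (nrm B)"
    using f_near[OF seq_rep_cauchy[OF x, unfolded cauchy_seqs_iff_near]]
    unfolding B.norm.cauchy_seqs_iff_near by (simp add: case_prod_unfold)
  from someI_ex[OF B.complete[OF this, unfolded Bex_def]]
  have "B.norm.near sequentially (\<lambda>n. f (seq_rep (cls x) n)) (\<lambda>n. completion_lift B f (cls x))"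
    unfolding completion_lift_def B.norm.near_def
    using seq_rep_cauchy[OF x] by (simp add: cauchy_seqs_closed)
  then show ?thesis
    using f_near[OF near_sym[OF seq_rep_near[OF x]]] B.norm.near_trans by blast
qed

lemma lift_eqI: "x \<in> cauchy_seqs P N \<Longrightarrow> B.norm.near sequentially (\<lambda>n. f (x n)) (\<lambda>n. l) \<Longrightarrow>
    completion_lift B f (cls x) = l"
  using B.near_const_eq lift_near by blast

lemma lift_to_completion: "a \<in> carrier P \<Longrightarrow> completion_lift B f (\<iota> a) = f a"
  unfolding to_completion_def by (rule lift_eqI) (auto simp: cauchy_seqs_const B.norm.near_refl)

lemma lift_carrier: "X \<in> carrier K \<Longrightarrow> completion_lift B f X \<in> carrier B"
  using lift_near B.norm.near_closed by (metis completion_cases)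

lemma lift_hom: "star_homomorphism K B (completion_lift B f)"
proof unfold_locales
  have "completion_lift B f \<in> ring_hom K B"
  proof (rule ring_hom_memI)
    fix X Y assume XY: "X \<in> carrier K" "Y \<in> carrier K"
    obtain x y where x: "x \<in> cauchy_seqs P N" "X = cls x" "y \<in> cauchy_seqs P N" "Y = cls y"
      using XY by (meson completion_cases)
    have "B.norm.near sequentially (\<lambda>n. f (x n \<oplus>\<^bsub>P\<^esub> y n))
      (\<lambda>n. completion_lift B f X \<oplus>\<^bsub>B\<^esub> completion_lift B f Y)"
      using B.norm.near_add[OF lift_near lift_near, OF x(1,3)] x by (simp add: cauchy_seqs_closed)
    then show "completion_lift B f (X \<oplus>\<^bsub>K\<^esub> Y) = completion_lift B f X \<oplus>\<^bsub>B\<^esub> completion_lift B f Y"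
      using x by (simp add: cls_add lift_eqI cauchy_seqs_add)
    obtain C where "\<And>n. N (y n) \<le> C" using cauchy_seqs_bounded[OF x(3)] by blast
    then have C: "nrm B (f (y n)) \<le> C" for n
      using f_bounded[of "y n"] x order_trans by (auto simp: cauchy_seqs_closed)
    have "B.norm.near sequentially (\<lambda>n. f (x n \<otimes>\<^bsub>P\<^esub> y n))
      (\<lambda>n. completion_lift B f X \<otimes>\<^bsub>B\<^esub> completion_lift B f Y)"
      using B.norm.near_mult[OF lift_near[OF x(1)] lift_near[OF x(3)] C order_refl] x
      by (simp add: cauchy_seqs_closed)
    then show "completion_lift B f (X \<otimes>\<^bsub>K\<^esub> Y) = completion_lift B f X \<otimes>\<^bsub>B\<^esub> completion_lift B f Y"
      using x by (simp add: cls_mult lift_eqI cauchy_seqs_mult)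
  qed (auto simp: lift_carrier completion_one lift_eqI cauchy_seqs_const[OF one_closed] B.norm.near_refl)
  moreover have "completion_lift B f (c \<odot>\<^bsub>K\<^esub> X) = c \<odot>\<^bsub>B\<^esub> completion_lift B f X"
    "completion_lift B f (adj K X) = adj B (completion_lift B f X)" if "X \<in> carrier K" for c X
  proof -
    obtain x where x: "x \<in> cauchy_seqs P N" "X = cls x"
      using \<open>X \<in> carrier K\<close> by (rule completion_cases)
    show "completion_lift B f (c \<odot>\<^bsub>K\<^esub> X) = c \<odot>\<^bsub>B\<^esub> completion_lift B f X"
      using B.norm.near_smult[OF lift_near[OF x(1)], of c] x
      by (simp add: cls_smult lift_eqI cauchy_seqs_smult f.hom_smult cauchy_seqs_closed)
    show "completion_lift B f (adj K X) = adj B (completion_lift B f X)"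
      using B.norm.near_adj[OF lift_near[OF x(1)]] x
      by (simp add: cls_adj lift_eqI cauchy_seqs_adj f.hom_adj cauchy_seqs_closed)
  qed
  ultimately show "star_hom K B (completion_lift B f)"
    by (auto simp: star_hom_def)
qed

lemma lift_contractive: "contractive K B (completion_lift B f)"
  unfolding contractive_def
proof
  fix X assume "X \<in> carrier K"
  then obtain x where x: "x \<in> cauchy_seqs P N" "X = cls x" by (rule completion_cases)
  have "(\<lambda>n. nrm B (f (x n))) \<longlonglongrightarrow> nrm B (completion_lift B f X)"
    using B.norm.near_norm[OF lift_near[OF x(1)] refl tendsto_const] x by simp
  then show "nrm B (completion_lift B f X) \<le> nrm K X"
    by (rule LIMSEQ_le[OF _ cls_nrm[OF x(1), folded x(2)]])
      (use x in \<open>auto simp: f_bounded cauchy_seqs_closed\<close>)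
qed

end

text \<open>Contractivity carries the convergence of a representing sequence over to both image
  sequences, which coincide termwise; limits in B are unique.\<close>

lemma (in seminormed_star_algebra) completion_hom_eqI:
  assumes "star_homomorphism K B f" "star_homomorphism K B g" "contractive K B f" "contractive K B g"
    and B: "unital_cstar_algebra B"
    and eq: "\<And>a. a \<in> carrier P \<Longrightarrow> f (\<iota> a) = g (\<iota> a)" and X: "X \<in> carrier K"
  shows "f X = g X"
proof -
  interpret B: unital_cstar_algebra B by fact
  interpret f: star_homomorphism K B f by fact
  interpret g: star_homomorphism K B g by fact
  obtain x where x: "x \<in> cauchy_seqs P N" "X = cls x"
    using X by (rule completion_cases)
  have lim: "(\<lambda>n. nrm K (\<iota> (x n) \<ominus>\<^bsub>K\<^esub> X)) \<longlonglongrightarrow> 0"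
    using to_completion_tendsto x by simp
  have c: "\<iota> (x n) \<in> carrier K" for n
    using x by (simp add: cauchy_seqs_closed)
  have "B.norm.near sequentially (\<lambda>n. f (\<iota> (x n))) (\<lambda>n. f X)"
    by (rule B.norm.near_bound[OF _ _ _ lim])
      (use X c assms(3) in \<open>auto simp: f.hom_diff[symmetric] contractive_def\<close>)
  moreover have "B.norm.near sequentially (\<lambda>n. g (\<iota> (x n))) (\<lambda>n. g X)"
    by (rule B.norm.near_bound[OF _ _ _ lim])
      (use X c assms(4) in \<open>auto simp: g.hom_diff[symmetric] contractive_def\<close>)
  ultimately show ?thesis
    using x by (simp add: eq cauchy_seqs_closed B.near_const_eq)
qed


section \<open>Projections in C*-algebras\<close>

text \<open>Roots of order 2 ^ n remove the constant K. Only powers of two occur because the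
  estimates come from repeated squaring, by the C*-identity or by Cauchy-Schwarz.\<close>

lemma le_of_power_two_power_le:
  fixes b L K :: real
  assumes "\<And>n. b ^ (2 ^ n) \<le> K * L ^ (2 ^ n)" "0 \<le> L"
  shows "b \<le> L"
proof (rule ccontr)
  assume "\<not> b \<le> L"
  then have "L < b" by simp
  show False
  proof (cases "L = 0")
    case True
    then show False using assms(1)[of 0] \<open>L < b\<close> by simp
  next
    case False
    then have L: "L > 0" using assms by simp
    have "1 < b / L" using \<open>L < b\<close> L by simp
    then obtain n where "K < (b / L) ^ n"
      using real_arch_pow by blast
    also have "\<dots> \<le> (b / L) ^ (2 ^ n)"
      using \<open>1 < b / L\<close> less_exp[of n] by (intro power_increasing) auto
    finally have "(b / L) ^ (2 ^ n) > K" .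
    then show False
      using assms(1)[of n] L by (simp add: power_divide field_simps)
  qed
qed

context unital_star_algebra
begin

definition projection :: "'a \<Rightarrow> bool" where
  "projection p \<longleftrightarrow> p \<in> carrier P \<and> p \<otimes> p = p \<and> adj P p = p"

lemma projectionD: "projection p \<Longrightarrow> p \<in> carrier P" "projection p \<Longrightarrow> p \<otimes> p = p"
    "projection p \<Longrightarrow> adj P p = p"
  by (auto simp: projection_def)

lemma projection_complement:
  assumes "projection p"
  shows "projection (\<one> \<ominus> p)"
proof -
  note p = projectionD[OF assms]
  have "(\<one> \<ominus> p) \<otimes> (\<one> \<ominus> p) = \<one> \<ominus> p"
    using p by (simp add: a_minus_def l_distr r_distr l_minus r_minus r_neg)
  then show ?thesis
    using p by (simp add: projection_def adj_diff adj_one)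
qed

text \<open>Polynomials in a single element reduce computations with scalars to the commutative ring
  \<^typ>\<open>complex poly\<close>.\<close>

definition poly_at :: "'a \<Rightarrow> complex poly \<Rightarrow> 'a" where
  "poly_at h p = fold_coeffs (\<lambda>c r. c \<odot> \<one> \<oplus> h \<otimes> r) p \<zero>"

context
  fixes h assumes h: "h \<in> carrier P"
begin

lemma poly_at_0: "poly_at h 0 = \<zero>"
  by (simp add: poly_at_def)

lemma poly_at_pCons: "poly_at h (pCons c p) = c \<odot> \<one> \<oplus> h \<otimes> poly_at h p"
  by (cases "c = 0 \<and> p = 0") (use h in \<open>auto simp: poly_at_def smult_zero_left\<close>)

lemma poly_at_closed: "poly_at h p \<in> carrier P"
  using h by (induction p) (auto simp: poly_at_0 poly_at_pCons smult_closed)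

lemma poly_at_add: "poly_at h (p + q) = poly_at h p \<oplus> poly_at h q"
proof (induction p q rule: poly_induct2)
  case (pCons a p b q)
  then show ?case
    using h by (simp add: poly_at_pCons poly_at_closed smult_closed smult_l_distr r_distr a_ac)
qed (simp add: poly_at_0)

lemma poly_at_smult: "poly_at h (Polynomial.smult c p) = c \<odot> poly_at h p"
proof (induction p)
  case (pCons a p)
  then show ?case
    using h by (simp add: poly_at_pCons poly_at_closed smult_closed smult_r_distr smult_smult smult_mult_right)
qed (simp add: poly_at_0 smult_zero_right)

lemma poly_at_mult: "poly_at h (p * q) = poly_at h p \<otimes> poly_at h q"
proof (induction p)
  case (pCons a p)
  have "poly_at h (pCons a p * q) = a \<odot> poly_at h q \<oplus> h \<otimes> (poly_at h p \<otimes> poly_at h q)"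
    using h by (simp add: poly_at_add poly_at_smult poly_at_pCons pCons smult_zero_left poly_at_closed)
  then show ?case
    using h by (simp add: poly_at_pCons poly_at_closed smult_closed l_distr smult_mult_left m_assoc)
qed (simp add: poly_at_0 poly_at_closed)

lemma poly_at_linear: "poly_at h [:a, b:] = a \<odot> \<one> \<oplus> b \<odot> h"
  using h by (simp add: poly_at_pCons poly_at_0 smult_closed smult_mult_right)

lemma poly_at_1: "poly_at h 1 = \<one>"
  using h by (simp add: one_pCons poly_at_pCons poly_at_0 smult_one)

lemma poly_at_minus: "poly_at h (p - q) = poly_at h p \<ominus> poly_at h q"
  using poly_at_add[of p "- q"] poly_at_smult[of "-1" q]
  by (simp add: smult_minus_one poly_at_closed a_minus_def)

lemma poly_at_commute: "poly_at h p \<otimes> h = h \<otimes> poly_at h p"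
  using poly_at_mult[of p "[:0, 1:]"] poly_at_mult[of "[:0, 1:]" p] h
  by (simp add: poly_at_linear smult_zero_left smult_one mult.commute)

lemma adj_poly_at:
  assumes "adj P h = h"
  shows "adj P (poly_at h p) = poly_at h (map_poly cnj p)"
proof (induction p)
  case (pCons a p)
  then show ?case
    using h assms poly_at_commute
    by (simp add: poly_at_pCons poly_at_closed smult_closed adj_add adj_smult adj_mult adj_one map_poly_pCons)
qed (simp add: poly_at_0 adj_zero)

end

end

context seminormed_star_algebra
begin

lemma N_projection:
  assumes "projection p"
  shows "N p \<le> 1"
proof -
  have "N p * N p = N p"
    using N_cstar[of p] projectionD[OF assms] by (simp add: power2_eq_square)
  then show ?thesis by auto
qed

lemma N_poly_at:
  assumes h: "h \<in> carrier P"
  shows "N (poly_at h (p + q)) \<le> N (poly_at h p) + N (poly_at h q)"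
    and "N (poly_at h (p * q)) \<le> N (poly_at h p) * N (poly_at h q)"
    and "N (poly_at h (Polynomial.smult c p)) = cmod c * N (poly_at h p)"
    and "adj P h = h \<Longrightarrow> N (poly_at h (map_poly cnj p * p)) = (N (poly_at h p))\<^sup>2"
  using N_cstar[OF poly_at_closed[OF h, of p]]
  by (simp_all add: h poly_at_closed poly_at_add poly_at_mult poly_at_smult N_add N_mult N_smult adj_poly_at)

text \<open>Since \<open>(1 + s h)\<^sup>3 + (1 - s h)\<^sup>3 = 2 + 6 s\<^sup>2 h\<^sup>2\<close>.\<close>

lemma N_poly_at_cubes:
  fixes s :: complex
  assumes h: "h \<in> carrier P" and s: "N (poly_at h [:1, s:]) \<le> 1" "N (poly_at h [:1, -s:]) \<le> 1"
  shows "N (poly_at h [:1, 0, 3 * s\<^sup>2:]) \<le> 1"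
proof -
  have cube: "N (poly_at h (p ^ 3)) \<le> 1" if "N (poly_at h p) \<le> 1" for p
  proof -
    have nonneg: "0 \<le> N (poly_at h q)" for q
      using h by (simp add: N_nonneg poly_at_closed)
    have "N (poly_at h (p * (p * p))) \<le> N (poly_at h p) * N (poly_at h (p * p))"
      "N (poly_at h (p * p)) \<le> N (poly_at h p) * N (poly_at h p)"
      using h by (auto intro: N_poly_at)
    moreover have "N (poly_at h p) * N (poly_at h p) \<le> 1"
      using that nonneg by (simp add: mult_le_one)
    moreover from calculation have "N (poly_at h p) * N (poly_at h (p * p)) \<le> 1"
      using that nonneg by (intro mult_le_one) auto
    ultimately show ?thesis by (simp add: power3_eq_cube mult.assoc)
  qed
  have "Polynomial.smult 2 [:1, 0, 3 * s\<^sup>2:] = [:1, s:] ^ 3 + [:1, -s:] ^ 3"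
    by (simp add: power3_eq_cube power2_eq_square algebra_simps)
  then have "2 * N (poly_at h [:1, 0, 3 * s\<^sup>2:]) = N (poly_at h ([:1, s:] ^ 3 + [:1, -s:] ^ 3))"
    using N_poly_at(3)[OF h, of 2 "[:1, 0, 3 * s\<^sup>2:]"] by simp
  also have "\<dots> \<le> N (poly_at h ([:1, s:] ^ 3)) + N (poly_at h ([:1, -s:] ^ 3))"
    by (rule N_poly_at(1)[OF h])
  also have "\<dots> \<le> 2"
    using cube[OF s(1)] cube[OF s(2)] by simp
  finally show ?thesis by simp
qed

text \<open>The C*-identity turns the bound on \<open>1 + 3 t\<^sup>2 h\<^sup>2\<close> into one on \<open>1 \<plusminus> i \<surd>3 t h\<close>, hence
  \<open>1 - 9 t\<^sup>2 h\<^sup>2\<close> is bounded as well and \<open>9/10 (1 + t h)\<^sup>2 + 1/10 (1 - 9 t\<^sup>2 h\<^sup>2) = 1 + 9/5 t h\<close>.\<close>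

lemma N_poly_at_enlarge:
  fixes t :: real
  assumes h: "h \<in> carrier P" "adj P h = h"
    and t: "N (poly_at h [:1, of_real t:]) \<le> 1" "N (poly_at h [:1, - of_real t:]) \<le> 1"
  shows "N (poly_at h [:1, of_real (9 / 5 * t):]) \<le> 1"
proof -
  define s where "s = \<i> * of_real (sqrt 3 * t)"
  have s2: "s\<^sup>2 = of_real (- 3 * t\<^sup>2)" "cnj s = - s"
    by (simp_all add: s_def power_mult_distrib flip: of_real_power)
  have "map_poly cnj [:1, s:] * [:1, s:] = [:1, 0, 3 * (of_real t)\<^sup>2:]"
    "map_poly cnj [:1, -s:] * [:1, -s:] = [:1, 0, 3 * (of_real t)\<^sup>2:]"
    using s2 by (simp_all add: map_poly_pCons power2_eq_square)
  then have "(N (poly_at h [:1, s:]))\<^sup>2 \<le> 1" "(N (poly_at h [:1, -s:]))\<^sup>2 \<le> 1"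
    using N_poly_at(4)[OF h(1) h(2), of "[:1, s:]"] N_poly_at(4)[OF h(1) h(2), of "[:1, -s:]"]
      N_poly_at_cubes[OF h(1) t] by simp_all
  then have s: "N (poly_at h [:1, s:]) \<le> 1" "N (poly_at h [:1, -s:]) \<le> 1"
    using h by (simp_all add: abs_square_le_1 abs_le_iff)
  have "[:1, of_real (9 / 5 * t):] = Polynomial.smult (9/10) ([:1, of_real t:] * [:1, of_real t:])
      + Polynomial.smult (1/10) [:1, 0, 3 * s\<^sup>2:]"
    unfolding s2 by (simp add: power2_eq_square)
  then have "N (poly_at h [:1, of_real (9 / 5 * t):]) \<le>
      9/10 * N (poly_at h ([:1, of_real t:] * [:1, of_real t:])) + 1/10 * N (poly_at h [:1, 0, 3 * s\<^sup>2:])"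
    by (metis (no_types, lifting) N_poly_at(1,3)[OF h(1)] norm_divide norm_numeral norm_one)
  also have "N (poly_at h ([:1, of_real t:] * [:1, of_real t:])) \<le> 1"
    using N_poly_at(2)[OF h(1), of "[:1, of_real t:]" "[:1, of_real t:]"] t(1)
      N_nonneg[OF poly_at_closed[OF h(1)], of "[:1, of_real t:]"]
    by (meson mult_le_one order_trans)
  also have "N (poly_at h [:1, 0, 3 * s\<^sup>2:]) \<le> 1"
    by (rule N_poly_at_cubes[OF h(1) s])
  finally show ?thesis by simp
qed

text \<open>This is the extremality of 1 in the unit ball, for self-adjoint directions. Each
  enlargement multiplies the admissible factor by 9/5, so 1 + s h and 1 - s h stay in the ball for s
  = (9/5) ^ k, and their difference 2 s h has seminorm at most 2 for every k.\<close>

lemma N_eq_0_if_one_extreme: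
  assumes h: "h \<in> carrier P" "adj P h = h" and le: "N (\<one> \<oplus> h) \<le> 1" "N (\<one> \<ominus> h) \<le> 1"
  shows "N h = 0"
proof -
  have "N (poly_at h [:1, of_real ((9/5) ^ k):]) \<le> 1 \<and> N (poly_at h [:1, of_real (- ((9/5) ^ k)):]) \<le> 1" for k :: nat
  proof (induction k)
    case 0
    then show ?case
      using le h by (simp add: poly_at_linear smult_one smult_minus_one a_minus_def)
  next
    case (Suc k)
    then show ?case
      using N_poly_at_enlarge[OF h, of "(9/5) ^ k"] N_poly_at_enlarge[OF h, of "- ((9/5) ^ k)"] by simp
  qed
  note le = this
  have "(9/5) ^ k * N h \<le> 1" for k
  proof -
    let ?s = "of_real ((9/5) ^ k) :: complex"
    have "Polynomial.smult (2 * ?s) [:0, 1:] = [:1, ?s:] + Polynomial.smult (- 1) [:1, - ?s:]"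
      by simp
    then have "2 * (9/5) ^ k * N h = N (poly_at h ([:1, ?s:] + Polynomial.smult (- 1) [:1, - ?s:]))"
      using N_poly_at(3)[OF h(1), of "2 * ?s" "[:0, 1:]"] h
      by (simp add: poly_at_linear smult_one smult_zero_left norm_mult norm_power)
    also have "\<dots> \<le> N (poly_at h [:1, ?s:]) + N (poly_at h [:1, - ?s:])"
      using N_poly_at(1)[OF h(1), of "[:1, ?s:]" "Polynomial.smult (- 1) [:1, - ?s:]"]
        N_poly_at(3)[OF h(1), of "-1" "[:1, - ?s:]"] by simp
    also have "\<dots> \<le> 2" using le[of k] by simp
    finally show ?thesis by simp
  qed
  then have "N h \<le> (5/9) ^ k" for k
    by (simp add: power_divide field_simps)
  moreover have "(\<lambda>k. (5/9) ^ k :: real) \<longlonglongrightarrow> 0"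
    by (rule LIMSEQ_power_zero) simp
  ultimately have "N h \<le> 0"
    by (intro LIMSEQ_le_const) auto
  then show ?thesis using N_nonneg[OF h(1)] by simp
qed

text \<open>The summands of \<open>z = a + k\<close> do not interact, so \<open>N z ^ 2 ^ n = N (z ^ 2 ^ n) \<le> 2\<close>.\<close>

lemma N_add_orthogonal_le:
  assumes a: "projection a" and k: "k \<in> carrier P" "adj P k = k" "N k \<le> 1" "a \<otimes> k = \<zero>" "k \<otimes> a = \<zero>"
  shows "N (a \<oplus> k) \<le> 1"
proof -
  have "\<exists>l\<in>carrier P. adj P l = l \<and> N l \<le> 1 \<and> a \<otimes> l = \<zero> \<and> l \<otimes> a = \<zero> \<and>
      N (a \<oplus> k) ^ (2 ^ n) = N (a \<oplus> l)" for n
  proof (induction n)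
    case 0
    then show ?case using k by auto
  next
    case (Suc n)
    then obtain l where l: "l \<in> carrier P" "adj P l = l" "N l \<le> 1" "a \<otimes> l = \<zero>" "l \<otimes> a = \<zero>"
      "N (a \<oplus> k) ^ (2 ^ n) = N (a \<oplus> l)" by blast
    have c: "a \<in> carrier P" using a by (simp add: projectionD)
    have "N (a \<oplus> k) ^ (2 ^ Suc n) = (N (a \<oplus> l))\<^sup>2"
      by (simp add: l(6)[symmetric] power_mult[symmetric] mult.commute)
    also have "\<dots> = N (adj P (a \<oplus> l) \<otimes> (a \<oplus> l))"
      using l c by (simp add: N_cstar)
    also have "adj P (a \<oplus> l) \<otimes> (a \<oplus> l) = a \<oplus> l \<otimes> l"
      using l a c by (simp add: adj_add projectionD l_distr r_distr)
    finally show ?case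
    proof (intro bexI[of _ "l \<otimes> l"] conjI)
      show "N (l \<otimes> l) \<le> 1"
        using N_mult[OF l(1) l(1)] l(3) N_nonneg[OF l(1)] by (meson mult_le_one order_trans)
      show "a \<otimes> (l \<otimes> l) = \<zero>" "l \<otimes> l \<otimes> a = \<zero>"
        using l c by (simp_all add: m_assoc[symmetric], simp_all add: m_assoc)
    qed (use l in \<open>auto simp: adj_mult\<close>)
  qed
  note * = this
  have "N (a \<oplus> k) ^ (2 ^ n) \<le> 2 * 1 ^ (2 ^ n)" for n
  proof -
    obtain l where "l \<in> carrier P" "N l \<le> 1" "N (a \<oplus> k) ^ (2 ^ n) = N (a \<oplus> l)"
      using *[of n] by blast
    then show ?thesis
      using N_add[of a l] N_projection[OF a] projectionD(1)[OF a] by simp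
  qed
  then show ?thesis by (rule le_of_power_two_power_le) simp
qed

text \<open>Writes 1 - q p q as the projection 1 - q plus q (1 - p) q. The second summand has
  seminorm at most 1 and is annihilated by 1 - q on both sides, so the bound for orthogonal sums
  applies. It replaces the order relation 0 \<le> q p q \<le> 1.\<close>

lemma N_one_minus_compression_le:
  assumes p: "projection p" and q: "projection q"
  shows "N (\<one> \<ominus> q \<otimes> p \<otimes> q) \<le> 1"
proof -
  let ?k = "q \<otimes> (\<one> \<ominus> p) \<otimes> q"
  note pq = projectionD[OF p] projectionD[OF q] projectionD[OF projection_complement[OF p]]
  have qqx: "q \<otimes> (q \<otimes> x) = q \<otimes> x" if "x \<in> carrier P" for x
    using that pq by (simp add: m_assoc[symmetric])
  have "N ((\<one> \<ominus> q) \<oplus> ?k) \<le> 1"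
  proof (rule N_add_orthogonal_le)
    have "N ?k \<le> N q * N (\<one> \<ominus> p) * N q"
      using pq by (meson N_mult N_nonneg m_closed mult_right_mono order_trans)
    also have "\<dots> \<le> 1"
      using pq N_projection[OF q] N_projection[OF projection_complement[OF p]]
      by (intro mult_le_one mult_nonneg_nonneg N_nonneg) auto
    finally show "N ?k \<le> 1" .
    show "(\<one> \<ominus> q) \<otimes> ?k = \<zero>" "?k \<otimes> (\<one> \<ominus> q) = \<zero>"
      using pq by (simp_all add: a_minus_def l_distr r_distr l_minus r_minus m_assoc qqx r_neg)
  qed (use pq projection_complement[OF q] in \<open>auto simp: adj_mult m_assoc\<close>)
  also have "(\<one> \<ominus> q) \<oplus> ?k = \<one> \<ominus> q \<otimes> p \<otimes> q"
    using pq by (simp add: a_minus_def l_distr r_distr l_minus r_minus a_assoc)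
      (simp add: a_assoc[symmetric] l_neg)
  finally show ?thesis .
qed

end

section \<open>Orthogonality of projections with sum 1\<close>

context unital_cstar_algebra
begin

text \<open>With h l = p j p l p j, compression of the sum by p j shows that the h l with l distinct
  from j add up to 0. Both signs of a multiple of h i then keep 1 in the unit ball, so h i = 0 by
  extremality, and h i is the product of the adjoint of p i p j with p i p j itself.\<close>

lemma orthogonal_of_sum_eq_one:
  assumes "finite I" and p: "\<And>i. i \<in> I \<Longrightarrow> projection (p i)" and one: "(\<Oplus>i\<in>I. p i) = \<one>"
    and ij: "i \<in> I" "j \<in> I" "i \<noteq> j"
  shows "p i \<otimes> p j = \<zero>"
proof -
  note pc = projectionD(1)[OF p]
  define h where "h l = p j \<otimes> p l \<otimes> p j" for l
  have hc: "h l \<in> carrier A" "adj A (h l) = h l" if "l \<in> I" for l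
    using that ij p by (auto simp: h_def projectionD adj_mult m_assoc)
  define J where "J = I - {i, j}"
  have J: "finite J" "J \<subseteq> I" "I = insert j (insert i J)" "i \<notin> J" "j \<notin> insert i J"
    using \<open>finite I\<close> ij by (auto simp: J_def)
  have "(\<Oplus>l\<in>I. h l) = p j \<otimes> (\<Oplus>l\<in>I. p l) \<otimes> p j"
    unfolding h_def using \<open>finite I\<close> ij pc
    by (subst finsum_rdistr finsum_ldistr; auto simp: Pi_iff)+
  also have "\<dots> = h j"
    using ij p[of j] by (simp add: one h_def projectionD)
  also have "(\<Oplus>l\<in>I. h l) = h j \<oplus> (h i \<oplus> (\<Oplus>l\<in>J. h l))"
    using J hc ij by (simp add: Pi_iff subset_iff finsum_closed)
  finally have hi: "h i \<oplus> (\<Oplus>l\<in>J. h l) = \<zero>"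
    using J hc ij by (simp add: finsum_closed Pi_iff subset_iff)
  \<comment> \<open>With this t the element 1 + t h i is the average of 1 and the elements 1 - h l
    for l in J, because h i is minus the sum of these h l.\<close>
  define t where "t = 1 / (real (card J) + 1)"
  have t: "0 < t" "t \<le> 1" by (auto simp: t_def)
  have hJ: "(\<Oplus>l\<in>J. h l) \<in> carrier A" using J hc by (intro finsum_closed) auto
  have le1: "nrm A (\<one> \<ominus> h l) \<le> 1" if "l \<in> I" for l
    unfolding h_def using that ij p by (intro norm.N_one_minus_compression_le) auto
  have "nrm A (\<one> \<oplus> of_real t \<odot> h i) \<le> 1"
  proof -
    have sum: "(\<Oplus>l\<in>K. \<one> \<ominus> h l) \<oplus> (\<Oplus>l\<in>K. h l) = of_nat (card K) \<odot> \<one>" if "finite K" "K \<subseteq> I" for K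
    proof -
      have "(\<Oplus>l\<in>K. \<one> \<ominus> h l) \<oplus> (\<Oplus>l\<in>K. h l) = (\<Oplus>l\<in>K. (\<one> \<ominus> h l) \<oplus> h l)"
        using that hc by (intro finsum_addf[symmetric]) auto
      also have "\<dots> = (\<Oplus>l\<in>K. \<one>)"
        using that hc by (intro finsum_cong') (auto simp: a_minus_def a_assoc l_neg subset_iff)
      also have "\<dots> = of_nat (card K) \<odot> \<one>"
        using \<open>finite K\<close> by (induction K) (auto simp: star.smult_zero_left smult_l_distr smult_one)
      finally show ?thesis .
    qed
    have "(\<Oplus>l\<in>J. \<one> \<ominus> h l) = ((\<Oplus>l\<in>J. \<one> \<ominus> h l) \<oplus> (\<Oplus>l\<in>J. h l)) \<oplus> h i"
    proof -
      have c: "(\<Oplus>l\<in>J. \<one> \<ominus> h l) \<in> carrier A" "h i \<in> carrier A"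
        using J(2) hc ij by (auto intro!: finsum_closed)
      then have "((\<Oplus>l\<in>J. \<one> \<ominus> h l) \<oplus> (\<Oplus>l\<in>J. h l)) \<oplus> h i = (\<Oplus>l\<in>J. \<one> \<ominus> h l) \<oplus> (h i \<oplus> (\<Oplus>l\<in>J. h l))"
        using hJ by (simp add: a_ac)
      then show ?thesis using c by (simp add: hi)
    qed
    also have "\<dots> = of_nat (card J) \<odot> \<one> \<oplus> h i"
      using sum[of J] J by simp
    finally have "\<one> \<oplus> (\<Oplus>l\<in>J. \<one> \<ominus> h l) = of_real (1 / t) \<odot> \<one> \<oplus> h i"
      using ij hc by (simp add: t_def smult_l_distr smult_one a_ac smult_closed)
    then have "of_real t \<odot> (\<one> \<oplus> (\<Oplus>l\<in>J. \<one> \<ominus> h l)) = \<one> \<oplus> of_real t \<odot> h i"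
      using ij hc t by (simp add: smult_r_distr smult_closed smult_smult[symmetric] smult_one)
    then have "nrm A (\<one> \<oplus> of_real t \<odot> h i) = t * nrm A (\<one> \<oplus> (\<Oplus>l\<in>J. \<one> \<ominus> h l))"
      using J hc t nrm_smult[of "\<one> \<oplus> (\<Oplus>l\<in>J. \<one> \<ominus> h l)" "of_real t"]
      by (simp add: finsum_closed Pi_iff subset_iff)
    also have "\<dots> \<le> t * (1 + (\<Sum>l\<in>J. 1))"
    proof (intro mult_left_mono)
      have "nrm A (\<one> \<oplus> (\<Oplus>l\<in>J. \<one> \<ominus> h l)) \<le> nrm A \<one> + nrm A (\<Oplus>l\<in>J. \<one> \<ominus> h l)"
        using J hc by (intro nrm_add) (auto intro!: finsum_closed)
      also have "nrm A (\<Oplus>l\<in>J. \<one> \<ominus> h l) \<le> (\<Sum>l\<in>J. nrm A (\<one> \<ominus> h l))"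
        using J hc by (intro norm.N_finsum) auto
      also have "\<dots> \<le> (\<Sum>l\<in>J. 1)"
        using J le1 by (intro sum_mono) auto
      finally show "nrm A (\<one> \<oplus> (\<Oplus>l\<in>J. \<one> \<ominus> h l)) \<le> 1 + (\<Sum>l\<in>J. 1)"
        using norm.N_one_le by simp
    qed (use t in simp)
    also have "\<dots> = 1" by (simp add: t_def add.commute)
    finally show ?thesis .
  qed
  moreover have "nrm A (\<one> \<ominus> of_real t \<odot> h i) \<le> 1"
  proof -
    \<comment> \<open>For the other sign a convex combination of 1 and 1 - h i suffices.\<close>
    have "\<one> \<ominus> of_real t \<odot> h i = of_real (1 - t) \<odot> \<one> \<oplus> of_real t \<odot> (\<one> \<ominus> h i)"
    proof -
      have "of_real (1 - t) \<odot> \<one> \<oplus> of_real t \<odot> (\<one> \<ominus> h i) =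
          (of_real (1 - t) \<odot> \<one> \<oplus> of_real t \<odot> \<one>) \<oplus> (\<ominus> (of_real t \<odot> h i))"
        using ij hc by (simp add: a_minus_def smult_r_distr star.smult_a_inv smult_closed a_assoc)
      then show ?thesis
        using ij hc by (simp add: a_minus_def smult_l_distr[symmetric] smult_one flip: of_real_add)
    qed
    then have "nrm A (\<one> \<ominus> of_real t \<odot> h i) \<le> (1 - t) * nrm A \<one> + t * nrm A (\<one> \<ominus> h i)"
      using nrm_add[of "of_real (1 - t) \<odot> \<one>" "of_real t \<odot> (\<one> \<ominus> h i)"] ij hc t
        nrm_smult[of \<one> "of_real (1 - t)"] nrm_smult[of "\<one> \<ominus> h i" "of_real t"]
      by (simp add: smult_closed del: of_real_diff)
    also have "\<dots> \<le> (1 - t) * 1 + t * 1"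
      using t le1[OF ij(1)] norm.N_one_le by (intro add_mono mult_left_mono) auto
    finally show ?thesis by simp
  qed
  ultimately have "nrm A (of_real t \<odot> h i) = 0"
    using ij hc by (intro norm.N_eq_0_if_one_extreme) (auto simp: smult_closed adj_smult)
  then have "nrm A (h i) = 0"
    using ij hc t by (simp add: nrm_smult)
  moreover have "h i = adj A (p i \<otimes> p j) \<otimes> (p i \<otimes> p j)"
    using ij p projectionD(2)[OF p[OF ij(1)]]
    by (simp add: h_def projectionD adj_mult m_assoc) (simp add: m_assoc[symmetric] projectionD)
  ultimately have "nrm A (p i \<otimes> p j) = 0"
    using ij pc nrm_cstar[of "p i \<otimes> p j"] by simp
  then show ?thesis
    using ij pc nrm_eq_0_iff by auto
qed

end

text \<open>The sets \<open>Y\<close> whose partial sum lies in \<open>S\<close> form a Boolean algebra, and \<open>{i}\<close> is one of its atoms.\<close>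

lemma (in unital_star_algebra) summand_in_subalgebra:
  assumes X: "finite X" and p: "\<And>i. i \<in> X \<Longrightarrow> projection (p i)" and one: "(\<Oplus>i\<in>X. p i) = \<one>"
    and orth: "\<And>i j. \<lbrakk>i \<in> X; j \<in> X; i \<noteq> j\<rbrakk> \<Longrightarrow> p i \<otimes> p j = \<zero>"
    and S: "\<one> \<in> S" "\<And>x y. \<lbrakk>x \<in> S; y \<in> S\<rbrakk> \<Longrightarrow> x \<otimes> y \<in> S" "\<And>x y. \<lbrakk>x \<in> S; y \<in> S\<rbrakk> \<Longrightarrow> x \<ominus> y \<in> S"
    and i: "i \<in> X"
    and sep: "\<And>j. \<lbrakk>j \<in> X; j \<noteq> i\<rbrakk> \<Longrightarrow> \<exists>Y\<subseteq>X. (\<Oplus>k\<in>Y. p k) \<in> S \<and> (i \<in> Y) \<noteq> (j \<in> Y)"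
  shows "p i \<in> S"
proof -
  note pc = projectionD(1)[OF p]
  define \<Y> where "\<Y> = {Y. Y \<subseteq> X \<and> (\<Oplus>k\<in>Y. p k) \<in> S}"
  have fin: "finite Y" if "Y \<subseteq> X" for Y using that X finite_subset by blast
  have Int: "Y \<inter> Z \<in> \<Y>" if YZ: "Y \<in> \<Y>" "Z \<in> \<Y>" for Y Z
  proof -
    have sub: "Y \<subseteq> X" "Z \<subseteq> X" using YZ by (auto simp: \<Y>_def)
    have "(\<Oplus>k\<in>Y. p k) \<otimes> (\<Oplus>k\<in>Z. p k) = (\<Oplus>k\<in>Y. \<Oplus>l\<in>Z. p k \<otimes> p l)"
      using sub fin pc by (intro finsum_smult_mult_finsum_smult) auto
    also have "\<dots> = (\<Oplus>k\<in>Y. if k \<in> Z then p k else \<zero>)"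
    proof (rule finsum_cong')
      fix k assume k: "k \<in> Y"
      show "(\<Oplus>l\<in>Z. p k \<otimes> p l) = (if k \<in> Z then p k else \<zero>)"
      proof (cases "k \<in> Z")
        case True
        have "(\<Oplus>l\<in>Z. p k \<otimes> p l) = p k \<otimes> p k"
          using True k sub fin pc orth[of k] by (intro finsum_single) (auto simp: subset_iff)
        then show ?thesis using True k sub p by (simp add: projectionD subset_iff)
      next
        case False
        have "(\<Oplus>l\<in>Z. p k \<otimes> p l) = (\<Oplus>l\<in>Z. \<zero>)"
          using False k sub orth by (intro finsum_cong') auto
        then show ?thesis using False by (simp add: finsum_zero)
      qed
    qed (use sub pc in auto)
    also have "\<dots> = (\<Oplus>k\<in>Y \<inter> Z. if k \<in> Z then p k else \<zero>)"
      using sub fin pc by (intro finsum_superset) auto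
    also have "\<dots> = (\<Oplus>k\<in>Y \<inter> Z. p k)"
      using sub pc by (intro finsum_cong') auto
    finally have "(\<Oplus>k\<in>Y \<inter> Z. p k) \<in> S"
      using YZ S(2)[of "\<Oplus>k\<in>Y. p k" "\<Oplus>k\<in>Z. p k"] by (simp add: \<Y>_def)
    then show ?thesis using sub by (auto simp: \<Y>_def)
  qed
  have Compl: "X - Y \<in> \<Y>" if Y: "Y \<in> \<Y>" for Y
  proof -
    have sub: "Y \<subseteq> X" using Y by (auto simp: \<Y>_def)
    have c: "(\<Oplus>k\<in>Y. p k) \<in> carrier P" "(\<Oplus>k\<in>X - Y. p k) \<in> carrier P"
      using sub pc by (auto intro!: finsum_closed)
    have "(\<Oplus>k\<in>Y. p k) \<oplus> (\<Oplus>k\<in>X - Y. p k) = (\<Oplus>k\<in>Y \<union> (X - Y). p k)"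
      using sub X fin pc by (intro finsum_Un_disjoint[symmetric]) auto
    also have "Y \<union> (X - Y) = X" using sub by auto
    finally have "(\<Oplus>k\<in>X - Y. p k) \<oplus> (\<Oplus>k\<in>Y. p k) = \<one>"
      using one c by (simp add: a_comm)
    then have "(\<Oplus>k\<in>X - Y. p k) = \<one> \<ominus> (\<Oplus>k\<in>Y. p k)"
      using c by (metis a_minus_def a_assoc a_inv_closed r_neg r_zero)
    then show ?thesis using S(3)[OF S(1)] Y by (auto simp: \<Y>_def)
  qed
  \<comment> \<open>X itself makes the family of sets that contain i nonempty, so its intersection
    is again a member.\<close>
  have top: "X \<in> \<Y>" using S one by (auto simp: \<Y>_def)
  have "\<Inter>\<Z> \<in> \<Y>" if "finite \<Z>" "\<Z> \<noteq> {}" "\<Z> \<subseteq> \<Y>" for \<Z>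
    using that by (induction \<Z> rule: finite_ne_induct) (auto intro: Int)
  moreover have "\<Y> \<subseteq> Pow X" by (auto simp: \<Y>_def)
  ultimately have "\<Inter>{Y \<in> \<Y>. i \<in> Y} \<in> \<Y>"
    using top i X by (metis (no_types, lifting) empty_iff finite_Pow_iff finite_subset mem_Collect_eq subsetI)
  moreover have "\<Inter>{Y \<in> \<Y>. i \<in> Y} = {i}"
  proof -
    have "j = i" if j: "j \<in> \<Inter>{Y \<in> \<Y>. i \<in> Y}" for j
    proof (rule ccontr)
      assume "j \<noteq> i"
      have "j \<in> X" using j top i by auto
      then obtain Y where Y: "Y \<in> \<Y>" "(i \<in> Y) \<noteq> (j \<in> Y)"
        using sep[OF _ \<open>j \<noteq> i\<close>] by (auto simp: \<Y>_def)
      \<comment> \<open>A set that contains j but not i is replaced by its complement.\<close>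
      then show False
        using j Compl[OF Y(1)] i by (cases "i \<in> Y") auto
    qed
    then show ?thesis by auto
  qed
  ultimately show ?thesis
    using i pc by (simp add: \<Y>_def)
qed


section \<open>Homomorphisms with dense range\<close>

context unital_cstar_algebra
begin

lemma geometric_limit:
  assumes s: "\<And>n. s n \<in> carrier A" and le: "\<And>n. nrm A (s (Suc n) \<ominus> s n) \<le> C * \<rho> ^ n"
    and \<rho>: "0 \<le> \<rho>" "\<rho> < 1"
  shows "s \<in> cauchy_seqs A (nrm A)" "\<exists>l. norm.near sequentially s (\<lambda>n. l)"
proof -
  \<comment> \<open>D is the sum of the geometric series of the increments. Bounding the distance by
    D \<rho> ^ n - D \<rho> ^ (n + k) instead of D \<rho> ^ n lets the induction telescope.\<close>
  define D where "D = C / (1 - \<rho>)"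
  have "0 \<le> C"
    using le[of 0] norm.N_nonneg[of "s (Suc 0) \<ominus> s 0"] s by simp
  then have D: "0 \<le> D" "D * (1 - \<rho>) = C" using \<rho> by (auto simp: D_def)
  have tail: "nrm A (s (n + k) \<ominus> s n) \<le> D * \<rho> ^ n - D * \<rho> ^ (n + k)" for n k
  proof (induction k)
    case 0
    then show ?case using s by (simp add: a_minus_def r_neg norm.N_zero)
  next
    case (Suc k)
    have "nrm A (s (n + Suc k) \<ominus> s n) \<le> nrm A (s (Suc (n + k)) \<ominus> s (n + k)) + nrm A (s (n + k) \<ominus> s n)"
      using s norm.N_triangle by simp
    also have "\<dots> \<le> C * \<rho> ^ (n + k) + (D * \<rho> ^ n - D * \<rho> ^ (n + k))"
      using Suc le by (intro add_mono)
    also have "\<dots> = D * \<rho> ^ n - D * \<rho> ^ (n + Suc k)"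
      unfolding D(2)[symmetric] by (simp add: algebra_simps)
    finally show ?case .
  qed
  have tail': "nrm A (s m \<ominus> s n) \<le> D * \<rho> ^ M" if "M \<le> n" "n \<le> m" for m n M
  proof -
    have "nrm A (s m \<ominus> s n) \<le> D * \<rho> ^ n - D * \<rho> ^ m"
      using tail[of n "m - n"] that by simp
    also have "\<dots> \<le> D * \<rho> ^ n" using D \<rho> by simp
    also have "\<dots> \<le> D * \<rho> ^ M"
      using D \<rho> that by (intro mult_left_mono power_decreasing) auto
    finally show ?thesis .
  qed
  show c: "s \<in> cauchy_seqs A (nrm A)"
    unfolding cauchy_seqs_def
  proof (safe intro!: s)
    fix \<epsilon> :: real assume "0 < \<epsilon>"
    have "(\<lambda>n. D * \<rho> ^ n) \<longlonglongrightarrow> D * 0"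
      using \<rho> by (intro tendsto_mult tendsto_const LIMSEQ_power_zero) simp
    then obtain M where "D * \<rho> ^ M < \<epsilon>"
      using order_tendstoD(2)[of _ "D * 0" sequentially \<epsilon>] \<open>0 < \<epsilon>\<close> by (auto simp: eventually_sequentially)
    then have "nrm A (s m \<ominus> s n) < \<epsilon>" if "M \<le> m" "M \<le> n" for m n
      using tail'[of M n m] tail'[of M m n] that norm.N_diff_commute[OF s s, of m n]
      by (cases "n \<le> m") auto
    then show "\<exists>M. \<forall>m\<ge>M. \<forall>n\<ge>M. nrm A (s m \<ominus> s n) < \<epsilon>" by blast
  qed
  show "\<exists>l. norm.near sequentially s (\<lambda>n. l)"
    using complete[OF c] s by (auto simp: norm.near_def)
qed

lemma neumann_series:
  assumes x: "x \<in> carrier A" "nrm A x < 1"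
  obtains y where "y \<in> carrier A" "(\<one> \<ominus> x) \<otimes> y = \<one>" "y \<otimes> (\<one> \<ominus> x) = \<one>"
proof -
  \<comment> \<open>The partial sums of the powers of x, defined by recursion so that the fixed
    point equation y = 1 + x y is immediate in the limit. The mirrored equation follows since every
    partial sum commutes with x.\<close>
  define s where "s = rec_nat \<zero> (\<lambda>_ r. \<one> \<oplus> x \<otimes> r)"
  have s: "s 0 = \<zero>" "s (Suc n) = \<one> \<oplus> x \<otimes> s n" for n by (simp_all add: s_def)
  have c: "s n \<in> carrier A" for n by (induction n) (use x in \<open>auto simp: s\<close>)
  have comm: "s n \<otimes> x = x \<otimes> s n" for n
    by (induction n) (use x c in \<open>auto simp: s l_distr r_distr m_assoc\<close>)
  have "nrm A (s (Suc n) \<ominus> s n) \<le> 1 * nrm A x ^ n" for n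
  proof (induction n)
    case 0
    then show ?case using norm.N_one_le x by (simp add: s norm.diff_zero)
  next
    case (Suc n)
    have "s (Suc (Suc n)) \<ominus> s (Suc n) = x \<otimes> (s (Suc n) \<ominus> s n)"
    proof -
      have "s (Suc (Suc n)) \<ominus> s (Suc n) = (\<one> \<oplus> x \<otimes> s (Suc n)) \<ominus> (\<one> \<oplus> x \<otimes> s n)"
        by (simp only: s(2))
      also have "\<dots> = x \<otimes> s (Suc n) \<ominus> x \<otimes> s n"
        using x c by (simp add: a_minus_def minus_add a_ac r_neg1 r_neg2 del: s)
      also have "\<dots> = x \<otimes> (s (Suc n) \<ominus> s n)"
        using x c by (simp add: a_minus_def r_distr r_minus)
      finally show ?thesis .
    qed
    then have "nrm A (s (Suc (Suc n)) \<ominus> s (Suc n)) \<le> nrm A x * nrm A (s (Suc n) \<ominus> s n)"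
      using x c nrm_mult by simp
    also have "\<dots> \<le> nrm A x * (1 * nrm A x ^ n)"
      using Suc x by (intro mult_left_mono norm.N_nonneg) auto
    finally show ?case by simp
  qed
  from geometric_limit[OF c this norm.N_nonneg[OF x(1)] x(2)] obtain y where
    cauchy: "s \<in> cauchy_seqs A (nrm A)" and lim: "norm.near sequentially s (\<lambda>n. y)" by blast
  have y: "y \<in> carrier A" by (rule norm.near_closed(2)[OF lim])
  obtain B where B: "\<And>n. nrm A (s n) \<le> B" using norm.cauchy_seqs_bounded[OF cauchy] by blast
  have suc: "norm.near sequentially (\<lambda>n. s (Suc n)) (\<lambda>n. y)"
    using lim LIMSEQ_Suc[OF norm.nearD[OF lim]] by (auto simp: norm.near_def)
  have "norm.near sequentially (\<lambda>n. \<one> \<oplus> x \<otimes> s n) (\<lambda>n. \<one> \<oplus> x \<otimes> y)"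
    using B x by (intro norm.near_add norm.near_mult[OF _ lim B order_refl] norm.near_refl) auto
  then have 1: "y = \<one> \<oplus> x \<otimes> y"
    using near_const_eq suc by (simp add: s)
  have "norm.near sequentially (\<lambda>n. \<one> \<oplus> s n \<otimes> x) (\<lambda>n. \<one> \<oplus> y \<otimes> x)"
    using B x by (intro norm.near_add norm.near_mult[OF lim _ order_refl, of _ _ "nrm A y"] norm.near_refl) auto
  then have 2: "y = \<one> \<oplus> y \<otimes> x"
    using near_const_eq suc by (simp add: s comm)
  have "(\<one> \<ominus> x) \<otimes> y = y \<ominus> x \<otimes> y" "y \<otimes> (\<one> \<ominus> x) = y \<ominus> y \<otimes> x"
    using x y by (simp_all add: a_minus_def l_distr r_distr l_minus r_minus)
  moreover have "y \<ominus> x \<otimes> y = \<one>" "y \<ominus> y \<otimes> x = \<one>"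
    using 1 2 x y by (metis a_assoc a_inv_closed a_minus_def m_closed one_closed r_neg r_zero)+
  ultimately show ?thesis
    using that y by simp
qed

text \<open>The Cayley transform U = (h - i) r satisfies U = 1 - 2 i r, and the product of its
  adjoint with U is 1. Hence U has norm at most 1 and 2 r = -i (1 - U) has norm at most 2.\<close>

lemma nrm_adjoint_plus_i:
  assumes h: "h \<in> carrier A" "adj A h = h"
    and r: "r \<in> carrier A" "(h \<oplus> \<i> \<odot> \<one>) \<otimes> r = \<one>"
  shows "nrm A r \<le> 1"
proof -
  note c = poly_at_closed[OF h(1)]
  have i: "h \<oplus> \<i> \<odot> \<one> = poly_at h [:\<i>, 1:]"
    using h by (simp add: poly_at_linear smult_one smult_closed a_comm)
  define U where "U = poly_at h [:-\<i>, 1:] \<otimes> r"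
  have U: "U \<in> carrier A" using c r by (simp add: U_def)
  have "[:-\<i>, 1:] = [:\<i>, 1:] - Polynomial.smult (2 * \<i>) 1" by (simp add: one_pCons)
  then have U_eq: "U = \<one> \<ominus> (2 * \<i>) \<odot> r"
    unfolding U_def using h r c
    by (simp only: poly_at_minus poly_at_smult poly_at_1)
      (simp add: i a_minus_def l_distr l_minus smult_closed smult_mult_left)
  have "adj A U \<otimes> U = adj A r \<otimes> (poly_at h [:\<i>, 1:] \<otimes> poly_at h [:-\<i>, 1:]) \<otimes> r"
    using h r c by (simp add: U_def adj_mult adj_closed adj_poly_at map_poly_pCons m_assoc)
  also have "poly_at h [:\<i>, 1:] \<otimes> poly_at h [:-\<i>, 1:] = poly_at h [:-\<i>, 1:] \<otimes> poly_at h [:\<i>, 1:]"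
    using h by (simp add: poly_at_mult[symmetric] mult.commute)
  also have "adj A r \<otimes> (poly_at h [:-\<i>, 1:] \<otimes> poly_at h [:\<i>, 1:]) \<otimes> r
      = adj A r \<otimes> poly_at h [:-\<i>, 1:] \<otimes> (poly_at h [:\<i>, 1:] \<otimes> r)"
    using h r c by (simp add: m_assoc adj_closed)
  also have "\<dots> = adj A r \<otimes> poly_at h [:-\<i>, 1:]"
    using r c by (simp add: i adj_closed)
  also have "\<dots> = adj A (poly_at h [:\<i>, 1:] \<otimes> r)"
    using h r c by (simp add: adj_mult adj_poly_at map_poly_pCons)
  also have "\<dots> = \<one>" using r by (simp add: i[symmetric] star.adj_one)
  finally have "(nrm A U)\<^sup>2 \<le> 1"
    using nrm_cstar[OF U] norm.N_one_le by simp
  then have "nrm A U \<le> 1" by (simp add: abs_square_le_1 abs_le_iff)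
  moreover have "(2 * \<i>) \<odot> r = \<one> \<ominus> U"
    unfolding U_eq using r by (simp add: a_minus_def minus_add smult_closed a_assoc[symmetric] r_neg)
  then have "2 * nrm A r = nrm A (\<one> \<ominus> U)"
    using nrm_smult[OF r(1), of "2 * \<i>"] by (simp add: norm_mult)
  ultimately show ?thesis
    using norm.N_diff[of \<one> U] norm.N_one_le U by simp
qed

text \<open>For large \<open>T\<close> the C*-identity gives \<open>\<parallel>i T - h\<parallel>\<^sup>2 \<le> T\<^sup>2 + \<parallel>h\<parallel>\<^sup>2 < (1 + T)\<^sup>2\<close>,
  so \<open>h + i = i (1 + T) - (i T - h)\<close> is inverted by a Neumann series.\<close>

lemma self_adjoint_plus_i_invertible:
  assumes h: "h \<in> carrier A" "adj A h = h"
  obtains r where "r \<in> carrier A" "(h \<oplus> \<i> \<odot> \<one>) \<otimes> r = \<one>"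
proof -
  note c = poly_at_closed[OF h(1)]
  define T where "T = (nrm A h)\<^sup>2 + 1"
  have T: "0 < T" by (simp add: T_def add_nonneg_pos)
  define z where "z = \<i> * (1 + of_real T)"
  have z: "z \<noteq> 0" "cmod z = 1 + T"
  proof -
    have "z = \<i> * of_real (1 + T)" by (simp add: z_def)
    then show "cmod z = 1 + T" using T by (simp only: norm_mult norm_of_real) simp
    then show "z \<noteq> 0" using T by auto
  qed
  define q where "q = Polynomial.smult (1 / z) [:\<i> * of_real T, -1:]"
  have "map_poly cnj [:\<i> * of_real T, -1:] * [:\<i> * of_real T, -1:]
      = Polynomial.smult (of_real (T\<^sup>2)) 1 + [:0, 1:] * [:0, 1:]"
    by (simp add: map_poly_pCons one_pCons power2_eq_square) (simp add: complex_eq_iff)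
  then have "(nrm A (poly_at h [:\<i> * of_real T, -1:]))\<^sup>2
      = nrm A (poly_at h (Polynomial.smult (of_real (T\<^sup>2)) 1 + [:0, 1:] * [:0, 1:]))"
    using norm.N_poly_at(4)[OF h(1) h(2), of "[:\<i> * of_real T, -1:]"] by simp
  also have "\<dots> \<le> nrm A (poly_at h (Polynomial.smult (of_real (T\<^sup>2)) 1)) + nrm A (poly_at h ([:0, 1:] * [:0, 1:]))"
    by (rule norm.N_poly_at(1)[OF h(1)])
  also have "\<dots> \<le> T\<^sup>2 * nrm A \<one> + nrm A h * nrm A h"
    using h norm.N_poly_at(3)[OF h(1), of "of_real (T\<^sup>2)" 1] norm.N_poly_at(2)[OF h(1), of "[:0, 1:]" "[:0, 1:]"]
    by (simp add: poly_at_1 poly_at_linear smult_one star.smult_zero_left norm_power)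
  also have "\<dots> \<le> T\<^sup>2 + (nrm A h)\<^sup>2"
    using norm.N_one_le mult_left_mono[of "nrm A \<one>" 1 "T\<^sup>2"] by (simp add: power2_eq_square)
  also have "\<dots> < (1 + T)\<^sup>2"
    using T by (simp add: T_def power2_eq_square algebra_simps)
  finally have "nrm A (poly_at h [:\<i> * of_real T, -1:]) < 1 + T"
    using T by (simp add: power_less_imp_less_base)
  moreover have "(1 + T) * nrm A (poly_at h q) = nrm A (poly_at h [:\<i> * of_real T, -1:])"
    unfolding q_def norm.N_poly_at(3)[OF h(1)] using z T by (simp add: norm_divide)
  ultimately have "nrm A (poly_at h q) < 1"
    using T by (metis mult_less_cancel_left_pos mult.right_neutral add_pos_pos zero_less_one)
  from neumann_series[OF c this] obtain y where y: "y \<in> carrier A" "(\<one> \<ominus> poly_at h q) \<otimes> y = \<one>"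
    by blast
  have "Polynomial.smult z (1 - q) = [:\<i>, 1:]"
  proof -
    have "z - \<i> * of_real T = \<i>" by (simp add: z_def algebra_simps)
    then show ?thesis using z(1) by (simp add: q_def smult_diff_right one_pCons right_diff_distrib)
  qed
  then have "h \<oplus> \<i> \<odot> \<one> = z \<odot> (\<one> \<ominus> poly_at h q)"
    using h poly_at_smult[OF h(1), of z "1 - q"]
    by (simp add: poly_at_minus poly_at_1 poly_at_linear smult_one smult_closed a_comm)
  then have "(h \<oplus> \<i> \<odot> \<one>) \<otimes> ((1 / z) \<odot> y) = \<one>"
    using y c z by (simp add: smult_mult_left smult_mult_right smult_closed smult_smult[symmetric] smult_one)
  then show ?thesis
    using that y smult_closed by blast
qed

end

text \<open>
  An element with small image is replaced by \<open>a = (w + i)\<^sup>-\<^sup>1 + i\<close>, whose norm is at most \<open>2\<close>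
  whatever the norm of \<open>w\<close>, while \<open>\<phi> a - \<phi> w = - (\<phi> w)\<^sup>2 (\<phi> w + i)\<^sup>-\<^sup>1\<close> is of second order.
  This bounded lifting replaces the functional calculus in the proof that the range is closed.
\<close>

locale dense_star_hom = A: unital_cstar_algebra A + B: unital_cstar_algebra B + star_homomorphism A B \<phi>
  for A :: "('a, 'm) cstar_algebra_scheme" and B :: "('b, 'n) cstar_algebra_scheme" and \<phi> +
  assumes contractive: "contractive A B \<phi>"
    and dense: "\<And>b \<epsilon>. \<lbrakk>b \<in> carrier B; 0 < \<epsilon>\<rbrakk> \<Longrightarrow> \<exists>a\<in>carrier A. nrm B (b \<ominus>\<^bsub>B\<^esub> \<phi> a) < \<epsilon>"
begin

lemma lift_self_adjoint:
  assumes b: "b \<in> carrier B" "adj B b = b" "nrm B b \<le> 1 / 8"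
  obtains a where "a \<in> carrier A" "nrm A a \<le> 2" "nrm B (b \<ominus>\<^bsub>B\<^esub> \<phi> a) \<le> 1 / 32"
proof -
  \<comment> \<open>The error 1 / 128 is not increased by passing to the self-adjoint part w. Then
    \<phi> w has norm at most 1 / 8 + 1 / 128 = 17 / 128, and 1 / 128 plus the square of 17 / 128 is
    below 1 / 32.\<close>
  obtain w0 where w0: "w0 \<in> carrier A" "nrm B (b \<ominus>\<^bsub>B\<^esub> \<phi> w0) < 1 / 128"
    using dense[OF b(1), of "1 / 128"] by auto
  define w where "w = (1 / 2) \<odot>\<^bsub>A\<^esub> (w0 \<oplus>\<^bsub>A\<^esub> adj A w0)"
  have w: "w \<in> carrier A" "adj A w = w"
    using w0 by (simp_all add: w_def A.smult_closed A.adj_closed A.adj_smult A.adj_add A.adj_adj A.a_comm)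
  have "b \<ominus>\<^bsub>B\<^esub> \<phi> w = (1 / 2) \<odot>\<^bsub>B\<^esub> ((b \<ominus>\<^bsub>B\<^esub> \<phi> w0) \<oplus>\<^bsub>B\<^esub> adj B (b \<ominus>\<^bsub>B\<^esub> \<phi> w0))"
  proof -
    have "b = (1 / 2) \<odot>\<^bsub>B\<^esub> (b \<oplus>\<^bsub>B\<^esub> b)"
      using b B.smult_l_distr[of b "1 / 2" "1 / 2"] by (simp add: B.smult_r_distr B.smult_one)
    moreover have "\<phi> w = (1 / 2) \<odot>\<^bsub>B\<^esub> (\<phi> w0 \<oplus>\<^bsub>B\<^esub> adj B (\<phi> w0))"
      using w0 by (simp add: w_def hom_smult hom_adj A.adj_closed)
    ultimately have "b \<ominus>\<^bsub>B\<^esub> \<phi> w = (1 / 2) \<odot>\<^bsub>B\<^esub> ((b \<oplus>\<^bsub>B\<^esub> b) \<ominus>\<^bsub>B\<^esub> (\<phi> w0 \<oplus>\<^bsub>B\<^esub> adj B (\<phi> w0)))"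
      using b w0 B.smult_diff[of "b \<oplus>\<^bsub>B\<^esub> b" "\<phi> w0 \<oplus>\<^bsub>B\<^esub> adj B (\<phi> w0)" "1 / 2"] by (simp add: B.adj_closed)
    also have "(b \<oplus>\<^bsub>B\<^esub> b) \<ominus>\<^bsub>B\<^esub> (\<phi> w0 \<oplus>\<^bsub>B\<^esub> adj B (\<phi> w0)) = (b \<ominus>\<^bsub>B\<^esub> \<phi> w0) \<oplus>\<^bsub>B\<^esub> adj B (b \<ominus>\<^bsub>B\<^esub> \<phi> w0)"
      using b w0 by (simp add: B.adj_diff B.adj_closed) (simp add: a_minus_def B.minus_add B.a_ac B.adj_closed)
    finally show ?thesis .
  qed
  then have "nrm B (b \<ominus>\<^bsub>B\<^esub> \<phi> w) \<le> (1 / 2) * (nrm B (b \<ominus>\<^bsub>B\<^esub> \<phi> w0) + nrm B (adj B (b \<ominus>\<^bsub>B\<^esub> \<phi> w0)))"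
    using b w0 B.nrm_add[of "b \<ominus>\<^bsub>B\<^esub> \<phi> w0" "adj B (b \<ominus>\<^bsub>B\<^esub> \<phi> w0)"]
    by (simp add: B.nrm_smult B.adj_closed)
  also have "\<dots> \<le> 1 / 128"
    using b w0 by (simp add: B.norm.N_adj)
  finally have bw: "nrm B (b \<ominus>\<^bsub>B\<^esub> \<phi> w) \<le> 1 / 128" .
  define v where "v = \<phi> w"
  have v: "v \<in> carrier B" "adj B v = v"
    using w hom_adj[OF w(1)] by (simp_all add: v_def)
  have nv: "nrm B v \<le> 17 / 128"
    using B.norm.N_abs_diff[of b v] bw b v by (simp add: v_def)
  obtain r where r: "r \<in> carrier A" "(w \<oplus>\<^bsub>A\<^esub> \<i> \<odot>\<^bsub>A\<^esub> \<one>\<^bsub>A\<^esub>) \<otimes>\<^bsub>A\<^esub> r = \<one>\<^bsub>A\<^esub>"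
    using A.self_adjoint_plus_i_invertible[OF w] by blast
  then have "nrm A r \<le> 1" using A.nrm_adjoint_plus_i[OF w] by blast
  have \<phi>r: "\<phi> r \<in> carrier B" "nrm B (\<phi> r) \<le> 1"
    using \<open>nrm A r \<le> 1\<close> r contractive by (auto simp: contractive_def intro: order_trans)
  have vr: "v \<otimes>\<^bsub>B\<^esub> \<phi> r \<oplus>\<^bsub>B\<^esub> \<i> \<odot>\<^bsub>B\<^esub> \<phi> r = \<one>\<^bsub>B\<^esub>"
    using arg_cong[OF r(2), of \<phi>] r(1) w(1)
    by (simp add: hom_smult A.smult_closed B.l_distr B.smult_closed B.smult_mult_left flip: v_def)
      (simp add: v_def B.l_distr B.smult_closed B.smult_mult_left)
  define a where "a = r \<oplus>\<^bsub>A\<^esub> \<i> \<odot>\<^bsub>A\<^esub> \<one>\<^bsub>A\<^esub>"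
  have a: "a \<in> carrier A" using r by (simp add: a_def A.smult_closed)
  have "nrm A a \<le> nrm A r + nrm A (\<i> \<odot>\<^bsub>A\<^esub> \<one>\<^bsub>A\<^esub>)"
    using r by (simp add: a_def A.nrm_add A.smult_closed)
  also have "\<dots> \<le> 2"
    using A.norm.N_one_le \<open>nrm A r \<le> 1\<close> by (simp add: A.nrm_smult)
  finally have na: "nrm A a \<le> 2" .
  \<comment> \<open>Multiplying v r' + i r' = 1, with r' = \<phi> r, by v gives v = v v r' + i v r';
    multiplying it by i gives i = i v r' - r', so that \<phi> a = r' + i = i v r'.\<close>
  have "v \<ominus>\<^bsub>B\<^esub> \<phi> a = v \<otimes>\<^bsub>B\<^esub> v \<otimes>\<^bsub>B\<^esub> \<phi> r"
  proof -
    let ?r = "\<phi> r"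
    have c: "v \<otimes>\<^bsub>B\<^esub> ?r \<in> carrier B" "\<i> \<odot>\<^bsub>B\<^esub> ?r \<in> carrier B"
      using v \<phi>r by (simp_all add: B.smult_closed)
    have 1: "v = v \<otimes>\<^bsub>B\<^esub> v \<otimes>\<^bsub>B\<^esub> ?r \<oplus>\<^bsub>B\<^esub> \<i> \<odot>\<^bsub>B\<^esub> (v \<otimes>\<^bsub>B\<^esub> ?r)"
      using arg_cong[OF vr, of "\<lambda>x. v \<otimes>\<^bsub>B\<^esub> x"] v \<phi>r c
      by (simp add: B.r_distr B.smult_mult_right B.m_assoc)
    have 2: "\<i> \<odot>\<^bsub>B\<^esub> \<one>\<^bsub>B\<^esub> = \<i> \<odot>\<^bsub>B\<^esub> (v \<otimes>\<^bsub>B\<^esub> ?r) \<oplus>\<^bsub>B\<^esub> \<ominus>\<^bsub>B\<^esub> ?r"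
      using arg_cong[OF vr, of "\<lambda>x. \<i> \<odot>\<^bsub>B\<^esub> x"] v \<phi>r c
      by (simp add: B.smult_r_distr B.smult_smult[symmetric] B.star.smult_minus_one)
    have "\<phi> a = ?r \<oplus>\<^bsub>B\<^esub> \<i> \<odot>\<^bsub>B\<^esub> \<one>\<^bsub>B\<^esub>"
      using r by (simp add: a_def hom_smult A.smult_closed)
    also have "\<dots> = \<i> \<odot>\<^bsub>B\<^esub> (v \<otimes>\<^bsub>B\<^esub> ?r)"
      unfolding 2 using c \<phi>r B.a_lcomm[of ?r "\<i> \<odot>\<^bsub>B\<^esub> (v \<otimes>\<^bsub>B\<^esub> ?r)" "\<ominus>\<^bsub>B\<^esub> ?r"]
      by (simp add: B.smult_closed B.r_neg)
    finally have \<phi>a: "\<phi> a = \<i> \<odot>\<^bsub>B\<^esub> (v \<otimes>\<^bsub>B\<^esub> ?r)" .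
    show ?thesis
      unfolding \<phi>a by (subst (1) 1) (use c v \<phi>r in \<open>simp add: a_minus_def B.smult_closed B.a_assoc B.r_neg\<close>)
  qed
  then have "nrm B (v \<ominus>\<^bsub>B\<^esub> \<phi> a) \<le> nrm B (v \<otimes>\<^bsub>B\<^esub> v) * nrm B (\<phi> r)"
    using v \<phi>r B.nrm_mult by simp
  also have "\<dots> \<le> (nrm B v * nrm B v) * 1"
    using v \<phi>r by (intro mult_mono B.nrm_mult B.norm.N_nonneg mult_nonneg_nonneg) auto
  also have "\<dots> \<le> (17 / 128 * (17 / 128)) * 1"
    using v nv by (intro mult_mono B.norm.N_nonneg mult_nonneg_nonneg) auto
  finally have "nrm B (b \<ominus>\<^bsub>B\<^esub> \<phi> a) \<le> 1 / 128 + 17 / 128 * (17 / 128)"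
    using B.norm.N_triangle[of b v "\<phi> a"] b v a bw by (simp add: v_def)
  then show ?thesis using that[OF a na] by simp
qed

text \<open>Scaling by 1 / (8 c) makes the self-adjoint and skew parts accessible to
  \<open>lift_self_adjoint\<close>. Recombined, the lift has norm at most 4 and error at most 1 /
  16; scaling back by 8 c gives 32 c and c / 2. The factor 1 / 2 drives the iteration in
  \<open>surjective\<close>.\<close>

lemma lift_approx:
  assumes b: "b \<in> carrier B" "nrm B b \<le> c" and c: "0 < c"
  obtains a where "a \<in> carrier A" "nrm A a \<le> 32 * c" "nrm B (b \<ominus>\<^bsub>B\<^esub> \<phi> a) \<le> c / 2"
proof -
  define k where "k = 1 / (8 * c)"
  have k: "0 < k" "k * c = 1 / 8" using c by (auto simp: k_def)
  define d where "d = of_real k \<odot>\<^bsub>B\<^esub> b"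
  have d: "d \<in> carrier B" "nrm B d \<le> 1 / 8"
  proof -
    have "k * nrm B b \<le> k * c" using b k by (intro mult_left_mono) auto
    then show "d \<in> carrier B" "nrm B d \<le> 1 / 8"
      using b k by (auto simp: d_def B.smult_closed B.nrm_smult)
  qed
  define d1 where "d1 = (1 / 2) \<odot>\<^bsub>B\<^esub> (d \<oplus>\<^bsub>B\<^esub> adj B d)"
  define d2 where "d2 = (- \<i> / 2) \<odot>\<^bsub>B\<^esub> (d \<ominus>\<^bsub>B\<^esub> adj B d)"
  note dc = d(1) B.adj_closed[OF d(1)]
  have d1: "d1 \<in> carrier B" "adj B d1 = d1" "nrm B d1 \<le> 1 / 8"
    using dc d(2) B.nrm_add[OF dc] 
    by (simp_all add: d1_def B.smult_closed B.adj_smult B.adj_add B.adj_adj B.a_comm B.nrm_smult B.norm.N_adj)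
  have "adj B d2 = (\<i> / 2) \<odot>\<^bsub>B\<^esub> (adj B d \<ominus>\<^bsub>B\<^esub> d)"
    using dc by (simp add: d2_def B.adj_smult B.adj_diff B.adj_adj)
  also have "adj B d \<ominus>\<^bsub>B\<^esub> d = (-1) \<odot>\<^bsub>B\<^esub> (d \<ominus>\<^bsub>B\<^esub> adj B d)"
    using dc by (simp add: B.star.smult_minus_one) (simp add: a_minus_def B.minus_add B.a_comm)
  also have "(\<i> / 2) \<odot>\<^bsub>B\<^esub> \<dots> = d2"
    using dc by (simp add: d2_def B.smult_smult[symmetric])
  finally have d2: "d2 \<in> carrier B" "adj B d2 = d2" "nrm B d2 \<le> 1 / 8"
    using dc d(2) B.norm.N_diff[OF dc]
    by (simp_all add: d2_def B.smult_closed B.nrm_smult B.norm.N_adj norm_divide)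
  have d_eq: "d = d1 \<oplus>\<^bsub>B\<^esub> \<i> \<odot>\<^bsub>B\<^esub> d2"
  proof -
    have "\<i> \<odot>\<^bsub>B\<^esub> d2 = (1 / 2) \<odot>\<^bsub>B\<^esub> (d \<ominus>\<^bsub>B\<^esub> adj B d)"
      using dc by (simp add: d2_def B.smult_smult[symmetric])
    then have "d1 \<oplus>\<^bsub>B\<^esub> \<i> \<odot>\<^bsub>B\<^esub> d2 = (1 / 2) \<odot>\<^bsub>B\<^esub> ((d \<oplus>\<^bsub>B\<^esub> adj B d) \<oplus>\<^bsub>B\<^esub> (d \<ominus>\<^bsub>B\<^esub> adj B d))"
      using dc B.smult_r_distr[of "d \<oplus>\<^bsub>B\<^esub> adj B d" "d \<ominus>\<^bsub>B\<^esub> adj B d"] by (simp add: d1_def)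
    also have "(d \<oplus>\<^bsub>B\<^esub> adj B d) \<oplus>\<^bsub>B\<^esub> (d \<ominus>\<^bsub>B\<^esub> adj B d) = d \<oplus>\<^bsub>B\<^esub> d"
      using dc by (simp add: a_minus_def B.a_ac) (metis B.a_lcomm B.add.inv_closed B.r_neg B.r_zero)
    also have "(1 / 2) \<odot>\<^bsub>B\<^esub> (d \<oplus>\<^bsub>B\<^esub> d) = d"
      using dc B.smult_l_distr[of d "1 / 2" "1 / 2"] by (simp add: B.smult_r_distr B.smult_one)
    finally show ?thesis by simp
  qed
  obtain a1 where a1: "a1 \<in> carrier A" "nrm A a1 \<le> 2" "nrm B (d1 \<ominus>\<^bsub>B\<^esub> \<phi> a1) \<le> 1 / 32"
    using lift_self_adjoint[OF d1] by blast
  obtain a2 where a2: "a2 \<in> carrier A" "nrm A a2 \<le> 2" "nrm B (d2 \<ominus>\<^bsub>B\<^esub> \<phi> a2) \<le> 1 / 32"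
    using lift_self_adjoint[OF d2] by blast
  define a0 where "a0 = a1 \<oplus>\<^bsub>A\<^esub> \<i> \<odot>\<^bsub>A\<^esub> a2"
  have a0: "a0 \<in> carrier A" "nrm A a0 \<le> 4"
    using a1 a2 A.nrm_add[of a1 "\<i> \<odot>\<^bsub>A\<^esub> a2"] by (simp_all add: a0_def A.smult_closed A.nrm_smult)
  have "d \<ominus>\<^bsub>B\<^esub> \<phi> a0 = (d1 \<ominus>\<^bsub>B\<^esub> \<phi> a1) \<oplus>\<^bsub>B\<^esub> \<i> \<odot>\<^bsub>B\<^esub> (d2 \<ominus>\<^bsub>B\<^esub> \<phi> a2)"
    unfolding d_eq a0_def using d1 d2 a1 a2
    by (simp add: hom_smult A.smult_closed B.smult_diff)
      (simp add: a_minus_def B.minus_add B.a_ac B.smult_closed)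
  then have "nrm B (d \<ominus>\<^bsub>B\<^esub> \<phi> a0) \<le> nrm B (d1 \<ominus>\<^bsub>B\<^esub> \<phi> a1) + nrm B (d2 \<ominus>\<^bsub>B\<^esub> \<phi> a2)"
    using d1 d2 a1 a2 B.nrm_add[of "d1 \<ominus>\<^bsub>B\<^esub> \<phi> a1" "\<i> \<odot>\<^bsub>B\<^esub> (d2 \<ominus>\<^bsub>B\<^esub> \<phi> a2)"]
    by (simp add: B.smult_closed B.nrm_smult)
  then have da: "nrm B (d \<ominus>\<^bsub>B\<^esub> \<phi> a0) \<le> 1 / 16" using a1 a2 by simp
  let ?a = "of_real (1 / k) \<odot>\<^bsub>A\<^esub> a0"
  have "b = of_real (1 / k) \<odot>\<^bsub>B\<^esub> d"
    using b k by (simp add: d_def B.smult_smult[symmetric] B.smult_one)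
  then have "b \<ominus>\<^bsub>B\<^esub> \<phi> ?a = of_real (1 / k) \<odot>\<^bsub>B\<^esub> (d \<ominus>\<^bsub>B\<^esub> \<phi> a0)"
    using d a0 by (simp add: hom_smult B.smult_diff)
  then have "nrm B (b \<ominus>\<^bsub>B\<^esub> \<phi> ?a) = 1 / k * nrm B (d \<ominus>\<^bsub>B\<^esub> \<phi> a0)"
    using d a0 k B.nrm_smult[of "d \<ominus>\<^bsub>B\<^esub> \<phi> a0" "of_real (1 / k)"] by (simp add: norm_divide)
  also have "\<dots> \<le> 1 / k * (1 / 16)"
    using da k by (intro mult_left_mono) auto
  finally have "nrm B (b \<ominus>\<^bsub>B\<^esub> \<phi> ?a) \<le> c / 2" using c by (simp add: k_def)
  moreover have "nrm A ?a \<le> 32 * c"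
    using a0 k c A.nrm_smult[of a0 "of_real (1 / k)"] mult_left_mono[OF a0(2), of "1 / k"]
    by (simp add: norm_divide k_def)
  ultimately show ?thesis using that A.smult_closed[OF a0(1)] by blast
qed

text \<open>The argument of the open mapping theorem: the remainder is lifted again and again, the
  corrections decrease geometrically in A, so their sum exists there, and by contractivity it is
  sent to b.\<close>

lemma surjective: "\<phi> ` carrier A = carrier B"
proof (intro equalityI subsetI)
  fix b assume b: "b \<in> carrier B"
  \<comment> \<open>The added 1 keeps c positive when b is 0, as \<open>lift_approx\<close>
    requires.\<close>
  define c where "c = nrm B b + 1"
  have c: "0 < c" "nrm B b \<le> c" using B.norm.N_nonneg[OF b] by (auto simp: c_def)
  have "\<exists>s. \<forall>n. (s n \<in> carrier A \<and> nrm B (b \<ominus>\<^bsub>B\<^esub> \<phi> (s n)) \<le> c * (1 / 2) ^ n) \<and>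
      nrm A (s (Suc n) \<ominus>\<^bsub>A\<^esub> s n) \<le> 32 * c * (1 / 2) ^ n"
  proof (rule dependent_nat_choice)
    show "\<exists>x. x \<in> carrier A \<and> nrm B (b \<ominus>\<^bsub>B\<^esub> \<phi> x) \<le> c * (1 / 2) ^ 0"
      using b c by (intro exI[of _ "\<zero>\<^bsub>A\<^esub>"]) (simp add: B.norm.diff_zero)
    fix x n assume x: "x \<in> carrier A \<and> nrm B (b \<ominus>\<^bsub>B\<^esub> \<phi> x) \<le> c * (1 / 2) ^ n"
    then obtain a where a: "a \<in> carrier A" "nrm A a \<le> 32 * (c * (1 / 2) ^ n)"
      "nrm B ((b \<ominus>\<^bsub>B\<^esub> \<phi> x) \<ominus>\<^bsub>B\<^esub> \<phi> a) \<le> c * (1 / 2) ^ n / 2"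
      using lift_approx[of "b \<ominus>\<^bsub>B\<^esub> \<phi> x" "c * (1 / 2) ^ n"] b c by auto
    have "(b \<ominus>\<^bsub>B\<^esub> \<phi> x) \<ominus>\<^bsub>B\<^esub> \<phi> a = b \<ominus>\<^bsub>B\<^esub> \<phi> (x \<oplus>\<^bsub>A\<^esub> a)"
      using x a b by (simp add: a_minus_def B.minus_add B.a_ac)
    moreover have "(x \<oplus>\<^bsub>A\<^esub> a) \<ominus>\<^bsub>A\<^esub> x = a"
      using x a by (simp add: a_minus_def A.a_ac A.r_neg)
    ultimately show "\<exists>y. (y \<in> carrier A \<and> nrm B (b \<ominus>\<^bsub>B\<^esub> \<phi> y) \<le> c * (1 / 2) ^ Suc n) \<and>
        nrm A (y \<ominus>\<^bsub>A\<^esub> x) \<le> 32 * c * (1 / 2) ^ n"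
      using x a by (intro exI[of _ "x \<oplus>\<^bsub>A\<^esub> a"]) simp
  qed
  then obtain s where s: "\<And>n. s n \<in> carrier A" "\<And>n. nrm B (b \<ominus>\<^bsub>B\<^esub> \<phi> (s n)) \<le> c * (1 / 2) ^ n"
    "\<And>n. nrm A (s (Suc n) \<ominus>\<^bsub>A\<^esub> s n) \<le> 32 * c * (1 / 2) ^ n" by blast
  obtain a where a: "A.norm.near sequentially s (\<lambda>n. a)"
    using A.geometric_limit(2)[OF s(1,3)] by auto
  then have ac: "a \<in> carrier A" by (rule A.norm.near_closed(2))
  have "B.norm.near sequentially (\<lambda>n. \<phi> (s n)) (\<lambda>n. \<phi> a)"
    by (rule B.norm.near_bound[OF _ _ _ A.norm.nearD[OF a]])
      (use s ac contractive in \<open>auto simp: hom_diff[symmetric] contractive_def\<close>)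
  moreover have "B.norm.near sequentially (\<lambda>n. \<phi> (s n)) (\<lambda>n. b)"
  proof (rule B.norm.near_bound)
    show "(\<lambda>n. c * (1 / 2) ^ n) \<longlonglongrightarrow> 0"
      by (rule tendsto_eq_rhs[OF tendsto_mult[OF tendsto_const LIMSEQ_power_zero]]) auto
    show "nrm B (\<phi> (s n) \<ominus>\<^bsub>B\<^esub> b) \<le> c * (1 / 2) ^ n" for n
      using s(1,2)[of n] b B.norm.N_diff_commute[of b "\<phi> (s n)"] by simp
  qed (use s b in auto)
  ultimately have "b = \<phi> a" by (rule B.near_const_eq[symmetric])
  then show "b \<in> \<phi> ` carrier A" using ac by blast
qed auto

end


section \<open>Positive functionals and the GNS seminorm\<close>

text \<open>In the order on the complex numbers \<open>0 \<le> z\<close> includes that z is real;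
  this is the source of the symmetry of \<open>form\<close>.\<close>

locale positive_functional = unital_star_algebra P
  for P :: "('a, 'm) star_algebra_scheme" (structure) +
  fixes \<omega> :: "'a \<Rightarrow> complex"
  assumes fn_add: "\<lbrakk>x \<in> carrier P; y \<in> carrier P\<rbrakk> \<Longrightarrow> \<omega> (x \<oplus> y) = \<omega> x + \<omega> y"
    and fn_smult: "x \<in> carrier P \<Longrightarrow> \<omega> (c \<odot> x) = c * \<omega> x"
    and fn_pos: "x \<in> carrier P \<Longrightarrow> 0 \<le> \<omega> (adj P x \<otimes> x)"
begin

definition form :: "'a \<Rightarrow> 'a \<Rightarrow> complex" where "form x y = \<omega> (adj P x \<otimes> y)"

definition qf :: "'a \<Rightarrow> real" where "qf x = Re (form x x)"

lemma form_self: "x \<in> carrier P \<Longrightarrow> form x x = of_real (qf x)" "x \<in> carrier P \<Longrightarrow> 0 \<le> qf x"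
  using fn_pos[of x] by (auto simp: form_def qf_def less_eq_complex_def complex_eq_iff)

lemma form_add:
  "\<lbrakk>x \<in> carrier P; y \<in> carrier P; z \<in> carrier P\<rbrakk> \<Longrightarrow> form (x \<oplus> y) z = form x z + form y z"
  "\<lbrakk>x \<in> carrier P; y \<in> carrier P; z \<in> carrier P\<rbrakk> \<Longrightarrow> form z (x \<oplus> y) = form z x + form z y"
  by (simp_all add: form_def adj_add adj_closed l_distr r_distr fn_add)

lemma form_smult:
  "\<lbrakk>x \<in> carrier P; y \<in> carrier P\<rbrakk> \<Longrightarrow> form (c \<odot> x) y = cnj c * form x y"
  "\<lbrakk>x \<in> carrier P; y \<in> carrier P\<rbrakk> \<Longrightarrow> form x (c \<odot> y) = c * form x y"
  by (simp_all add: form_def adj_smult adj_closed smult_mult_left smult_mult_right fn_smult)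

lemma form_mult_left:
  "\<lbrakk>x \<in> carrier P; y \<in> carrier P; z \<in> carrier P\<rbrakk> \<Longrightarrow> form (x \<otimes> y) z = form y (adj P x \<otimes> z)"
  by (simp add: form_def adj_mult adj_closed m_assoc)

text \<open>Polarization: the form is real at x + y and at x + i y, which fixes the imaginary and
  the real part of the difference respectively.\<close>

lemma form_commute:
  assumes "x \<in> carrier P" "y \<in> carrier P"
  shows "form y x = cnj (form x y)"
proof -
  have "form x y + form y x \<in> \<real>"
    using form_self(1)[of "x \<oplus> y"] form_self(1)[OF assms(1)] form_self(1)[OF assms(2)] assms
    by (simp add: form_add complex_is_Real_iff complex_eq_iff)
  moreover have "\<i> * form x y - \<i> * form y x \<in> \<real>"
    using form_self(1)[of "x \<oplus> \<i> \<odot> y"] form_self(1)[OF assms(1)] form_self(1)[OF assms(2)] assms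
    by (simp add: form_add form_smult smult_closed complex_is_Real_iff complex_eq_iff)
  ultimately show ?thesis
    by (simp add: complex_is_Real_iff complex_eq_iff)
qed

lemma qf_smult:
  assumes "x \<in> carrier P"
  shows "qf (c \<odot> x) = (cmod c)\<^sup>2 * qf x"
proof -
  have "form (c \<odot> x) (c \<odot> x) = of_real ((cmod c)\<^sup>2) * form x x"
    using assms by (simp add: form_smult smult_closed complex_norm_square mult_ac del: of_real_power)
  then show ?thesis by (simp add: qf_def del: of_real_power)
qed

lemma qf_add_smult:
  assumes "x \<in> carrier P" "y \<in> carrier P"
  shows "qf (x \<oplus> c \<odot> y) = qf x + 2 * Re (c * form x y) + (cmod c)\<^sup>2 * qf y"
proof -
  have "form (x \<oplus> c \<odot> y) (x \<oplus> c \<odot> y) = form x x + (c * form x y + cnj (c * form x y)) + form (c \<odot> y) (c \<odot> y)"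
    using assms form_commute[OF assms] by (simp add: form_add form_smult smult_closed algebra_simps)
  then show ?thesis
    using qf_smult[OF assms(2), of c] by (simp add: qf_def)
qed

lemma cauchy_schwarz:
  assumes "x \<in> carrier P" "y \<in> carrier P"
  shows "(cmod (form x y))\<^sup>2 \<le> qf x * qf y"
proof -
  define w where "w = (cmod (form x y))\<^sup>2"
  have quad: "0 \<le> qf x - 2 * t * w + t\<^sup>2 * w * qf y" for t :: real
  proof -
    \<comment> \<open>The factor \<open>cnj (form x y)\<close> cancels the phase of the mixed term,
      which leaves a quadratic polynomial in the real variable t.\<close>
    let ?c = "- of_real t * cnj (form x y)"
    have "?c * form x y = of_real (- t * w)"
      by (simp add: w_def complex_norm_square[symmetric] mult.assoc mult.commute[of "cnj _"] del: of_real_power)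
    moreover have "(cmod ?c)\<^sup>2 = t\<^sup>2 * w"
      by (simp add: w_def norm_mult power_mult_distrib)
    ultimately have "qf (x \<oplus> ?c \<odot> y) = qf x + 2 * (- t * w) + t\<^sup>2 * w * qf y"
      unfolding qf_add_smult[OF assms] by (simp only: Re_complex_of_real)
    then show ?thesis
      using form_self(2)[of "x \<oplus> ?c \<odot> y"] assms by (simp add: smult_closed)
  qed
  have "w \<le> qf x * qf y"
  proof (cases "qf y = 0")
    case True
    show ?thesis
    proof (rule ccontr)
      assume "\<not> w \<le> qf x * qf y"
      then have "0 < w" using True by simp
      \<comment> \<open>For qf y = 0 the polynomial is linear in t, and at this t its value is - qf
        x - 2.\<close>
      then show False using quad[of "(qf x + 1) / w"] True form_self(2)[OF assms(1)] by simp
    qed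
  next
    case False
    then have "0 < qf y" using form_self(2)[OF assms(2)] by simp
    \<comment> \<open>The minimum of the quadratic polynomial is at t = 1 / qf y.\<close>
    then show ?thesis
      using quad[of "1 / qf y"] by (simp add: power2_eq_square field_simps)
  qed
  then show ?thesis by (simp add: w_def)
qed

lemma sqrt_qf_add:
  assumes "x \<in> carrier P" "y \<in> carrier P"
  shows "sqrt (qf (x \<oplus> y)) \<le> sqrt (qf x) + sqrt (qf y)"
proof -
  note nonneg = form_self(2)[OF assms(1)] form_self(2)[OF assms(2)]
  have "Re (form x y) \<le> cmod (form x y)" by (rule complex_Re_le_cmod)
  also have "\<dots> \<le> sqrt (qf x * qf y)" using cauchy_schwarz[OF assms] by (rule real_le_rsqrt)
  finally have "qf (x \<oplus> y) \<le> (sqrt (qf x) + sqrt (qf y))\<^sup>2"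
    using qf_add_smult[OF assms, of 1] assms nonneg by (simp add: smult_one power2_sum real_sqrt_mult)
  then show ?thesis
    using nonneg by (intro real_le_lsqrt) auto
qed

end

text \<open>The bound l is merely submultiplicative, without a C*-identity, so that a weighted sum
  of absolute values of coefficients can play its role. This already makes left multiplication
  bounded for the form of \<omega>.\<close>

locale bounded_positive_functional = positive_functional P \<omega>
  for P :: "('a, 'm) star_algebra_scheme" (structure) and \<omega> +
  fixes l :: "'a \<Rightarrow> real"
  assumes bd_nonneg: "x \<in> carrier P \<Longrightarrow> 0 \<le> l x"
    and bd_mult: "\<lbrakk>x \<in> carrier P; y \<in> carrier P\<rbrakk> \<Longrightarrow> l (x \<otimes> y) \<le> l x * l y"
    and bd: "x \<in> carrier P \<Longrightarrow> cmod (\<omega> x) \<le> l x"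
begin

text \<open>Iterating Cauchy-Schwarz: with \<open>h = x\<^sup>* x\<close> the numbers \<open>\<omega> (y\<^sup>* h\<^sup>m y) / \<omega> (y\<^sup>* y)\<close> dominate the
  \<open>m\<close>-th power of the first one when \<open>m\<close> is a power of two, and they grow at most like \<open>(l h)\<^sup>m\<close>.\<close>

lemma qf_mult_le:
  assumes x: "x \<in> carrier P" and y: "y \<in> carrier P"
  shows "qf (x \<otimes> y) \<le> l (adj P x \<otimes> x) * qf y"
proof -
  define h where "h = rec_nat (adj P x \<otimes> x) (\<lambda>_ z. z \<otimes> z)"
  have h: "h 0 = adj P x \<otimes> x" "h (Suc n) = h n \<otimes> h n" for n by (simp_all add: h_def)
  have hc: "h n \<in> carrier P" "adj P (h n) = h n" for n
    by (induction n) (use x in \<open>auto simp: h adj_closed adj_mult adj_adj\<close>)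
  have lh: "l (h n) \<le> l (h 0) ^ (2 ^ n)" for n
  proof (induction n)
    case (Suc n)
    have "l (h (Suc n)) \<le> l (h n) * l (h n)" using hc by (simp add: h bd_mult)
    also have "\<dots> \<le> l (h 0) ^ (2 ^ n) * l (h 0) ^ (2 ^ n)"
      using Suc hc by (intro mult_mono bd_nonneg zero_le_power) auto
    finally show ?case by (simp add: power_add[symmetric] mult_2)
  qed simp
  define a where "a n = Re (form y (h n \<otimes> y))" for n
  have a0: "qf (x \<otimes> y) = a 0"
    using x y by (simp add: a_def h qf_def form_mult_left adj_closed m_assoc)
  have qf_h: "qf (h n \<otimes> y) = a (Suc n)" for n
    using hc y by (simp add: a_def h qf_def form_mult_left m_assoc)
  have step: "(a n)\<^sup>2 \<le> qf y * a (Suc n)" for n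
  proof -
    have "(a n)\<^sup>2 \<le> (cmod (form y (h n \<otimes> y)))\<^sup>2"
      unfolding a_def by (rule power2_le_iff_abs_le[THEN iffD2]) (auto simp: abs_Re_le_cmod)
    also have "\<dots> \<le> qf y * a (Suc n)"
      using cauchy_schwarz[of y "h n \<otimes> y"] hc y by (simp add: qf_h)
    finally show ?thesis .
  qed
  show ?thesis
  proof (cases "qf y = 0")
    case True
    then show ?thesis using step[of 0] a0 by simp
  next
    case False
    then have qy: "0 < qf y" using form_self(2)[OF y] by simp
    have grow: "(a 0 / qf y) ^ (2 ^ n) \<le> a n / qf y" for n
    proof (induction n)
      case (Suc n)
      have "0 \<le> a 0 / qf y" using qy form_self(2)[of "x \<otimes> y"] x y by (simp add: a0)
      then have "(a 0 / qf y) ^ (2 ^ Suc n) \<le> (a n / qf y)\<^sup>2"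
        using power_mono[OF Suc, of 2] by (simp add: power_mult[symmetric] mult.commute)
      also have "\<dots> \<le> a (Suc n) / qf y"
        using step[of n] qy by (simp add: power2_eq_square field_simps)
      finally show ?case .
    qed simp
    \<comment> \<open>The prefactor depends on y but not on n, so taking roots removes it.\<close>
    have "(a 0 / qf y) ^ (2 ^ n) \<le> l (adj P y) * l y / qf y * l (h 0) ^ (2 ^ n)" for n
    proof -
      have "a n \<le> cmod (form y (h n \<otimes> y))" by (simp add: a_def complex_Re_le_cmod)
      also have "\<dots> \<le> l (adj P y \<otimes> (h n \<otimes> y))"
        unfolding form_def using hc y by (intro bd) (auto simp: adj_closed)
      also have "\<dots> \<le> l (adj P y) * (l (h n) * l y)"
        using hc y by (intro order_trans[OF bd_mult] mult_left_mono bd_mult bd_nonneg) (auto simp: adj_closed)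
      also have "\<dots> \<le> l (adj P y) * (l (h 0) ^ (2 ^ n) * l y)"
        using y lh by (intro mult_left_mono mult_right_mono bd_nonneg) (auto simp: adj_closed)
      finally have "a n / qf y \<le> l (adj P y) * (l (h 0) ^ (2 ^ n) * l y) / qf y"
        using qy by (simp add: divide_right_mono)
      then show ?thesis using grow[of n] by (simp add: mult_ac)
    qed
    then have "a 0 / qf y \<le> l (h 0)"
      by (rule le_of_power_two_power_le) (use hc in \<open>auto intro: bd_nonneg\<close>)
    then show ?thesis using qy by (simp add: a0 h field_simps)
  qed
qed

end

text \<open>\<open>spatial_seminorm\<close> with the product states replaced by an arbitrary set of
  functionals: the supremum of the operator norms of left multiplication by x in their GNS
  representations. The general form separates the C*-seminorm argument from tensors.\<close>

definition gns_seminorm :: "('a, 'm) star_algebra_scheme \<Rightarrow> ('a \<Rightarrow> complex) set \<Rightarrow> 'a \<Rightarrow> real" where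
  "gns_seminorm P \<Omega> x = Sup (insert 0 {sqrt (Re (\<omega> (adj P (x \<otimes>\<^bsub>P\<^esub> y) \<otimes>\<^bsub>P\<^esub> (x \<otimes>\<^bsub>P\<^esub> y)))) | \<omega> y.
     \<omega> \<in> \<Omega> \<and> y \<in> carrier P \<and> \<omega> (adj P y \<otimes>\<^bsub>P\<^esub> y) = 1})"

locale bounded_positive_functionals = unital_star_algebra P
  for P :: "('a, 'm) star_algebra_scheme" (structure) +
  fixes \<Omega> :: "('a \<Rightarrow> complex) set" and l :: "'a \<Rightarrow> real"
  assumes functional: "\<omega> \<in> \<Omega> \<Longrightarrow> bounded_positive_functional P \<omega> l"
begin

abbreviation N where "N \<equiv> gns_seminorm P \<Omega>"
abbreviation Q where "Q \<omega> x \<equiv> Re (\<omega> (adj P x \<otimes> x))"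

lemma gns_bdd_above:
  assumes x: "x \<in> carrier P"
  shows "bdd_above (insert 0 {sqrt (Q \<omega> (x \<otimes> y)) | \<omega> y. \<omega> \<in> \<Omega> \<and> y \<in> carrier P \<and> \<omega> (adj P y \<otimes> y) = 1})"
proof (rule bdd_aboveI)
  fix r assume "r \<in> insert 0 {sqrt (Q \<omega> (x \<otimes> y)) | \<omega> y. \<omega> \<in> \<Omega> \<and> y \<in> carrier P \<and> \<omega> (adj P y \<otimes> y) = 1}"
  then consider "r = 0" | \<omega> y where "r = sqrt (Q \<omega> (x \<otimes> y))" "\<omega> \<in> \<Omega>" "y \<in> carrier P" "\<omega> (adj P y \<otimes> y) = 1"
    by blast
  then show "r \<le> sqrt (max 0 (l (adj P x \<otimes> x)))"
  proof cases
    case 2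
    interpret bounded_positive_functional P \<omega> l by (rule functional[OF 2(2)])
    show ?thesis
      using qf_mult_le[OF x 2(3)] 2(1,4) by (simp add: qf_def form_def)
  qed simp
qed

lemma gns_nonneg: "x \<in> carrier P \<Longrightarrow> 0 \<le> N x"
  unfolding gns_seminorm_def by (rule cSup_upper[OF _ gns_bdd_above]) auto

text \<open>The supremum only ranges over normalized vectors. Other vectors are rescaled, except
  those with qf y = 0, for which \<open>qf_mult_le\<close> forces the left side to vanish.\<close>

lemma gns_bound:
  assumes \<omega>: "\<omega> \<in> \<Omega>" and x: "x \<in> carrier P" and y: "y \<in> carrier P"
  shows "sqrt (Q \<omega> (x \<otimes> y)) \<le> N x * sqrt (Q \<omega> y)"
proof -
  interpret bounded_positive_functional P \<omega> l by (rule functional[OF \<omega>])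
  have Q: "Q \<omega> z = qf z" for z by (simp add: qf_def form_def)
  show ?thesis
  proof (cases "qf y = 0")
    case True
    then show ?thesis using qf_mult_le[OF x y] by (simp add: Q)
  next
    case False
    then have qy: "0 < qf y" using form_self(2)[OF y] by simp
    define c where "c = 1 / sqrt (qf y)"
    have c: "c\<^sup>2 * qf y = 1" "0 < c" using qy by (simp_all add: c_def power_divide)
    let ?y = "of_real c \<odot> y"
    have "qf ?y = 1"
      using c y by (simp add: qf_smult)
    then have "\<omega> (adj P ?y \<otimes> ?y) = 1"
      using form_self(1)[of ?y] y by (simp add: form_def smult_closed)
    then have "sqrt (Q \<omega> (x \<otimes> ?y)) \<le> N x"
      unfolding gns_seminorm_def using \<omega> y
      by (intro cSup_upper gns_bdd_above[OF x]) (auto simp: smult_closed)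
    also have "x \<otimes> ?y = of_real c \<odot> (x \<otimes> y)" using x y by (simp add: smult_mult_right)
    finally have "c * sqrt (qf (x \<otimes> y)) \<le> N x"
      unfolding Q using qf_smult[of "x \<otimes> y" "of_real c"] x y c by (simp add: real_sqrt_mult)
    then show ?thesis
      unfolding Q using qy by (simp add: c_def field_simps)
  qed
qed

lemma gns_le:
  assumes "0 \<le> K" "\<And>\<omega> y. \<lbrakk>\<omega> \<in> \<Omega>; y \<in> carrier P\<rbrakk> \<Longrightarrow> sqrt (Q \<omega> (x \<otimes> y)) \<le> K * sqrt (Q \<omega> y)"
  shows "N x \<le> K"
  unfolding gns_seminorm_def
proof (rule cSup_least)
  fix r assume "r \<in> insert 0 {sqrt (Q \<omega> (x \<otimes> y)) | \<omega> y. \<omega> \<in> \<Omega> \<and> y \<in> carrier P \<and> \<omega> (adj P y \<otimes> y) = 1}"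
  then show "r \<le> K"
  proof (elim insertE CollectE exE conjE)
    fix \<omega> y assume "r = sqrt (Q \<omega> (x \<otimes> y))" "\<omega> \<in> \<Omega>" "y \<in> carrier P" "\<omega> (adj P y \<otimes> y) = 1"
    then show "r \<le> K" using assms(2)[of \<omega> y] by simp
  qed (use assms in simp)
qed simp

text \<open>For the C*-identity, the square of the length of x z is the inner product of z with
  \<open>adj P x \<otimes> x \<otimes> z\<close>; Cauchy-Schwarz bounds it by the seminorm of
  \<open>adj P x \<otimes> x\<close> times the squared length of z. This lower bound also yields
  that taking adjoints does not increase the seminorm, whence the upper bound.\<close>

lemma gns_cstar_seminorm: "cstar_seminorm P N"
proof -
  have add: "N (x \<oplus> y) \<le> N x + N y" if x: "x \<in> carrier P" "y \<in> carrier P" for x y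
  proof (rule gns_le)
    fix \<omega> z assume \<omega>: "\<omega> \<in> \<Omega>" and z: "z \<in> carrier P"
    interpret bounded_positive_functional P \<omega> l by (rule functional[OF \<omega>])
    have "sqrt (Q \<omega> ((x \<oplus> y) \<otimes> z)) \<le> sqrt (Q \<omega> (x \<otimes> z)) + sqrt (Q \<omega> (y \<otimes> z))"
      using sqrt_qf_add[of "x \<otimes> z" "y \<otimes> z"] x z by (simp add: l_distr qf_def form_def)
    then show "sqrt (Q \<omega> ((x \<oplus> y) \<otimes> z)) \<le> (N x + N y) * sqrt (Q \<omega> z)"
      using gns_bound[OF \<omega> x(1) z] gns_bound[OF \<omega> x(2) z] by (simp add: algebra_simps)
  qed (use x in \<open>simp add: gns_nonneg\<close>)
  have mult: "N (x \<otimes> y) \<le> N x * N y" if x: "x \<in> carrier P" "y \<in> carrier P" for x y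
  proof (rule gns_le)
    fix \<omega> z assume \<omega>: "\<omega> \<in> \<Omega>" and z: "z \<in> carrier P"
    have "sqrt (Q \<omega> (x \<otimes> y \<otimes> z)) \<le> N x * sqrt (Q \<omega> (y \<otimes> z))"
      using gns_bound[OF \<omega> x(1), of "y \<otimes> z"] x z by (simp add: m_assoc)
    also have "\<dots> \<le> N x * (N y * sqrt (Q \<omega> z))"
      using gns_bound[OF \<omega> x(2) z] x by (intro mult_left_mono gns_nonneg) auto
    finally show "sqrt (Q \<omega> (x \<otimes> y \<otimes> z)) \<le> N x * N y * sqrt (Q \<omega> z)"
      by (simp add: mult.assoc)
  qed (use x in \<open>simp add: gns_nonneg\<close>)
  have smult_le: "N (c \<odot> x) \<le> cmod c * N x" if x: "x \<in> carrier P" for x c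
  proof (rule gns_le)
    fix \<omega> z assume \<omega>: "\<omega> \<in> \<Omega>" and z: "z \<in> carrier P"
    interpret bounded_positive_functional P \<omega> l by (rule functional[OF \<omega>])
    have "sqrt (Q \<omega> ((c \<odot> x) \<otimes> z)) = cmod c * sqrt (Q \<omega> (x \<otimes> z))"
      using qf_smult[of "x \<otimes> z" c] x z by (simp add: smult_mult_left qf_def form_def real_sqrt_mult)
    then show "sqrt (Q \<omega> ((c \<odot> x) \<otimes> z)) \<le> cmod c * N x * sqrt (Q \<omega> z)"
      using mult_left_mono[OF gns_bound[OF \<omega> x z], of "cmod c"] by (simp add: mult.assoc)
  qed (use x in \<open>simp add: gns_nonneg\<close>)
  \<comment> \<open>The missing inequality is \<open>smult_le\<close> with the scalar 1 / c, applied
    to c x.\<close>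
  have smult: "N (c \<odot> x) = cmod c * N x" if x: "x \<in> carrier P" for x c
  proof (cases "c = 0")
    case True
    then show ?thesis using smult_le[OF x, of 0] gns_nonneg[of "0 \<odot> x"] x by (simp add: smult_closed)
  next
    case False
    have "N x \<le> cmod (1 / c) * N (c \<odot> x)"
      using smult_le[of "c \<odot> x" "1 / c"] x False by (simp add: smult_closed smult_smult[symmetric] smult_one)
    then have "cmod c * N x \<le> N (c \<odot> x)" using False by (simp add: norm_divide field_simps)
    then show ?thesis using smult_le[OF x, of c] by simp
  qed
  have square_le: "(N x)\<^sup>2 \<le> N (adj P x \<otimes> x)" if x: "x \<in> carrier P" for x
  proof -
    let ?M = "N (adj P x \<otimes> x)"
    have M: "0 \<le> ?M" using x by (simp add: gns_nonneg adj_closed)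
    have "N x \<le> sqrt ?M"
    proof (rule gns_le)
      fix \<omega> z assume \<omega>: "\<omega> \<in> \<Omega>" and z: "z \<in> carrier P"
      interpret bounded_positive_functional P \<omega> l by (rule functional[OF \<omega>])
      have Q: "Q \<omega> z = qf z" for z by (simp add: qf_def form_def)
      let ?z = "adj P x \<otimes> x \<otimes> z"
      have c: "?z \<in> carrier P" using x z by (simp add: adj_closed)
      have "qf (x \<otimes> z) \<le> cmod (form z ?z)"
        unfolding qf_def using x z
        by (subst form_mult_left) (auto simp: complex_Re_le_cmod adj_closed m_assoc)
      also have "\<dots> \<le> sqrt (qf z * qf ?z)"
        by (rule real_le_rsqrt[OF cauchy_schwarz[OF z c]])
      also have "\<dots> = sqrt (qf z) * sqrt (qf ?z)"
        by (simp add: real_sqrt_mult)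
      also have "\<dots> \<le> sqrt (qf z) * (?M * sqrt (qf z))"
        using gns_bound[OF \<omega> _ z, of "adj P x \<otimes> x"] x z form_self(2)[OF z]
        by (intro mult_left_mono) (auto simp: Q adj_closed)
      also have "\<dots> = ?M * qf z" using form_self(2)[OF z] by simp
      finally have "sqrt (qf (x \<otimes> z)) \<le> sqrt (?M * qf z)" by simp
      then show "sqrt (Q \<omega> (x \<otimes> z)) \<le> sqrt ?M * sqrt (Q \<omega> z)"
        by (simp add: Q real_sqrt_mult)
    qed (use M in simp)
    then have "(N x)\<^sup>2 \<le> (sqrt ?M)\<^sup>2" using x by (intro power_mono gns_nonneg) auto
    then show ?thesis using M by simp
  qed
  have adj_le: "N (adj P x) \<le> N x" if x: "x \<in> carrier P" for x
  proof (cases "N (adj P x) = 0")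
    case True
    then show ?thesis using gns_nonneg[OF x] by simp
  next
    case False
    have "N (adj P x) * N (adj P x) \<le> N x * N (adj P x)"
      using square_le[of "adj P x"] mult[of x "adj P x"] x
      by (simp add: adj_closed adj_adj power2_eq_square)
    then show ?thesis using False gns_nonneg[of "adj P x"] x by (simp add: adj_closed)
  qed
  have "N (adj P x \<otimes> x) = (N x)\<^sup>2" if x: "x \<in> carrier P" for x
  proof (rule antisym)
    have "N (adj P x \<otimes> x) \<le> N (adj P x) * N x" using x by (simp add: mult adj_closed)
    also have "\<dots> \<le> (N x)\<^sup>2"
      unfolding power2_eq_square using x by (intro mult_right_mono adj_le gns_nonneg) auto
    finally show "N (adj P x \<otimes> x) \<le> (N x)\<^sup>2" .
  qed (rule square_le[OF x])
  then show ?thesis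
    by (simp add: cstar_seminorm_def add mult smult)
qed

sublocale gns: seminormed_star_algebra P N
  by unfold_locales (rule gns_cstar_seminorm)

end


section \<open>The Schur product of positive kernels\<close>

definition kernel_sum :: "'k set \<Rightarrow> ('k \<Rightarrow> 'k \<Rightarrow> complex) \<Rightarrow> ('k \<Rightarrow> complex) \<Rightarrow> complex" where
  "kernel_sum K T c = (\<Sum>k\<in>K. \<Sum>l\<in>K. cnj (c k) * c l * T k l)"

text \<open>Positive semidefinite matrices indexed by K. The symmetry is part of the notion because
  the elimination step identifies the column of an element with its conjugated row.\<close>

definition positive_kernel :: "'k set \<Rightarrow> ('k \<Rightarrow> 'k \<Rightarrow> complex) \<Rightarrow> bool" where
  "positive_kernel K T \<longleftrightarrow> (\<forall>k\<in>K. \<forall>l\<in>K. T l k = cnj (T k l)) \<and> (\<forall>c. 0 \<le> kernel_sum K T c)"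

lemma kernel_sum_superset:
  assumes "finite L" "K \<subseteq> L" "\<And>k l. k \<in> L \<Longrightarrow> l \<in> L \<Longrightarrow> k \<notin> K \<or> l \<notin> K \<Longrightarrow> cnj (c k) * c l * T k l = 0"
  shows "kernel_sum L T c = kernel_sum K T c"
proof -
  have "kernel_sum L T c = (\<Sum>k\<in>K. \<Sum>l\<in>L. cnj (c k) * c l * T k l)"
    unfolding kernel_sum_def using assms by (intro sum.mono_neutral_right) (auto intro!: sum.neutral)
  also have "\<dots> = kernel_sum K T c"
    unfolding kernel_sum_def using assms by (intro sum.cong refl sum.mono_neutral_right) auto
  finally show ?thesis .
qed

lemma kernel_sum_insert:
  assumes "finite K" "a \<notin> K"
  shows "kernel_sum (insert a K) T c = cnj (c a) * c a * T a a + cnj (c a) * (\<Sum>l\<in>K. c l * T a l) +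
    c a * (\<Sum>k\<in>K. cnj (c k) * T k a) + kernel_sum K T c"
  using assms by (simp add: kernel_sum_def sum.distrib sum_distrib_left algebra_simps)

lemma positive_kernel_subset:
  assumes "positive_kernel L T" "finite L" "K \<subseteq> L"
  shows "positive_kernel K T"
  unfolding positive_kernel_def
proof (intro conjI allI)
  fix c
  have "kernel_sum K T c = kernel_sum K T (\<lambda>k. if k \<in> K then c k else 0)"
    by (simp add: kernel_sum_def)
  also have "\<dots> = kernel_sum L T (\<lambda>k. if k \<in> K then c k else 0)"
    using assms by (intro kernel_sum_superset[symmetric]) auto
  finally show "0 \<le> kernel_sum K T c" using assms by (simp add: positive_kernel_def)
qed (use assms in \<open>auto simp: positive_kernel_def\<close>)

text \<open>One Cholesky step per element: subtracting the rank one kernel of row \<open>a\<close> leaves a kernel that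
  vanishes on row \<open>a\<close>. If \<open>T a a = 0\<close> then row \<open>a\<close> vanishes and \<open>x / 0 = 0\<close> makes the step void.\<close>

lemma schur_product:
  assumes "finite K" "positive_kernel K S" "positive_kernel K T"
  shows "0 \<le> kernel_sum K (\<lambda>k l. S k l * T k l) c"
  using assms
proof (induction K arbitrary: T c)
  case empty
  then show ?case by (simp add: kernel_sum_def)
next
  case (insert a K)
  let ?L = "insert a K"
  have fin: "finite ?L" using insert by simp
  have herm: "T l k = cnj (T k l)" if "k \<in> ?L" "l \<in> ?L" for k l
    using insert.prems(2) that unfolding positive_kernel_def by blast
  have pos: "0 \<le> kernel_sum ?L T d" for d
    using insert.prems(2) unfolding positive_kernel_def by blast
  define v where "v = T a"
  have vk: "T k a = cnj (v k)" if "k \<in> ?L" for k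
    using herm[of a k] that by (simp add: v_def)
  have expand: "kernel_sum ?L T d = cnj (d a) * d a * v a + cnj (d a) * (\<Sum>l\<in>K. d l * v l) +
      d a * cnj (\<Sum>l\<in>K. d l * v l) + kernel_sum K T d" for d
    using insert.hyps by (simp add: kernel_sum_insert v_def[symmetric] vk cong: sum.cong)
  define t where "t = Re (v a)"
  have t: "v a = of_real t" "0 \<le> t"
  proof -
    have "kernel_sum ?L T (\<lambda>k. if k = a then 1 else 0) = v a"
      unfolding expand using insert.hyps by (simp add: kernel_sum_def sum.neutral)
    then have "0 \<le> v a" using pos by metis
    then show "v a = of_real t" "0 \<le> t" by (auto simp: t_def less_eq_complex_def complex_eq_iff)
  qed
  have v0: "v l = 0" if "t = 0" "l \<in> ?L" for l
  proof (cases "l = a")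
    case False
    then have l: "l \<in> K" using that by simp
    have "0 \<le> Re (T l l) - 2 * r * (cmod (v l))\<^sup>2" for r
    proof -
      \<comment> \<open>A test vector supported on a and l. With vanishing diagonal entry at a the
        form becomes linear in r, hence negative for large r unless v l = 0.\<close>
      let ?d = "\<lambda>k. if k = a then - of_real r * v l else if k = l then 1 else 0"
      have "kernel_sum K T ?d = kernel_sum {l} T ?d"
        using insert.hyps l by (intro kernel_sum_superset) auto
      also have "\<dots> = T l l" using False by (simp add: kernel_sum_def)
      finally have 1: "kernel_sum K T ?d = T l l" .
      have "(\<Sum>k\<in>K. ?d k * v k) = (\<Sum>k\<in>K. if k = l then v l else 0)"
        using insert.hyps by (intro sum.cong) auto
      then have 2: "(\<Sum>k\<in>K. ?d k * v k) = v l" using insert.hyps l by simp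
      have "kernel_sum ?L T ?d = - 2 * of_real r * of_real ((cmod (v l))\<^sup>2) + T l l"
        unfolding expand 1 2 complex_norm_square using t that by (simp add: algebra_simps)
      then have "Re (kernel_sum ?L T ?d) = Re (T l l) - 2 * r * (cmod (v l))\<^sup>2"
        by (simp del: of_real_power)
      then show ?thesis using pos[of ?d] by (simp add: less_eq_complex_def)
    qed
    note * = this
    show ?thesis
    proof (rule ccontr)
      assume "v l \<noteq> 0"
      then have "0 < (cmod (v l))\<^sup>2" by simp
      then show False
        using *[of "(Re (T l l) + 1) / (cmod (v l))\<^sup>2"] *[of 0] by simp
    qed
  qed (use t that in simp)
  define T' where "T' k l = T k l - cnj (v k) * v l / of_real t" for k l
  have T'0: "T' k l = 0" if "k \<in> ?L" "l \<in> ?L" "k = a \<or> l = a" for k l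
  proof (cases "t = 0")
    case True
    then show ?thesis using that v0 vk[of k] by (auto simp: T'_def v_def[symmetric])
  next
    case False
    then show ?thesis using that t vk[of k] by (auto simp: T'_def v_def[symmetric])
  qed
  have "positive_kernel K T'"
    unfolding positive_kernel_def
  proof (intro conjI ballI allI)
    show "T' l k = cnj (T' k l)" if "k \<in> K" "l \<in> K" for k l
      using herm[of k l] that by (simp add: T'_def)
    fix d
    define u where "u = (\<Sum>l\<in>K. d l * v l)"
    have rank1: "kernel_sum K T' d = kernel_sum K T d - cnj u * u / of_real t"
    proof -
      have "cnj u * u = (\<Sum>k\<in>K. \<Sum>l\<in>K. (cnj (d k) * cnj (v k)) * (d l * v l))"
        by (simp add: u_def sum_product)
      then show ?thesis
        by (simp add: kernel_sum_def T'_def sum_divide_distrib sum_subtractf[symmetric] algebra_simps)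
    qed
    show "0 \<le> kernel_sum K T' d"
    proof (cases "t = 0")
      case True
      have "positive_kernel K T"
        by (rule positive_kernel_subset[OF insert.prems(2) fin]) auto
      then show ?thesis using True by (simp add: rank1 positive_kernel_def)
    next
      case False
      \<comment> \<open>The entry at a minimizes the form of T among all extensions of d, and the
        minimum is the form of the Schur complement \<open>T'\<close>.\<close>
      let ?d = "d(a := - u / of_real t)"
      have same: "kernel_sum K T ?d = kernel_sum K T d" "(\<Sum>l\<in>K. ?d l * v l) = u"
        using insert.hyps unfolding kernel_sum_def u_def by (intro sum.cong refl; fastforce)+
      have "kernel_sum ?L T ?d = kernel_sum K T' d"
        unfolding expand same rank1 using False by (simp add: t field_simps)
      then show ?thesis using pos[of ?d] by simp
    qed
  qed
  then have "0 \<le> kernel_sum K (\<lambda>k l. S k l * T' k l) c"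
    using insert.IH positive_kernel_subset[OF insert.prems(1) fin] by blast
  also have "kernel_sum K (\<lambda>k l. S k l * T' k l) c = kernel_sum ?L (\<lambda>k l. S k l * T' k l) c"
    using fin T'0 by (intro kernel_sum_superset[symmetric]) auto
  finally have "0 \<le> kernel_sum ?L (\<lambda>k l. S k l * T' k l) c" .
  moreover have "0 \<le> kernel_sum ?L S (\<lambda>k. c k * v k) / of_real t"
  proof -
    have "0 \<le> kernel_sum ?L S (\<lambda>k. c k * v k)"
      using insert.prems(1) unfolding positive_kernel_def by blast
    then show ?thesis using t(2) by (auto simp: less_eq_complex_def)
  qed
  \<comment> \<open>T is \<open>T'\<close> plus a rank one kernel, and the entrywise product of S
    with that kernel is S with its coefficients rescaled by v.\<close>
  moreover have "kernel_sum ?L (\<lambda>k l. S k l * T k l) c =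
      kernel_sum ?L (\<lambda>k l. S k l * T' k l) c + kernel_sum ?L S (\<lambda>k. c k * v k) / of_real t"
    unfolding kernel_sum_def T'_def sum_divide_distrib sum.distrib[symmetric]
    by (intro sum.cong refl) (simp add: algebra_simps)
  ultimately show ?case by simp
qed


section \<open>The minimal tensor product\<close>

context positive_functional
begin

lemma form_finsum_left:
  "finite K \<Longrightarrow> (\<And>k. k \<in> K \<Longrightarrow> f k \<in> carrier P) \<Longrightarrow> y \<in> carrier P \<Longrightarrow>
    form (\<Oplus>k\<in>K. f k) y = (\<Sum>k\<in>K. form (f k) y)"
proof (induction K rule: finite_induct)
  case empty
  then show ?case using form_smult(1)[of \<zero> y 0] by (simp add: smult_zero_right)
qed (simp add: form_add Pi_iff finsum_closed)

lemma form_finsum_right: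
  "finite K \<Longrightarrow> (\<And>k. k \<in> K \<Longrightarrow> f k \<in> carrier P) \<Longrightarrow> y \<in> carrier P \<Longrightarrow>
    form y (\<Oplus>k\<in>K. f k) = (\<Sum>k\<in>K. form y (f k))"
proof (induction K rule: finite_induct)
  case empty
  then show ?case using form_smult(2)[of y \<zero> 0] by (simp add: smult_zero_right)
qed (simp add: form_add Pi_iff finsum_closed)

text \<open>The kernel sum with coefficients c is the form of \<Sum> c k f k with itself.\<close>

lemma gram_kernel:
  assumes "finite K" "\<And>k. k \<in> K \<Longrightarrow> f k \<in> carrier P"
  shows "positive_kernel K (\<lambda>k l. form (f k) (f l))"
  unfolding positive_kernel_def
proof (intro conjI ballI allI)
  show "form (f l) (f k) = cnj (form (f k) (f l))" if "k \<in> K" "l \<in> K" for k l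
    using assms that by (intro form_commute) auto
  fix c
  let ?z = "\<Oplus>k\<in>K. c k \<odot> f k"
  have z: "?z \<in> carrier P" using assms by (intro finsum_closed) (auto simp: smult_closed)
  have "form ?z ?z = (\<Sum>k\<in>K. form (c k \<odot> f k) ?z)"
    using assms z by (intro form_finsum_left) (auto simp: smult_closed)
  also have "\<dots> = (\<Sum>k\<in>K. \<Sum>l\<in>K. form (c k \<odot> f k) (c l \<odot> f l))"
    using assms by (intro sum.cong refl form_finsum_right) (auto simp: smult_closed)
  also have "\<dots> = kernel_sum K (\<lambda>k l. form (f k) (f l)) c"
    unfolding kernel_sum_def using assms
    by (intro sum.cong refl) (simp add: form_smult smult_closed)
  finally show "0 \<le> kernel_sum K (\<lambda>k l. form (f k) (f l)) c"
    using fn_pos[OF z] by (simp add: form_def)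
qed

end

lemma (in unital_cstar_algebra) state_positive_functional:
  assumes "state A \<sigma>"
  shows "positive_functional A \<sigma>"
  using assms by unfold_locales (auto simp: state_def less_eq_complex_def)

lemma (in star_monoid) mult_sum_left: "(\<Sum>k\<in>K. f k) \<otimes>\<^bsub>P\<^esub> g = (\<Sum>k\<in>K. f k \<otimes>\<^bsub>P\<^esub> g)"
  by (induction K rule: infinite_finite_induct) (auto simp: mult_plus_left mult_eq[of 0])

lemma (in star_monoid) mult_sum_right: "g \<otimes>\<^bsub>P\<^esub> (\<Sum>k\<in>K. f k) = (\<Sum>k\<in>K. g \<otimes>\<^bsub>P\<^esub> f k)"
  by (induction K rule: infinite_finite_induct) (auto simp: mult_plus_right mult_eq[of _ 0])

section \<open>Formal tensors, product states and the spatial seminorm\<close>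

locale cstar_tensor = A: unital_cstar_algebra A + B: unital_cstar_algebra B
  for A :: "('a, 'm) cstar_algebra_scheme" and B :: "('b, 'n) cstar_algebra_scheme"
begin

abbreviation weight :: "'a \<times> 'b \<Rightarrow> real" where "weight p \<equiv> nrm A (fst p) * nrm B (snd p)"

text \<open>The l1 norm of formal tensors, weighted by the norms of the factors. It is computed
  before any tensor relations are imposed, so sums over supports suffice to show that it is
  submultiplicative and dominates every product of states.\<close>

definition crossnorm :: "('a \<times> 'b \<Rightarrow>\<^sub>0 complex) \<Rightarrow> real" where
  "crossnorm x = (\<Sum>p\<in>Poly_Mapping.keys x. cmod (Poly_Mapping.lookup x p) * weight p)"

sublocale M: star_monoid "A \<times>\<times> B" "map_prod (adj A) (adj B)"
proof -
  interpret monoid "A \<times>\<times> B"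
    by (rule DirProd_monoid) unfold_locales
  show "star_monoid (A \<times>\<times> B) (map_prod (adj A) (adj B))"
    by unfold_locales (auto simp: A.adj_closed B.adj_closed A.adj_adj B.adj_adj A.adj_mult B.adj_mult)
qed

lemma formal_tensor_eq: "formal_tensor A B = M.P"
  by (simp add: formal_tensor_def)

lemma product_functional_eq: "product_functional \<sigma> \<tau> x =
    (\<Sum>p\<in>Poly_Mapping.keys x. Poly_Mapping.lookup x p * (\<sigma> (fst p) * \<tau> (snd p)))"
  by (simp add: product_functional_def case_prod_unfold mult.assoc)

lemma product_functional_add: "product_functional \<sigma> \<tau> (x + y) = product_functional \<sigma> \<tau> x + product_functional \<sigma> \<tau> y"
  unfolding product_functional_eq by (rule setsum_keys_plus_distrib) (auto simp: algebra_simps)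

lemma product_functional_single: "product_functional \<sigma> \<tau> (Poly_Mapping.single p c) = c * (\<sigma> (fst p) * \<tau> (snd p))"
  unfolding product_functional_eq by (cases "c = 0") auto

lemma product_functional_sum: "product_functional \<sigma> \<tau> (\<Sum>k\<in>K. f k) = (\<Sum>k\<in>K. product_functional \<sigma> \<tau> (f k))"
  by (induction K rule: infinite_finite_induct) (auto simp: product_functional_add, auto simp: product_functional_eq)

lemma product_functional_smult:
  assumes "x \<in> carrier M.P"
  shows "product_functional \<sigma> \<tau> (c \<odot>\<^bsub>M.P\<^esub> x) = c * product_functional \<sigma> \<tau> x"
  using assms
  by (induction x rule: M.monoid_algebra_induct)
    (simp_all add: monoid_star_algebra_simps map_mult_single map_mult_plus product_functional_single
      product_functional_add algebra_simps)

lemma weight_nonneg: "p \<in> carrier (A \<times>\<times> B) \<Longrightarrow> 0 \<le> weight p"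
  by (auto simp: A.norm.N_nonneg B.norm.N_nonneg)

lemma weight_mult: "\<lbrakk>p \<in> carrier (A \<times>\<times> B); q \<in> carrier (A \<times>\<times> B)\<rbrakk> \<Longrightarrow>
    weight (p \<otimes>\<^bsub>A \<times>\<times> B\<^esub> q) \<le> weight p * weight q"
proof -
  assume "p \<in> carrier (A \<times>\<times> B)" "q \<in> carrier (A \<times>\<times> B)"
  then have "nrm A (fst p \<otimes>\<^bsub>A\<^esub> fst q) * nrm B (snd p \<otimes>\<^bsub>B\<^esub> snd q) \<le>
      (nrm A (fst p) * nrm A (fst q)) * (nrm B (snd p) * nrm B (snd q))"
    by (intro mult_mono A.nrm_mult B.nrm_mult mult_nonneg_nonneg A.norm.N_nonneg B.norm.N_nonneg) auto
  then show ?thesis by (simp add: mult_DirProd' mult_ac)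
qed

lemma crossnorm_superset:
  assumes "finite K" "Poly_Mapping.keys x \<subseteq> K"
  shows "crossnorm x = (\<Sum>p\<in>K. cmod (Poly_Mapping.lookup x p) * weight p)"
  unfolding crossnorm_def using assms
  by (intro sum_keys_superset[where F = "\<lambda>p c. cmod c * weight p"]) auto

lemma crossnorm_single: "crossnorm (Poly_Mapping.single p c) = cmod c * weight p"
  by (subst crossnorm_superset[of "{p}"]) auto

lemma crossnorm_nonneg: "x \<in> carrier M.P \<Longrightarrow> 0 \<le> crossnorm x"
  unfolding crossnorm_def
  by (intro sum_nonneg mult_nonneg_nonneg weight_nonneg) (auto simp: monoid_star_algebra_simps)

lemma crossnorm_add:
  assumes "x \<in> carrier M.P" "y \<in> carrier M.P"
  shows "crossnorm (x + y) \<le> crossnorm x + crossnorm y"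
proof -
  let ?K = "Poly_Mapping.keys x \<union> Poly_Mapping.keys y"
  have "crossnorm (x + y) = (\<Sum>p\<in>?K. cmod (Poly_Mapping.lookup x p + Poly_Mapping.lookup y p) * weight p)"
    using Poly_Mapping.keys_add[of x y] by (subst crossnorm_superset[of ?K]) (auto simp: lookup_add)
  also have "\<dots> \<le> (\<Sum>p\<in>?K. (cmod (Poly_Mapping.lookup x p) + cmod (Poly_Mapping.lookup y p)) * weight p)"
    using assms by (intro sum_mono mult_right_mono norm_triangle_ineq weight_nonneg)
      (auto simp: monoid_star_algebra_simps)
  also have "\<dots> = crossnorm x + crossnorm y"
    by (subst (1 2) crossnorm_superset[of ?K]) (auto simp: sum.distrib algebra_simps)
  finally show ?thesis .
qed

lemma crossnorm_sum: "(\<And>k. k \<in> K \<Longrightarrow> f k \<in> carrier M.P) \<Longrightarrow> crossnorm (\<Sum>k\<in>K. f k) \<le> (\<Sum>k\<in>K. crossnorm (f k))"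
proof (induction K rule: infinite_finite_induct)
  case (insert k K)
  then show ?case using crossnorm_add[of "f k" "\<Sum>k\<in>K. f k"] by (simp add: M.sum_closed)
qed (auto simp: crossnorm_def)

lemma crossnorm_mult:
  assumes x: "x \<in> carrier M.P" and y: "y \<in> carrier M.P"
  shows "crossnorm (x \<otimes>\<^bsub>M.P\<^esub> y) \<le> crossnorm x * crossnorm y"
proof -
  let ?X = "Poly_Mapping.keys x" and ?Y = "Poly_Mapping.keys y"
  let ?s = "\<lambda>p q. Poly_Mapping.single (p \<otimes>\<^bsub>A \<times>\<times> B\<^esub> q) (Poly_Mapping.lookup x p * Poly_Mapping.lookup y q)"
  have in_M: "p \<in> carrier (A \<times>\<times> B)" if "p \<in> ?X \<or> p \<in> ?Y" for p
    using that x y by (auto simp: monoid_star_algebra_simps)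
  have s: "?s p q \<in> carrier M.P" if "p \<in> ?X" "q \<in> ?Y" for p q
    using that in_M by (intro M.single_closed M.m_closed) auto
  have "crossnorm (x \<otimes>\<^bsub>M.P\<^esub> y) \<le> (\<Sum>p\<in>?X. \<Sum>q\<in>?Y. crossnorm (?s p q))"
    unfolding M.mult_eq using s
    by (intro order_trans[OF crossnorm_sum] sum_mono crossnorm_sum M.sum_closed) auto
  also have "\<dots> \<le> (\<Sum>p\<in>?X. \<Sum>q\<in>?Y. (cmod (Poly_Mapping.lookup x p) * weight p) * (cmod (Poly_Mapping.lookup y q) * weight q))"
  proof (intro sum_mono)
    fix p q assume "p \<in> ?X" "q \<in> ?Y"
    then have "weight (p \<otimes>\<^bsub>A \<times>\<times> B\<^esub> q) \<le> weight p * weight q"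
      using in_M by (intro weight_mult) auto
    then have "cmod (Poly_Mapping.lookup x p * Poly_Mapping.lookup y q) * weight (p \<otimes>\<^bsub>A \<times>\<times> B\<^esub> q) \<le>
        cmod (Poly_Mapping.lookup x p * Poly_Mapping.lookup y q) * (weight p * weight q)"
      by (intro mult_left_mono) auto
    then show "crossnorm (?s p q) \<le> (cmod (Poly_Mapping.lookup x p) * weight p) * (cmod (Poly_Mapping.lookup y q) * weight q)"
      unfolding crossnorm_single by (simp add: norm_mult mult_ac)
  qed
  also have "\<dots> = crossnorm x * crossnorm y"
    by (simp add: crossnorm_def sum_product)
  finally show ?thesis .
qed

text \<open>On the product of the adjoint of x with x, the functional is a kernel sum whose kernel
  is the entrywise product of the Gram matrices of \<sigma> and \<tau>; \<open>schur_product\<close>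
  makes it nonnegative.\<close>

lemma product_functional_bounded:
  assumes "state A \<sigma>" "state B \<tau>"
  shows "bounded_positive_functional M.P (product_functional \<sigma> \<tau>) crossnorm"
proof -
  interpret \<sigma>: positive_functional A \<sigma> by (rule A.state_positive_functional[OF assms(1)])
  interpret \<tau>: positive_functional B \<tau> by (rule B.state_positive_functional[OF assms(2)])
  interpret P: unital_star_algebra M.P by (rule M.star_algebra)
  let ?\<omega> = "product_functional \<sigma> \<tau>"
  have pos: "0 \<le> ?\<omega> (adj M.P x \<otimes>\<^bsub>M.P\<^esub> x)" if x: "x \<in> carrier M.P" for x
  proof -
    let ?K = "Poly_Mapping.keys x" and ?c = "Poly_Mapping.lookup x"
    have K: "fst p \<in> carrier A" "snd p \<in> carrier B" if "p \<in> ?K" for p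
      using that x by (auto simp: monoid_star_algebra_simps)
    have x_eq: "x = (\<Sum>p\<in>?K. Poly_Mapping.single p (?c p))"
      by (rule poly_mapping_eqI) (auto simp: lookup_sum lookup_single when_def in_keys_iff)
    have "adj M.P x \<otimes>\<^bsub>M.P\<^esub> x = (\<Sum>p\<in>?K. Poly_Mapping.single (map_prod (adj A) (adj B) p) (cnj (?c p))) \<otimes>\<^bsub>M.P\<^esub>
        (\<Sum>q\<in>?K. Poly_Mapping.single q (?c q))"
      unfolding M.adj_eq using x_eq by simp
    also have "\<dots> = (\<Sum>p\<in>?K. \<Sum>q\<in>?K. Poly_Mapping.single (map_prod (adj A) (adj B) p \<otimes>\<^bsub>A \<times>\<times> B\<^esub> q) (cnj (?c p) * ?c q))"
      unfolding M.mult_sum_left M.mult_sum_right M.mult_single_single by (rule sum.swap)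
    finally have "?\<omega> (adj M.P x \<otimes>\<^bsub>M.P\<^esub> x) =
        kernel_sum ?K (\<lambda>p q. \<sigma>.form (fst p) (fst q) * \<tau>.form (snd p) (snd q)) ?c"
      by (simp add: product_functional_sum product_functional_single kernel_sum_def mult_DirProd'
          \<sigma>.form_def \<tau>.form_def mult.assoc)
    also have "0 \<le> \<dots>"
      using K by (intro schur_product \<sigma>.gram_kernel \<tau>.gram_kernel) auto
    finally show ?thesis .
  qed
  have bound: "cmod (?\<omega> x) \<le> crossnorm x" if x: "x \<in> carrier M.P" for x
    unfolding product_functional_eq crossnorm_def
  proof (rule sum_norm_le)
    fix p assume "p \<in> Poly_Mapping.keys x"
    then have "cmod (\<sigma> (fst p)) \<le> nrm A (fst p)" "cmod (\<tau> (snd p)) \<le> nrm B (snd p)" "fst p \<in> carrier A"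
      using x assms by (auto simp: monoid_star_algebra_simps state_def)
    then show "cmod (Poly_Mapping.lookup x p * (\<sigma> (fst p) * \<tau> (snd p))) \<le> cmod (Poly_Mapping.lookup x p) * weight p"
      by (auto simp: norm_mult A.norm.N_nonneg intro!: mult_left_mono mult_mono)
  qed
  show ?thesis
    by unfold_locales
      (auto simp: pos bound crossnorm_nonneg crossnorm_mult product_functional_smult
        monoid_star_algebra_simps(4) product_functional_add)
qed

abbreviation product_functionals where
  "product_functionals \<equiv> {product_functional \<sigma> \<tau> | \<sigma> \<tau>. state A \<sigma> \<and> state B \<tau>}"

sublocale gns: bounded_positive_functionals M.P product_functionals crossnorm
proof -
  have "bounded_positive_functional M.P \<omega> crossnorm" if "\<omega> \<in> product_functionals" for \<omega>
    using that product_functional_bounded by blast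
  then show "bounded_positive_functionals M.P product_functionals crossnorm"
    using M.star_algebra by (simp add: bounded_positive_functionals_def bounded_positive_functionals_axioms_def)
qed

lemma spatial_seminorm_eq: "spatial_seminorm A B = gns_seminorm M.P product_functionals"
proof
  fix x
  show "spatial_seminorm A B x = gns_seminorm M.P product_functionals x"
    unfolding spatial_seminorm_def gns_seminorm_def Let_def formal_tensor_eq
    by (rule arg_cong[where f = "\<lambda>S. Sup (insert 0 S)"]) blast
qed

sublocale sp: seminormed_star_algebra "formal_tensor A B" "spatial_seminorm A B"
  unfolding spatial_seminorm_eq formal_tensor_eq by (rule gns.gns.seminormed_star_algebra_axioms)

lemma min_tensor_eq: "min_tensor A B = sp.K"
  by (simp add: min_tensor_def)

lemma min_tensor_cstar_algebra: "unital_cstar_algebra (min_tensor A B)"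
  unfolding min_tensor_eq by (rule sp.completion_cstar_algebra)

sublocale T: unital_cstar_algebra "min_tensor A B"
  by (rule min_tensor_cstar_algebra)

section \<open>Elementary tensors and their bilinearity\<close>

abbreviation E where "E \<equiv> elementary_tensor A B"

lemma E_eq: "E a b = sp.\<iota> (Poly_Mapping.single (a, b) 1)"
  by (simp add: elementary_tensor_def)

lemma single_in: "\<lbrakk>a \<in> carrier A; b \<in> carrier B\<rbrakk> \<Longrightarrow> Poly_Mapping.single (a, b) c \<in> carrier (formal_tensor A B)"
  unfolding formal_tensor_eq by (rule M.single_closed) simp

lemma E_closed: "\<lbrakk>a \<in> carrier A; b \<in> carrier B\<rbrakk> \<Longrightarrow> E a b \<in> carrier (min_tensor A B)"
  unfolding E_eq min_tensor_eq by (intro sp.to_completion_closed single_in)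

lemma E_mult:
  assumes "a \<in> carrier A" "b \<in> carrier B" "c \<in> carrier A" "d \<in> carrier B"
  shows "E a b \<otimes>\<^bsub>min_tensor A B\<^esub> E c d = E (a \<otimes>\<^bsub>A\<^esub> c) (b \<otimes>\<^bsub>B\<^esub> d)"
proof -
  have "Poly_Mapping.single (a, b) 1 \<otimes>\<^bsub>formal_tensor A B\<^esub> Poly_Mapping.single (c, d) 1 =
      (Poly_Mapping.single (a \<otimes>\<^bsub>A\<^esub> c, b \<otimes>\<^bsub>B\<^esub> d) 1 :: _ \<Rightarrow>\<^sub>0 complex)"
    by (simp add: formal_tensor_eq M.mult_single_single)
  then show ?thesis
    unfolding E_eq min_tensor_eq using assms by (simp add: sp.\<iota>.hom_mult[symmetric] single_in)
qed

lemma E_adj: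
  assumes "a \<in> carrier A" "b \<in> carrier B"
  shows "adj (min_tensor A B) (E a b) = E (adj A a) (adj B b)"
proof -
  have "adj (formal_tensor A B) (Poly_Mapping.single (a, b) 1) = Poly_Mapping.single (adj A a, adj B b) 1"
    by (simp add: formal_tensor_eq M.adj_single)
  then show ?thesis
    unfolding E_eq min_tensor_eq using assms by (simp add: sp.\<iota>.hom_adj[symmetric] single_in)
qed

lemma E_one: "E \<one>\<^bsub>A\<^esub> \<one>\<^bsub>B\<^esub> = \<one>\<^bsub>min_tensor A B\<^esub>"
proof -
  have "Poly_Mapping.single (\<one>\<^bsub>A\<^esub>, \<one>\<^bsub>B\<^esub>) 1 = \<one>\<^bsub>formal_tensor A B\<^esub>"
    by (simp add: formal_tensor_eq monoid_star_algebra_simps)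
  then show ?thesis
    unfolding E_eq min_tensor_eq by simp
qed

text \<open>The seminorm only sees the functionals, for which bilinear relations hold.\<close>

lemma spatial_null:
  assumes z: "z \<in> carrier M.P"
    and null: "\<And>\<sigma> \<tau> p q. \<lbrakk>state A \<sigma>; state B \<tau>; p \<in> carrier (A \<times>\<times> B); q \<in> carrier (A \<times>\<times> B)\<rbrakk> \<Longrightarrow>
      product_functional \<sigma> \<tau> (Poly_Mapping.single p 1 \<otimes>\<^bsub>M.P\<^esub> z \<otimes>\<^bsub>M.P\<^esub> Poly_Mapping.single q 1) = 0"
  shows "sp.\<iota> z = \<zero>\<^bsub>min_tensor A B\<^esub>"
proof -
  have scale: "Poly_Mapping.single p c = c \<odot>\<^bsub>M.P\<^esub> Poly_Mapping.single p 1" for p and c :: complex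
    by (simp add: monoid_star_algebra_simps map_mult_single)
  have zero: "product_functional \<sigma> \<tau> (x \<otimes>\<^bsub>M.P\<^esub> z \<otimes>\<^bsub>M.P\<^esub> y) = 0"
    if st: "state A \<sigma>" "state B \<tau>" and x: "x \<in> carrier M.P" and y: "y \<in> carrier M.P" for \<sigma> \<tau> x y
    using x
  proof (induction x rule: M.monoid_algebra_induct)
    case p: (single p c)
    from y show ?case
    proof (induction y rule: M.monoid_algebra_induct)
      case q: (single q d)
      let ?p = "Poly_Mapping.single p 1 :: _ \<Rightarrow>\<^sub>0 complex" and ?q = "Poly_Mapping.single q 1 :: _ \<Rightarrow>\<^sub>0 complex"
      have c: "?p \<in> carrier M.P" "?q \<in> carrier M.P" using p q by (auto intro!: M.single_closed)
      have "(c \<odot>\<^bsub>M.P\<^esub> ?p) \<otimes>\<^bsub>M.P\<^esub> z \<otimes>\<^bsub>M.P\<^esub> (d \<odot>\<^bsub>M.P\<^esub> ?q) = d \<odot>\<^bsub>M.P\<^esub> (c \<odot>\<^bsub>M.P\<^esub> (?p \<otimes>\<^bsub>M.P\<^esub> z \<otimes>\<^bsub>M.P\<^esub> ?q))"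
        using c z by (simp add: gns.smult_mult_left gns.smult_mult_right gns.smult_closed)
      then have "product_functional \<sigma> \<tau> ((c \<odot>\<^bsub>M.P\<^esub> ?p) \<otimes>\<^bsub>M.P\<^esub> z \<otimes>\<^bsub>M.P\<^esub> (d \<odot>\<^bsub>M.P\<^esub> ?q)) = 0"
        using c z null[OF st p q] by (simp add: product_functional_smult gns.smult_closed)
      then show ?case by (simp only: scale[symmetric])
    qed (simp add: M.mult_plus_right product_functional_add)
  qed (simp add: M.mult_plus_left product_functional_add)
  have "gns_seminorm M.P product_functionals z \<le> 0"
  proof (rule gns.gns_le)
    fix \<omega> y assume "\<omega> \<in> product_functionals" and y: "y \<in> carrier M.P"
    then obtain \<sigma> \<tau> where st: "state A \<sigma>" "state B \<tau>" "\<omega> = product_functional \<sigma> \<tau>" by blast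
    \<comment> \<open>Regrouping exhibits z between two arbitrary factors, where \<open>zero\<close>
      applies.\<close>
    have "adj M.P (z \<otimes>\<^bsub>M.P\<^esub> y) \<otimes>\<^bsub>M.P\<^esub> (z \<otimes>\<^bsub>M.P\<^esub> y) = adj M.P (z \<otimes>\<^bsub>M.P\<^esub> y) \<otimes>\<^bsub>M.P\<^esub> z \<otimes>\<^bsub>M.P\<^esub> y"
      using z y by (simp add: gns.m_assoc gns.adj_closed)
    then show "sqrt (gns.Q \<omega> (z \<otimes>\<^bsub>M.P\<^esub> y)) \<le> 0 * sqrt (gns.Q \<omega> y)"
      using zero[OF st(1,2), of "adj M.P (z \<otimes>\<^bsub>M.P\<^esub> y)" y] z y by (simp add: st(3) gns.adj_closed)
  qed simp
  then have "spatial_seminorm A B z = 0"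
    using gns.gns_nonneg[OF z] by (simp add: spatial_seminorm_eq)
  moreover have z': "z \<in> carrier (formal_tensor A B)" using z by (simp add: formal_tensor_eq)
  ultimately have "nrm (min_tensor A B) (sp.\<iota> z) = 0"
    by (simp add: min_tensor_eq sp.nrm_to_completion)
  then show ?thesis
    using z' sp.to_completion_closed[OF z'] by (subst (asm) T.nrm_eq_0_iff) (auto simp: min_tensor_eq)
qed

text \<open>In the formal tensor algebra the pairs are linearly independent, so the relation fails
  there. The element z is its defect; sandwiched between monomials it is killed by every product
  state because \<sigma> is linear, so it becomes 0 in the completion.\<close>

lemma E_linear_left:
  assumes a: "a \<in> carrier A" "a' \<in> carrier A" and b: "b \<in> carrier B"
  shows "E (c \<odot>\<^bsub>A\<^esub> a \<oplus>\<^bsub>A\<^esub> a') b = c \<odot>\<^bsub>min_tensor A B\<^esub> E a b \<oplus>\<^bsub>min_tensor A B\<^esub> E a' b"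
proof -
  let ?P = "formal_tensor A B" and ?T = "min_tensor A B"
  define s where "s a = (Poly_Mapping.single (a, b) 1 :: 'a \<times> 'b \<Rightarrow>\<^sub>0 complex)" for a
  have s: "s a \<in> carrier ?P" if "a \<in> carrier A" for a using that b by (simp add: s_def single_in)
  have ca: "c \<odot>\<^bsub>A\<^esub> a \<oplus>\<^bsub>A\<^esub> a' \<in> carrier A" using a by (simp add: A.smult_closed)
  define z where "z = s (c \<odot>\<^bsub>A\<^esub> a \<oplus>\<^bsub>A\<^esub> a') + (Poly_Mapping.single (a, b) (- c) + Poly_Mapping.single (a', b) (- 1))"
  have z_in: "z \<in> carrier M.P"
    unfolding z_def s_def using a b ca by (intro M.plus_closed M.single_closed) auto
  have "sp.\<iota> z = \<zero>\<^bsub>?T\<^esub>"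
  proof (rule spatial_null[OF z_in])
    fix \<sigma> \<tau> p q assume st: "state A \<sigma>" "state B \<tau>" and pq: "p \<in> carrier (A \<times>\<times> B)" "q \<in> carrier (A \<times>\<times> B)"
    interpret \<sigma>: positive_functional A \<sigma> by (rule A.state_positive_functional[OF st(1)])
    have "\<sigma> (fst p \<otimes>\<^bsub>A\<^esub> (c \<odot>\<^bsub>A\<^esub> a \<oplus>\<^bsub>A\<^esub> a') \<otimes>\<^bsub>A\<^esub> fst q) =
        c * \<sigma> (fst p \<otimes>\<^bsub>A\<^esub> a \<otimes>\<^bsub>A\<^esub> fst q) + \<sigma> (fst p \<otimes>\<^bsub>A\<^esub> a' \<otimes>\<^bsub>A\<^esub> fst q)"
      using pq a by (auto simp: A.l_distr A.r_distr A.smult_closed A.smult_mult_left A.smult_mult_right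
          \<sigma>.fn_add \<sigma>.fn_smult)
    then show "product_functional \<sigma> \<tau> (Poly_Mapping.single p 1 \<otimes>\<^bsub>M.P\<^esub> z \<otimes>\<^bsub>M.P\<^esub> Poly_Mapping.single q 1) = 0"
      by (simp add: z_def s_def M.mult_plus_left M.mult_plus_right M.mult_single_single
          product_functional_add product_functional_single mult_DirProd' algebra_simps)
  qed
  moreover have "z = s (c \<odot>\<^bsub>A\<^esub> a \<oplus>\<^bsub>A\<^esub> a') \<ominus>\<^bsub>?P\<^esub> (c \<odot>\<^bsub>?P\<^esub> s a \<oplus>\<^bsub>?P\<^esub> s a')"
  proof -
    have "\<ominus>\<^bsub>?P\<^esub> (c \<odot>\<^bsub>?P\<^esub> s a \<oplus>\<^bsub>?P\<^esub> s a') = (-1) \<odot>\<^bsub>?P\<^esub> (c \<odot>\<^bsub>?P\<^esub> s a \<oplus>\<^bsub>?P\<^esub> s a')"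
      using a s by (simp add: sp.smult_minus_one sp.smult_closed)
    then show ?thesis
      by (simp add: z_def a_minus_def) (simp add: formal_tensor_eq monoid_star_algebra_simps s_def
          map_mult_plus map_mult_single)
  qed
  ultimately have "sp.\<iota> (s (c \<odot>\<^bsub>A\<^esub> a \<oplus>\<^bsub>A\<^esub> a')) \<ominus>\<^bsub>?T\<^esub> (c \<odot>\<^bsub>?T\<^esub> sp.\<iota> (s a) \<oplus>\<^bsub>?T\<^esub> sp.\<iota> (s a')) = \<zero>\<^bsub>?T\<^esub>"
    using a ca s by (simp add: min_tensor_eq sp.\<iota>.hom_diff sp.\<iota>.hom_smult sp.smult_closed)
  then show ?thesis
    using a b ca E_closed by (subst (asm) T.diff_eq_zero_iff) (auto simp: E_eq s_def T.smult_closed)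
qed

lemma E_linear_right:
  assumes a: "a \<in> carrier A" and b: "b \<in> carrier B" "b' \<in> carrier B"
  shows "E a (c \<odot>\<^bsub>B\<^esub> b \<oplus>\<^bsub>B\<^esub> b') = c \<odot>\<^bsub>min_tensor A B\<^esub> E a b \<oplus>\<^bsub>min_tensor A B\<^esub> E a b'"
proof -
  let ?P = "formal_tensor A B" and ?T = "min_tensor A B"
  define s where "s b = (Poly_Mapping.single (a, b) 1 :: 'a \<times> 'b \<Rightarrow>\<^sub>0 complex)" for b
  have s: "s b \<in> carrier ?P" if "b \<in> carrier B" for b using that a by (simp add: s_def single_in)
  have cb: "c \<odot>\<^bsub>B\<^esub> b \<oplus>\<^bsub>B\<^esub> b' \<in> carrier B" using b by (simp add: B.smult_closed)
  define z where "z = s (c \<odot>\<^bsub>B\<^esub> b \<oplus>\<^bsub>B\<^esub> b') + (Poly_Mapping.single (a, b) (- c) + Poly_Mapping.single (a, b') (- 1))"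
  have z_in: "z \<in> carrier M.P"
    unfolding z_def s_def using a b cb by (intro M.plus_closed M.single_closed) auto
  have "sp.\<iota> z = \<zero>\<^bsub>?T\<^esub>"
  proof (rule spatial_null[OF z_in])
    fix \<sigma> \<tau> p q assume st: "state A \<sigma>" "state B \<tau>" and pq: "p \<in> carrier (A \<times>\<times> B)" "q \<in> carrier (A \<times>\<times> B)"
    interpret \<tau>: positive_functional B \<tau> by (rule B.state_positive_functional[OF st(2)])
    have "\<tau> (snd p \<otimes>\<^bsub>B\<^esub> (c \<odot>\<^bsub>B\<^esub> b \<oplus>\<^bsub>B\<^esub> b') \<otimes>\<^bsub>B\<^esub> snd q) =
        c * \<tau> (snd p \<otimes>\<^bsub>B\<^esub> b \<otimes>\<^bsub>B\<^esub> snd q) + \<tau> (snd p \<otimes>\<^bsub>B\<^esub> b' \<otimes>\<^bsub>B\<^esub> snd q)"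
      using pq b by (auto simp: B.l_distr B.r_distr B.smult_closed B.smult_mult_left B.smult_mult_right
          \<tau>.fn_add \<tau>.fn_smult)
    then show "product_functional \<sigma> \<tau> (Poly_Mapping.single p 1 \<otimes>\<^bsub>M.P\<^esub> z \<otimes>\<^bsub>M.P\<^esub> Poly_Mapping.single q 1) = 0"
      by (simp add: z_def s_def M.mult_plus_left M.mult_plus_right M.mult_single_single
          product_functional_add product_functional_single mult_DirProd' algebra_simps)
  qed
  moreover have "z = s (c \<odot>\<^bsub>B\<^esub> b \<oplus>\<^bsub>B\<^esub> b') \<ominus>\<^bsub>?P\<^esub> (c \<odot>\<^bsub>?P\<^esub> s b \<oplus>\<^bsub>?P\<^esub> s b')"
  proof -
    have "\<ominus>\<^bsub>?P\<^esub> (c \<odot>\<^bsub>?P\<^esub> s b \<oplus>\<^bsub>?P\<^esub> s b') = (-1) \<odot>\<^bsub>?P\<^esub> (c \<odot>\<^bsub>?P\<^esub> s b \<oplus>\<^bsub>?P\<^esub> s b')"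
      using b s by (simp add: sp.smult_minus_one sp.smult_closed)
    then show ?thesis
      by (simp add: z_def a_minus_def) (simp add: formal_tensor_eq monoid_star_algebra_simps s_def
          map_mult_plus map_mult_single)
  qed
  ultimately have "sp.\<iota> (s (c \<odot>\<^bsub>B\<^esub> b \<oplus>\<^bsub>B\<^esub> b')) \<ominus>\<^bsub>?T\<^esub> (c \<odot>\<^bsub>?T\<^esub> sp.\<iota> (s b) \<oplus>\<^bsub>?T\<^esub> sp.\<iota> (s b')) = \<zero>\<^bsub>?T\<^esub>"
    using b cb s by (simp add: min_tensor_eq sp.\<iota>.hom_diff sp.\<iota>.hom_smult sp.smult_closed)
  then show ?thesis
    using a b cb E_closed by (subst (asm) T.diff_eq_zero_iff) (auto simp: E_eq s_def T.smult_closed)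
qed

lemma E_add_left: "\<lbrakk>a \<in> carrier A; a' \<in> carrier A; b \<in> carrier B\<rbrakk> \<Longrightarrow>
    E (a \<oplus>\<^bsub>A\<^esub> a') b = E a b \<oplus>\<^bsub>min_tensor A B\<^esub> E a' b"
  using E_linear_left[of a a' b 1] by (simp add: A.smult_one T.smult_one E_closed)

lemma E_add_right: "\<lbrakk>a \<in> carrier A; b \<in> carrier B; b' \<in> carrier B\<rbrakk> \<Longrightarrow>
    E a (b \<oplus>\<^bsub>B\<^esub> b') = E a b \<oplus>\<^bsub>min_tensor A B\<^esub> E a b'"
  using E_linear_right[of a b b' 1] by (simp add: B.smult_one T.smult_one E_closed)

lemma E_zero_left: "b \<in> carrier B \<Longrightarrow> E \<zero>\<^bsub>A\<^esub> b = \<zero>\<^bsub>min_tensor A B\<^esub>"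
  using E_linear_left[of "\<zero>\<^bsub>A\<^esub>" "\<zero>\<^bsub>A\<^esub>" b "-1"]
  by (simp add: A.star.smult_zero_right T.star.smult_minus_one E_closed T.l_neg)

lemma E_zero_right: "a \<in> carrier A \<Longrightarrow> E a \<zero>\<^bsub>B\<^esub> = \<zero>\<^bsub>min_tensor A B\<^esub>"
  using E_linear_right[of a "\<zero>\<^bsub>B\<^esub>" "\<zero>\<^bsub>B\<^esub>" "-1"]
  by (simp add: B.star.smult_zero_right T.star.smult_minus_one E_closed T.l_neg)

lemma E_smult_left: "\<lbrakk>a \<in> carrier A; b \<in> carrier B\<rbrakk> \<Longrightarrow> E (c \<odot>\<^bsub>A\<^esub> a) b = c \<odot>\<^bsub>min_tensor A B\<^esub> E a b"
  using E_linear_left[of a "\<zero>\<^bsub>A\<^esub>" b c] by (simp add: A.smult_closed T.smult_closed E_closed E_zero_left)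

lemma E_smult_right: "\<lbrakk>a \<in> carrier A; b \<in> carrier B\<rbrakk> \<Longrightarrow> E a (c \<odot>\<^bsub>B\<^esub> b) = c \<odot>\<^bsub>min_tensor A B\<^esub> E a b"
  using E_linear_right[of a b "\<zero>\<^bsub>B\<^esub>" c] by (simp add: B.smult_closed T.smult_closed E_closed E_zero_right)

lemma E_finsum_left:
  "\<lbrakk>finite K; \<And>k. k \<in> K \<Longrightarrow> f k \<in> carrier A; b \<in> carrier B\<rbrakk> \<Longrightarrow>
    E (\<Oplus>\<^bsub>A\<^esub>k\<in>K. f k) b = (\<Oplus>\<^bsub>min_tensor A B\<^esub>k\<in>K. E (f k) b)"
  by (induction K rule: finite_induct) (auto simp: E_zero_left E_add_left E_closed Pi_iff A.finsum_closed)

lemma E_finsum_right: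
  "\<lbrakk>finite K; \<And>k. k \<in> K \<Longrightarrow> f k \<in> carrier B; a \<in> carrier A\<rbrakk> \<Longrightarrow>
    E a (\<Oplus>\<^bsub>B\<^esub>k\<in>K. f k) = (\<Oplus>\<^bsub>min_tensor A B\<^esub>k\<in>K. E a (f k))"
  by (induction K rule: finite_induct) (auto simp: E_zero_right E_add_right E_closed Pi_iff B.finsum_closed)

end

text \<open>Contractivity is what transfers the norm bound contained in \<open>state\<close>; the
  remaining conditions are algebraic.\<close>

lemma state_comp:
  assumes "star_homomorphism A B \<phi>" "contractive A B \<phi>" "state B \<sigma>"
  shows "state A (\<lambda>x. \<sigma> (\<phi> x))"
proof -
  interpret star_homomorphism A B \<phi> by fact
  show ?thesis
    unfolding state_def
  proof (intro conjI ballI allI)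
    fix x assume x: "x \<in> carrier A"
    have "\<phi> (adj A x \<otimes>\<^bsub>A\<^esub> x) = adj B (\<phi> x) \<otimes>\<^bsub>B\<^esub> \<phi> x"
      using x by (simp add: hom_adj A.adj_closed)
    then show "Im (\<sigma> (\<phi> (adj A x \<otimes>\<^bsub>A\<^esub> x))) = 0" "0 \<le> Re (\<sigma> (\<phi> (adj A x \<otimes>\<^bsub>A\<^esub> x)))"
      using assms(3) x by (auto simp: state_def)
    have "cmod (\<sigma> (\<phi> x)) \<le> nrm B (\<phi> x)" "nrm B (\<phi> x) \<le> nrm A x"
      using assms(2,3) x by (auto simp: state_def contractive_def)
    then show "cmod (\<sigma> (\<phi> x)) \<le> nrm A x" by simp
  qed (use assms(3) in \<open>auto simp: state_def hom_smult\<close>)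
qed

text \<open>Surjectivity of \<open>\<phi>\<close> makes every vector of the GNS representation of \<open>\<sigma> \<otimes> \<tau>\<close> one of
  \<open>(\<sigma> \<circ> \<phi>) \<otimes> (\<tau> \<circ> \<phi>)\<close>.\<close>

lemma tensor_square_hom:
  assumes AB: "unital_cstar_algebra A" "unital_cstar_algebra B"
    and \<phi>: "star_homomorphism A B \<phi>" "contractive A B \<phi>" "\<phi> ` carrier A = carrier B"
  shows "\<exists>\<Phi>. star_homomorphism (min_tensor A A) (min_tensor B B) \<Phi> \<and>
    contractive (min_tensor A A) (min_tensor B B) \<Phi> \<and>
    (\<forall>a\<in>carrier A. \<forall>b\<in>carrier A.
      \<Phi> (elementary_tensor A A a b) = elementary_tensor B B (\<phi> a) (\<phi> b))"
proof -
  interpret A: cstar_tensor A A using AB by (simp add: cstar_tensor_def)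
  interpret B: cstar_tensor B B using AB by (simp add: cstar_tensor_def)
  interpret \<phi>: star_homomorphism A B \<phi> by fact
  let ?P = "formal_tensor A A" and ?Q = "formal_tensor B B"
  let ?h = "\<lambda>p. Poly_Mapping.single (\<phi> (fst p), \<phi> (snd p)) (1 :: complex)"
  interpret h: star_monoid_hom "A \<times>\<times> A" "map_prod (adj A) (adj A)" ?Q ?h
    by unfold_locales
      (auto simp: B.single_in, auto simp: B.formal_tensor_eq monoid_star_algebra_simps(2)
        B.M.mult_single_single B.M.adj_single \<phi>.hom_adj)
  define g where "g = monoid_lift ?Q ?h"
  interpret g: star_homomorphism ?P ?Q g
    unfolding g_def by unfold_locales (simp add: A.formal_tensor_eq h.lift_star_hom)
  have g_single: "g (Poly_Mapping.single (a, b) c) = Poly_Mapping.single (\<phi> a, \<phi> b) c"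
    if "a \<in> carrier A" "b \<in> carrier A" for a b c
    using that h.lift_single[of "(a, b)" c]
    by (simp add: g_def) (simp add: B.formal_tensor_eq monoid_star_algebra_simps map_mult_single)
  have g_plus: "g (x + y) = g x + g y" if "x \<in> carrier A.M.P" "y \<in> carrier A.M.P" for x y
    using g.hom_add[of x y] that by (simp add: A.formal_tensor_eq B.formal_tensor_eq monoid_star_algebra_simps(4))
  have functional: "product_functional (\<lambda>x. \<sigma> (\<phi> x)) (\<lambda>x. \<tau> (\<phi> x)) x = product_functional \<sigma> \<tau> (g x)"
    if "x \<in> carrier A.M.P" for \<sigma> \<tau> x
    using that
    by (induction x rule: A.M.monoid_algebra_induct)
      (auto simp: A.product_functional_single B.product_functional_single g_single g_plus
        A.product_functional_add B.product_functional_add)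
  have surj: "\<exists>x\<in>carrier A.M.P. g x = y" if "y \<in> carrier B.M.P" for y
    using that
  proof (induction y rule: B.M.monoid_algebra_induct)
    case (single p c)
    then have "fst p \<in> \<phi> ` carrier A" "snd p \<in> \<phi> ` carrier A"
      unfolding \<phi>(3) by auto
    then obtain a b where "a \<in> carrier A" "b \<in> carrier A" "p = (\<phi> a, \<phi> b)"
      by (metis imageE prod.collapse)
    then show ?case
      by (intro bexI[of _ "Poly_Mapping.single (a, b) c"]) (auto simp: g_single intro!: A.M.single_closed)
  next
    case (plus x y)
    then obtain v w where "v \<in> carrier A.M.P" "g v = x" "w \<in> carrier A.M.P" "g w = y" by blast
    then show ?case by (intro bexI[of _ "v + w"]) (simp_all add: g_plus A.M.plus_closed)
  qed
  have bounded: "spatial_seminorm B B (g x) \<le> spatial_seminorm A A x" if x: "x \<in> carrier ?P" for x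
    unfolding B.spatial_seminorm_eq
  proof (rule B.gns.gns_le)
    have xP: "x \<in> carrier A.M.P" using x by (simp add: A.formal_tensor_eq)
    show "0 \<le> spatial_seminorm A A x" using x by (rule A.sp.N_nonneg)
    fix \<omega> y assume "\<omega> \<in> B.product_functionals" and y: "y \<in> carrier B.M.P"
    then obtain \<sigma> \<tau> where st: "state B \<sigma>" "state B \<tau>" "\<omega> = product_functional \<sigma> \<tau>" by blast
    let ?\<omega> = "product_functional (\<lambda>x. \<sigma> (\<phi> x)) (\<lambda>x. \<tau> (\<phi> x))"
    have \<omega>: "?\<omega> \<in> A.product_functionals"
      using st state_comp[OF \<phi>(1,2)] by blast
    have Q: "A.gns.Q ?\<omega> w = B.gns.Q \<omega> (g w)" if w: "w \<in> carrier A.M.P" for w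
      using w g.hom_adj[of w] g.hom_mult[of "adj A.M.P w" w] A.M.adj_P_closed[OF w] A.M.mult_closed
      by (simp add: functional st A.formal_tensor_eq B.formal_tensor_eq)
    obtain z where z: "z \<in> carrier A.M.P" "g z = y" using surj[OF y] by blast
    have "sqrt (A.gns.Q ?\<omega> (x \<otimes>\<^bsub>A.M.P\<^esub> z)) \<le> spatial_seminorm A A x * sqrt (A.gns.Q ?\<omega> z)"
      unfolding A.spatial_seminorm_eq by (rule A.gns.gns_bound[OF \<omega> xP z(1)])
    moreover have "g (x \<otimes>\<^bsub>A.M.P\<^esub> z) = g x \<otimes>\<^bsub>B.M.P\<^esub> y"
      using g.hom_mult[of x z] x z by (simp add: A.formal_tensor_eq B.formal_tensor_eq)
    ultimately show "sqrt (B.gns.Q \<omega> (g x \<otimes>\<^bsub>B.M.P\<^esub> y)) \<le> spatial_seminorm A A x * sqrt (B.gns.Q \<omega> y)"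
      using Q[OF z(1)] Q[OF A.M.mult_closed[OF xP z(1)]] z(2) by simp
  qed
  let ?\<epsilon> = "\<lambda>x. B.sp.\<iota> (g x)"
  interpret \<epsilon>: star_homomorphism ?P "min_tensor B B" ?\<epsilon>
    by unfold_locales
      (use star_hom_comp[OF g.star_hom B.sp.\<iota>.star_hom] in \<open>simp add: B.min_tensor_eq\<close>)
  interpret \<epsilon>: completion_hom ?P "spatial_seminorm A A" "min_tensor B B" ?\<epsilon>
    by unfold_locales (use bounded in \<open>simp add: B.min_tensor_eq B.sp.nrm_to_completion\<close>)
  show ?thesis
  proof (intro exI[of _ "completion_lift (min_tensor B B) ?\<epsilon>"] conjI ballI)
    show "star_homomorphism (min_tensor A A) (min_tensor B B) (completion_lift (min_tensor B B) ?\<epsilon>)"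
      "contractive (min_tensor A A) (min_tensor B B) (completion_lift (min_tensor B B) ?\<epsilon>)"
      using \<epsilon>.lift_hom \<epsilon>.lift_contractive by (simp_all add: A.min_tensor_eq)
    show "completion_lift (min_tensor B B) ?\<epsilon> (A.E a b) = B.E (\<phi> a) (\<phi> b)"
      if "a \<in> carrier A" "b \<in> carrier A" for a b
      unfolding A.E_eq B.E_eq using that by (simp add: \<epsilon>.lift_to_completion A.single_in g_single)
  qed
qed


section \<open>Universal C*-algebras of projections\<close>

text \<open>The relations are arbitrary apart from forcing every generator to be a projection. This
  is what makes the supremum in \<open>universal_seminorm\<close> finite.\<close>

locale universal_projections =
  fixes X :: "'g set" and R :: "(('g \<times> bool) list \<Rightarrow>\<^sub>0 complex) set"
  assumes rel_closed: "R \<subseteq> carrier (free_star_algebra X)"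
    and rel_idem: "g \<in> X \<Longrightarrow> free_gen g \<otimes>\<^bsub>free_star_algebra X\<^esub> free_gen g \<ominus>\<^bsub>free_star_algebra X\<^esub> free_gen g \<in> R"
    and rel_adj: "g \<in> X \<Longrightarrow> adj (free_star_algebra X) (free_gen g) \<ominus>\<^bsub>free_star_algebra X\<^esub> free_gen g \<in> R"
begin

abbreviation F where "F \<equiv> free_star_algebra X"

sublocale F: unital_star_algebra F
  by (rule free_star_algebra)

definition vanishing :: "((('g \<times> bool) list \<Rightarrow>\<^sub>0 complex) \<Rightarrow> real) \<Rightarrow> bool" where
  "vanishing p \<longleftrightarrow> cstar_seminorm F p \<and> (\<forall>r\<in>R. p r = 0)"

lemma vanishing_seminormed: "vanishing p \<Longrightarrow> seminormed_star_algebra F p"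
  using F.unital_star_algebra_axioms
  by (simp add: vanishing_def seminormed_star_algebra_def seminormed_star_algebra_axioms_def)

lemma vanishing_zero: "vanishing (\<lambda>x. 0)"
  by (simp add: vanishing_def cstar_seminorm_def)

text \<open>Modulo elements on which p vanishes, \<open>adj F g \<otimes> g\<close>,
  \<open>g \<otimes> g\<close> and g agree for a generator g, so the C*-identity makes
  \<open>p g\<close> idempotent.\<close>

lemma vanishing_gen_le:
  assumes p: "vanishing p" and g: "g \<in> X"
  shows "p (free_gen g) \<le> 1"
proof -
  interpret seminormed_star_algebra F p by (rule vanishing_seminormed[OF p])
  let ?g = "free_gen g" and ?a = "adj F (free_gen g)"
  have c: "?g \<in> carrier F" "?a \<in> carrier F" using g by (simp_all add: free_gen_closed F.adj_closed)
  have 0: "p (?g \<otimes>\<^bsub>F\<^esub> ?g \<ominus>\<^bsub>F\<^esub> ?g) = 0" "p (?a \<ominus>\<^bsub>F\<^esub> ?g) = 0"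
    using p rel_idem[OF g] rel_adj[OF g] by (auto simp: vanishing_def)
  have "?a \<otimes>\<^bsub>F\<^esub> ?g \<ominus>\<^bsub>F\<^esub> ?g \<otimes>\<^bsub>F\<^esub> ?g = (?a \<ominus>\<^bsub>F\<^esub> ?g) \<otimes>\<^bsub>F\<^esub> ?g"
    using c by (simp add: a_minus_def F.l_distr F.l_minus)
  then have "p (?a \<otimes>\<^bsub>F\<^esub> ?g \<ominus>\<^bsub>F\<^esub> ?g \<otimes>\<^bsub>F\<^esub> ?g) \<le> 0"
    using N_mult[of "?a \<ominus>\<^bsub>F\<^esub> ?g" ?g] c 0 by simp
  then have "(p ?g)\<^sup>2 = p ?g"
    using N_abs_diff[of "?a \<otimes>\<^bsub>F\<^esub> ?g" "?g \<otimes>\<^bsub>F\<^esub> ?g"] N_abs_diff[of "?g \<otimes>\<^bsub>F\<^esub> ?g" ?g] N_cstar[OF c(1)] c 0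
    by simp
  then show ?thesis by (auto simp: power2_eq_square)
qed

text \<open>The bound is uniform in p but depends on x. It starts from the generators and passes
  through all operations, so no explicit constant for a word is needed.\<close>

lemma vanishing_bounded:
  assumes "x \<in> carrier F"
  shows "\<exists>C. \<forall>p. vanishing p \<longrightarrow> p x \<le> C"
  using assms
proof (induction x rule: free_star_algebra_induct)
  case (gen g)
  then show ?case using vanishing_gen_le by blast
next
  case one
  then show ?case using seminormed_star_algebra.N_one_le vanishing_seminormed by blast
next
  case (smult c x)
  then obtain C where C: "\<And>p. vanishing p \<Longrightarrow> p x \<le> C" by blast
  have "p (c \<odot>\<^bsub>F\<^esub> x) \<le> cmod c * C" if "vanishing p" for p
    using C[OF that] seminormed_star_algebra.N_smult[OF vanishing_seminormed[OF that] smult(1)]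
    by (simp add: mult_left_mono)
  then show ?case by blast
next
  case (add x y)
  then obtain C D where C: "\<And>p. vanishing p \<Longrightarrow> p x \<le> C" "\<And>p. vanishing p \<Longrightarrow> p y \<le> D" by blast
  have "p (x \<oplus>\<^bsub>F\<^esub> y) \<le> C + D" if "vanishing p" for p
    using C[OF that] seminormed_star_algebra.N_add[OF vanishing_seminormed[OF that] add(1,2)] by simp
  then show ?case by blast
next
  case (mult x y)
  then obtain C D where C: "\<And>p. vanishing p \<Longrightarrow> p x \<le> C" "\<And>p. vanishing p \<Longrightarrow> p y \<le> D" by blast
  \<comment> \<open>Absolute values make the product of the two bounds monotone.\<close>
  have "p (x \<otimes>\<^bsub>F\<^esub> y) \<le> \<bar>C\<bar> * \<bar>D\<bar>" if "vanishing p" for p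
  proof -
    interpret seminormed_star_algebra F p by (rule vanishing_seminormed[OF that])
    have "p x * p y \<le> \<bar>C\<bar> * \<bar>D\<bar>"
      using C[OF that] mult(1,2) by (intro mult_mono N_nonneg) auto
    then show ?thesis using N_mult[OF mult(1,2)] by simp
  qed
  then show ?case by blast
next
  case (adj x)
  then show ?case using seminormed_star_algebra.N_adj[OF vanishing_seminormed] by metis
qed

abbreviation N where "N \<equiv> universal_seminorm F R"

lemma N_eq: "N x = Sup {p x | p. vanishing p}"
  by (simp add: universal_seminorm_def vanishing_def)

lemma vanishing_le:
  assumes "vanishing p" "x \<in> carrier F"
  shows "p x \<le> N x"
proof -
  obtain C where "\<And>p. vanishing p \<Longrightarrow> p x \<le> C" using vanishing_bounded[OF assms(2)] by blast
  then show ?thesis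
    unfolding N_eq using assms by (intro cSup_upper bdd_aboveI[of _ C]) auto
qed

lemma N_least: "(\<And>p. vanishing p \<Longrightarrow> p x \<le> C) \<Longrightarrow> N x \<le> C"
  unfolding N_eq using vanishing_zero by (intro cSup_least) auto

lemma N_nonneg: "x \<in> carrier F \<Longrightarrow> 0 \<le> N x"
  using vanishing_le[OF vanishing_zero] .

lemma N_rel: "r \<in> R \<Longrightarrow> N r = 0"
  using N_nonneg[of r] rel_closed by (intro antisym N_least) (auto simp: vanishing_def)

text \<open>All conditions pass to suprema. Homogeneity gets its second inequality from the scalar 1
  / c, and the C*-identity holds since a supremum of squares of nonnegative numbers is the square of
  the supremum.\<close>

lemma universal_cstar_seminorm: "cstar_seminorm F N"
  unfolding cstar_seminorm_def
proof (intro conjI ballI allI)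
  fix x y assume xy: "x \<in> carrier F" "y \<in> carrier F"
  show "N (x \<oplus>\<^bsub>F\<^esub> y) \<le> N x + N y"
  proof (rule N_least)
    fix p assume p: "vanishing p"
    interpret seminormed_star_algebra F p by (rule vanishing_seminormed[OF p])
    show "p (x \<oplus>\<^bsub>F\<^esub> y) \<le> N x + N y"
      using N_add[OF xy] vanishing_le[OF p xy(1)] vanishing_le[OF p xy(2)] by simp
  qed
  show "N (x \<otimes>\<^bsub>F\<^esub> y) \<le> N x * N y"
  proof (rule N_least)
    fix p assume p: "vanishing p"
    interpret s: seminormed_star_algebra F p by (rule vanishing_seminormed[OF p])
    have "p x * p y \<le> N x * N y"
      using vanishing_le[OF p xy(1)] vanishing_le[OF p xy(2)] xy
      by (intro mult_mono N_nonneg s.N_nonneg)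
    then show "p (x \<otimes>\<^bsub>F\<^esub> y) \<le> N x * N y" using s.N_mult[OF xy] by simp
  qed
next
  fix x assume x: "x \<in> carrier F"
  have le: "N (c \<odot>\<^bsub>F\<^esub> x) \<le> cmod c * N x" if x: "x \<in> carrier F" for c x
  proof (rule N_least)
    fix p assume p: "vanishing p"
    interpret s: seminormed_star_algebra F p by (rule vanishing_seminormed[OF p])
    show "p (c \<odot>\<^bsub>F\<^esub> x) \<le> cmod c * N x"
      using s.N_smult[OF x] vanishing_le[OF p x] by (simp add: mult_left_mono)
  qed
  show "N (c \<odot>\<^bsub>F\<^esub> x) = cmod c * N x" for c
  proof (cases "c = 0")
    case True
    then show ?thesis using le[OF x, of 0] N_nonneg[of "0 \<odot>\<^bsub>F\<^esub> x"] x by (simp add: F.smult_closed)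
  next
    case False
    have "N x \<le> cmod (1 / c) * N (c \<odot>\<^bsub>F\<^esub> x)"
      using le[of "c \<odot>\<^bsub>F\<^esub> x" "1 / c"] x False by (simp add: F.smult_closed F.smult_smult[symmetric] F.smult_one)
    then have "cmod c * N x \<le> N (c \<odot>\<^bsub>F\<^esub> x)" using False by (simp add: norm_divide field_simps)
    then show ?thesis using le[OF x, of c] by simp
  qed
  have xx: "adj F x \<otimes>\<^bsub>F\<^esub> x \<in> carrier F" using x by (simp add: F.adj_closed)
  show "N (adj F x \<otimes>\<^bsub>F\<^esub> x) = (N x)\<^sup>2"
  proof (rule antisym)
    show "N (adj F x \<otimes>\<^bsub>F\<^esub> x) \<le> (N x)\<^sup>2"
    proof (rule N_least)
      fix p assume p: "vanishing p"
      interpret s: seminormed_star_algebra F p by (rule vanishing_seminormed[OF p])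
      show "p (adj F x \<otimes>\<^bsub>F\<^esub> x) \<le> (N x)\<^sup>2"
        using s.N_cstar[OF x] power_mono[OF vanishing_le[OF p x] s.N_nonneg[OF x], of 2] by simp
    qed
    have "N x \<le> sqrt (N (adj F x \<otimes>\<^bsub>F\<^esub> x))"
    proof (rule N_least)
      fix p assume p: "vanishing p"
      interpret s: seminormed_star_algebra F p by (rule vanishing_seminormed[OF p])
      show "p x \<le> sqrt (N (adj F x \<otimes>\<^bsub>F\<^esub> x))"
        using s.N_cstar[OF x] vanishing_le[OF p xx] by (intro real_le_rsqrt) simp
    qed
    then have "(N x)\<^sup>2 \<le> (sqrt (N (adj F x \<otimes>\<^bsub>F\<^esub> x)))\<^sup>2"
      using N_nonneg[OF x] by (intro power_mono)
    then show "(N x)\<^sup>2 \<le> N (adj F x \<otimes>\<^bsub>F\<^esub> x)" using N_nonneg[OF xx] by simp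
  qed
qed

sublocale S: seminormed_star_algebra F N
  by unfold_locales (rule universal_cstar_seminorm)

abbreviation U where "U \<equiv> universal_cstar_algebra X R"
abbreviation gen where "gen \<equiv> universal_gen X R"

lemma U_eq: "U = S.K"
  by (simp add: universal_cstar_algebra_def)

lemma gen_eq: "gen g = S.\<iota> (free_gen g)"
  by (simp add: universal_gen_def)

sublocale U: unital_cstar_algebra U
  unfolding U_eq by (rule S.completion_cstar_algebra)

lemma \<iota>_star_hom: "star_homomorphism F U S.\<iota>"
  unfolding U_eq by unfold_locales

lemma rel_zero: "r \<in> R \<Longrightarrow> S.\<iota> r = \<zero>\<^bsub>U\<^esub>"
  using rel_closed U.nrm_eq_0_iff[of "S.\<iota> r"] S.nrm_to_completion[of r] S.to_completion_closed[of r]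
  by (auto simp: U_eq N_rel)

lemma gen_closed: "g \<in> X \<Longrightarrow> gen g \<in> carrier U"
  unfolding gen_eq U_eq by (intro S.to_completion_closed free_gen_closed)

text \<open>The norm of B pulled back along \<open>free_lift\<close> is a C*-seminorm that vanishes
  on R, hence below N, and the map extends to the completion. The hypothesis on relations speaks of
  any \<epsilon> with the right values on generators, so its uses never unfold
  \<open>free_lift\<close>.\<close>

lemma universal_property:
  assumes B: "unital_cstar_algebra B" and u: "\<And>g. g \<in> X \<Longrightarrow> u g \<in> carrier B"
    and zero: "\<And>\<epsilon>. \<lbrakk>star_homomorphism F B \<epsilon>; \<And>g. g \<in> X \<Longrightarrow> \<epsilon> (free_gen g) = u g\<rbrakk> \<Longrightarrow> \<forall>r\<in>R. \<epsilon> r = \<zero>\<^bsub>B\<^esub>"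
  shows "\<exists>\<phi>. star_homomorphism U B \<phi> \<and> contractive U B \<phi> \<and> (\<forall>g\<in>X. \<phi> (gen g) = u g)"
proof -
  interpret B: unital_cstar_algebra B by (rule B)
  let ?\<epsilon> = "free_lift B u"
  interpret \<epsilon>: star_homomorphism F B ?\<epsilon> by (rule B.free_lift_hom[OF u])
  have gen: "?\<epsilon> (free_gen g) = u g" if "g \<in> X" for g using B.free_lift_gen[OF u that] by simp
  have "cstar_seminorm F (\<lambda>x. nrm B (?\<epsilon> x))"
    unfolding cstar_seminorm_def
    by (auto simp: \<epsilon>.hom_smult \<epsilon>.hom_adj F.adj_closed B.nrm_add B.nrm_mult B.nrm_smult B.nrm_cstar)
  then have "vanishing (\<lambda>x. nrm B (?\<epsilon> x))"
    using zero[OF \<epsilon>.star_homomorphism_axioms gen] by (simp add: vanishing_def B.norm.N_zero)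
  then interpret completion_hom F N B ?\<epsilon>
    by unfold_locales (rule vanishing_le)
  show ?thesis
    by (rule exI[of _ "completion_lift B ?\<epsilon>"])
      (simp add: U_eq lift_hom lift_contractive gen_eq lift_to_completion free_gen_closed gen)
qed

lemma hom_eqI:
  assumes f: "star_homomorphism U B f" "contractive U B f" and g: "star_homomorphism U B g" "contractive U B g"
    and B: "unital_cstar_algebra B" and eq: "\<And>a. a \<in> X \<Longrightarrow> f (gen a) = g (gen a)" and x: "x \<in> carrier U"
  shows "f x = g x"
proof -
  interpret f: star_homomorphism U B f by fact
  interpret g: star_homomorphism U B g by fact
  interpret \<iota>: star_homomorphism F U S.\<iota> by (rule \<iota>_star_hom)
  have "f (S.\<iota> a) = g (S.\<iota> a)" if "a \<in> carrier F" for a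
    using that
    by (induction a rule: free_star_algebra_induct)
      (auto simp: U_eq[symmetric] eq[unfolded gen_eq] \<iota>.hom_smult f.hom_smult g.hom_smult \<iota>.hom_adj f.hom_adj g.hom_adj)
  then show ?thesis
    using S.completion_hom_eqI[of B f g x] f g B x by (simp add: U_eq)
qed

end

section \<open>Subalgebras and the density of polynomials in the generators\<close>

context unital_star_algebra
begin

text \<open>Purely algebraic, without closedness, so that it applies to the range of a homomorphism
  before that range is known to be closed.\<close>

definition star_subalgebra :: "'a set \<Rightarrow> bool" where
  "star_subalgebra S \<longleftrightarrow> S \<subseteq> carrier P \<and> \<one> \<in> S \<and> (\<forall>x\<in>S. \<forall>y\<in>S. x \<oplus> y \<in> S \<and> x \<otimes> y \<in> S) \<and>
     (\<forall>c. \<forall>x\<in>S. c \<odot> x \<in> S) \<and> (\<forall>x\<in>S. adj P x \<in> S)"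

lemma star_subalgebra_zero: "star_subalgebra S \<Longrightarrow> \<zero> \<in> S"
  using smult_zero_left[OF one_closed] by (metis star_subalgebra_def)

lemma star_subalgebra_diff: "\<lbrakk>star_subalgebra S; x \<in> S; y \<in> S\<rbrakk> \<Longrightarrow> x \<ominus> y \<in> S"
  using smult_minus_one[of y] unfolding star_subalgebra_def a_minus_def by (metis subsetD)

lemma star_subalgebra_finsum:
  "\<lbrakk>star_subalgebra S; \<And>i. i \<in> I \<Longrightarrow> f i \<in> S\<rbrakk> \<Longrightarrow> (\<Oplus>i\<in>I. f i) \<in> S"
proof (induction I rule: infinite_finite_induct)
  case (insert i I)
  moreover have "f \<in> insert i I \<rightarrow> carrier P" using insert.prems by (auto simp: star_subalgebra_def)
  ultimately show ?case by (simp add: star_subalgebra_def Pi_iff)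
qed (auto simp: star_subalgebra_zero finsum_infinite)

end

lemma (in star_homomorphism) image_star_subalgebra: "B.star_subalgebra (\<phi> ` carrier A)"
  unfolding B.star_subalgebra_def
proof (intro conjI ballI allI)
  fix x y assume "x \<in> \<phi> ` carrier A" "y \<in> \<phi> ` carrier A"
  then obtain a b where "a \<in> carrier A" "b \<in> carrier A" "x = \<phi> a" "y = \<phi> b" by blast
  note ab = this
  show "x \<oplus>\<^bsub>B\<^esub> y \<in> \<phi> ` carrier A"
    by (rule image_eqI[of _ _ "a \<oplus>\<^bsub>A\<^esub> b"]) (use ab in auto)
  show "x \<otimes>\<^bsub>B\<^esub> y \<in> \<phi> ` carrier A"
    by (rule image_eqI[of _ _ "a \<otimes>\<^bsub>A\<^esub> b"]) (use ab in auto)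
next
  fix c x assume "x \<in> \<phi> ` carrier A"
  then obtain a where "a \<in> carrier A" "x = \<phi> a" by blast
  then show "c \<odot>\<^bsub>B\<^esub> x \<in> \<phi> ` carrier A"
    by (auto simp: hom_smult A.smult_closed intro!: image_eqI[of _ _ "c \<odot>\<^bsub>A\<^esub> a"])
next
  fix x assume "x \<in> \<phi> ` carrier A"
  then obtain a where "a \<in> carrier A" "x = \<phi> a" by blast
  then show "adj B x \<in> \<phi> ` carrier A"
    by (auto simp: hom_adj A.adj_closed intro!: image_eqI[of _ _ "adj A a"])
next
  show "\<one>\<^bsub>B\<^esub> \<in> \<phi> ` carrier A" by (rule image_eqI[of _ _ "\<one>\<^bsub>A\<^esub>"]) auto
qed auto

context universal_projections
begin

lemma polynomials_in_subalgebra: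
  assumes S: "U.star_subalgebra S" "\<And>g. g \<in> X \<Longrightarrow> gen g \<in> S" and a: "a \<in> carrier F"
  shows "S.\<iota> a \<in> S"
proof -
  interpret \<iota>: star_homomorphism F U S.\<iota> by (rule \<iota>_star_hom)
  from a show ?thesis
    by (induction a rule: free_star_algebra_induct)
      (use S in \<open>auto simp: U_eq[symmetric] U.star_subalgebra_def gen_eq \<iota>.hom_smult \<iota>.hom_adj\<close>)
qed

lemma polynomials_dense:
  assumes "x \<in> carrier U" "0 < \<epsilon>"
  obtains a where "a \<in> carrier F" "nrm U (x \<ominus>\<^bsub>U\<^esub> S.\<iota> a) < \<epsilon>"
  using S.to_completion_dense assms unfolding U_eq by blast

text \<open>A closed *-subalgebra that contains the generators contains the dense set of their
  polynomials. Y may be larger than the set of generators, because a block matrix also has zero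
  entries.\<close>

lemma generated: "Y \<subseteq> carrier U \<Longrightarrow> gen ` X \<subseteq> Y \<Longrightarrow> generated_by U Y"
  unfolding generated_by_def
proof (intro conjI allI impI)
  fix B assume Y: "Y \<subseteq> carrier U" "gen ` X \<subseteq> Y" and D: "closed_star_subalgebra U B \<and> Y \<subseteq> B"
  have B: "Y \<subseteq> B" "subring B U" "\<forall>c. \<forall>x\<in>B. c \<odot>\<^bsub>U\<^esub> x \<in> B" "\<forall>x\<in>B. adj U x \<in> B"
    and lim: "\<forall>x l. (\<forall>n::nat. x n \<in> B) \<and> l \<in> carrier U \<and> (\<lambda>n. nrm U (x n \<ominus>\<^bsub>U\<^esub> l)) \<longlonglongrightarrow> 0 \<longrightarrow> l \<in> B"
    using D[unfolded closed_star_subalgebra_def] by blast+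
  note subset = subringE(1)[OF B(2)]
  have sub: "U.star_subalgebra B"
    using B subringE[OF B(2)] unfolding U.star_subalgebra_def by simp
  have "x \<in> B" if x: "x \<in> carrier U" for x
  proof -
    have "\<exists>a. a \<in> B \<and> nrm U (x \<ominus>\<^bsub>U\<^esub> a) < inverse (real (Suc n))" for n
    proof -
      obtain a where "a \<in> carrier F" "nrm U (x \<ominus>\<^bsub>U\<^esub> S.\<iota> a) < inverse (real (Suc n))"
        using polynomials_dense[OF x, of "inverse (real (Suc n))"] by auto
      moreover from this have "S.\<iota> a \<in> B"
        using Y B by (intro polynomials_in_subalgebra[OF sub]) auto
      ultimately show ?thesis by blast
    qed
    then obtain a where a: "\<And>n. a n \<in> B" "\<And>n. nrm U (x \<ominus>\<^bsub>U\<^esub> a n) < inverse (real (Suc n))"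
      by metis
    have ac: "a n \<in> carrier U" for n using a(1)[of n] subset by blast
    have "U.norm.near sequentially a (\<lambda>n. x)"
      by (rule U.norm.near_bound[OF _ _ _ LIMSEQ_inverse_real_of_nat])
        (use a ac x U.norm.N_diff_commute[OF ac x] in \<open>auto simp del: of_nat_Suc simp: less_imp_le\<close>)
    then have "(\<lambda>n. nrm U (a n \<ominus>\<^bsub>U\<^esub> x)) \<longlonglongrightarrow> 0" by (rule U.norm.nearD)
    then show ?thesis using lim[rule_format, of a x] a(1) x by simp
  qed
  then show "B = carrier U" using subset by auto
qed

end


section \<open>Magic unitaries\<close>

context unital_star_algebra
begin

definition magic_unitary :: "'x set \<Rightarrow> ('x \<Rightarrow> 'x \<Rightarrow> 'a) \<Rightarrow> bool" where
  "magic_unitary X u \<longleftrightarrow> (\<forall>i\<in>X. \<forall>j\<in>X. projection (u i j)) \<and>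
     (\<forall>i\<in>X. (\<Oplus>j\<in>X. u i j) = \<one>) \<and> (\<forall>i\<in>X. (\<Oplus>j\<in>X. u j i) = \<one>)"

definition intertwines :: "'v set \<Rightarrow> 'e set \<Rightarrow> ('v \<Rightarrow> 'e \<Rightarrow> complex) \<Rightarrow>
    ('v \<Rightarrow> 'v \<Rightarrow> 'a) \<Rightarrow> ('e \<Rightarrow> 'e \<Rightarrow> 'a) \<Rightarrow> bool" where
  "intertwines V E M uV uE \<longleftrightarrow>
     (\<forall>v\<in>V. \<forall>f\<in>E. (\<Oplus>e\<in>E. M v e \<odot> uE e f) = (\<Oplus>w\<in>V. M w f \<odot> uV v w))"

lemma magic_unitary_closed: "\<lbrakk>magic_unitary X u; i \<in> X; j \<in> X\<rbrakk> \<Longrightarrow> u i j \<in> carrier P"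
  by (auto simp: magic_unitary_def projectionD)

lemma magic_unitary_cong:
  assumes u: "magic_unitary X u" and eq: "\<And>i j. \<lbrakk>i \<in> X; j \<in> X\<rbrakk> \<Longrightarrow> v i j = u i j"
  shows "magic_unitary X v"
proof -
  have "(\<Oplus>j\<in>X. v i j) = (\<Oplus>j\<in>X. u i j)" "(\<Oplus>j\<in>X. v j i) = (\<Oplus>j\<in>X. u j i)" if "i \<in> X" for i
    using that magic_unitary_closed[OF u] eq by (auto intro!: finsum_cong')
  then show ?thesis using u eq by (simp add: magic_unitary_def)
qed

lemma intertwines_cong:
  assumes M: "intertwines V E M uV uE"
    and c: "\<And>v w. \<lbrakk>v \<in> V; w \<in> V\<rbrakk> \<Longrightarrow> uV v w \<in> carrier P" "\<And>e f. \<lbrakk>e \<in> E; f \<in> E\<rbrakk> \<Longrightarrow> uE e f \<in> carrier P"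
    and eq: "\<And>v w. \<lbrakk>v \<in> V; w \<in> V\<rbrakk> \<Longrightarrow> vV v w = uV v w" "\<And>e f. \<lbrakk>e \<in> E; f \<in> E\<rbrakk> \<Longrightarrow> vE e f = uE e f"
  shows "intertwines V E M vV vE"
  unfolding intertwines_def
proof (intro ballI)
  fix v f assume vf: "v \<in> V" "f \<in> E"
  have "(\<Oplus>e\<in>E. M v e \<odot> vE e f) = (\<Oplus>e\<in>E. M v e \<odot> uE e f)"
    using c eq vf by (intro finsum_cong') (auto simp: smult_closed)
  moreover have "(\<Oplus>w\<in>V. M w f \<odot> vV v w) = (\<Oplus>w\<in>V. M w f \<odot> uV v w)"
    using c eq vf by (intro finsum_cong') (auto simp: smult_closed)
  ultimately show "(\<Oplus>e\<in>E. M v e \<odot> vE e f) = (\<Oplus>w\<in>V. M w f \<odot> vV v w)"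
    using M vf by (simp add: intertwines_def)
qed

lemma magic_unitary_transpose: "magic_unitary X u \<Longrightarrow> magic_unitary X (\<lambda>i j. u j i)"
  by (auto simp: magic_unitary_def)

lemma magic_unitary_relations_closed:
  "\<lbrakk>finite X; \<And>i j. \<lbrakk>i \<in> X; j \<in> X\<rbrakk> \<Longrightarrow> u i j \<in> carrier P\<rbrakk> \<Longrightarrow> magic_unitary_relations P X u \<subseteq> carrier P"
  by (auto simp: magic_unitary_relations_def adj_closed intro!: minus_closed finsum_closed)

lemma intertwiner_relations_closed:
  "\<lbrakk>\<And>v w. \<lbrakk>v \<in> V; w \<in> V\<rbrakk> \<Longrightarrow> uV v w \<in> carrier P; \<And>e f. \<lbrakk>e \<in> E; f \<in> E\<rbrakk> \<Longrightarrow> uE e f \<in> carrier P\<rbrakk> \<Longrightarrow>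
    intertwiner_relations P V E M uV uE \<subseteq> carrier P"
  by (auto simp: intertwiner_relations_def smult_closed intro!: minus_closed finsum_closed)

lemma finsum_Plus:
  assumes "finite V" "finite E" "\<And>v. v \<in> V \<Longrightarrow> f (Inl v) \<in> carrier P" "\<And>e. e \<in> E \<Longrightarrow> f (Inr e) \<in> carrier P"
  shows "(\<Oplus>k\<in>V <+> E. f k) = (\<Oplus>v\<in>V. f (Inl v)) \<oplus> (\<Oplus>e\<in>E. f (Inr e))"
proof -
  have "(\<Oplus>k\<in>V <+> E. f k) = (\<Oplus>k\<in>Inl ` V. f k) \<oplus> (\<Oplus>k\<in>Inr ` E. f k)"
    unfolding Plus_def using assms by (intro finsum_Un_disjoint) auto
  also have "(\<Oplus>k\<in>Inl ` V. f k) = (\<Oplus>v\<in>V. f (Inl v))"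
    using assms by (intro finsum_reindex) auto
  also have "(\<Oplus>k\<in>Inr ` E. f k) = (\<Oplus>e\<in>E. f (Inr e))"
    using assms by (intro finsum_reindex) auto
  finally show ?thesis .
qed

definition block_matrix :: "('v \<Rightarrow> 'v \<Rightarrow> 'a) \<Rightarrow> ('e \<Rightarrow> 'e \<Rightarrow> 'a) \<Rightarrow> 'v + 'e \<Rightarrow> 'v + 'e \<Rightarrow> 'a" where
  "block_matrix uV uE i j =
     (case (i, j) of (Inl v, Inl w) \<Rightarrow> uV v w | (Inr e, Inr f) \<Rightarrow> uE e f | _ \<Rightarrow> \<zero>)"

lemma block_matrix_simps [simp]:
  "block_matrix uV uE (Inl v) (Inl w) = uV v w" "block_matrix uV uE (Inr e) (Inr f) = uE e f"
  "block_matrix uV uE (Inl v) (Inr f) = \<zero>" "block_matrix uV uE (Inr e) (Inl w) = \<zero>"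
  by (simp_all add: block_matrix_def)

lemma magic_unitary_block:
  assumes fin: "finite V" "finite E" and magic: "magic_unitary V uV" "magic_unitary E uE"
  shows "magic_unitary (V <+> E) (block_matrix uV uE)"
proof -
  have "projection \<zero>" by (simp add: projection_def adj_zero)
  then have "projection (block_matrix uV uE i j)" if "i \<in> V <+> E" "j \<in> V <+> E" for i j
    using that magic by (auto simp: magic_unitary_def)
  moreover have "(\<Oplus>j\<in>V <+> E. block_matrix uV uE i j) = \<one>" "(\<Oplus>j\<in>V <+> E. block_matrix uV uE j i) = \<one>"
    if "i \<in> V <+> E" for i
    using that fin magic magic_unitary_closed[OF magic(1)] magic_unitary_closed[OF magic(2)]
    by (auto simp: finsum_Plus finsum_zero magic_unitary_def)
  ultimately show ?thesis by (simp add: magic_unitary_def)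
qed

end

context star_homomorphism
begin

text \<open>Used in both directions: for the canonical map into the universal algebra it shows that
  the generators form a magic unitary, and for maps into other algebras it verifies the relations
  needed for the universal property.\<close>

lemma magic_relations_iff:
  assumes "finite X" "\<And>i j. \<lbrakk>i \<in> X; j \<in> X\<rbrakk> \<Longrightarrow> u i j \<in> carrier A"
  shows "(\<forall>r\<in>magic_unitary_relations A X u. \<phi> r = \<zero>\<^bsub>B\<^esub>) \<longleftrightarrow> B.magic_unitary X (\<lambda>i j. \<phi> (u i j))"
proof -
  have 1: "\<phi> (u i j \<otimes>\<^bsub>A\<^esub> u i j \<ominus>\<^bsub>A\<^esub> u i j) = \<zero>\<^bsub>B\<^esub> \<longleftrightarrow> \<phi> (u i j) \<otimes>\<^bsub>B\<^esub> \<phi> (u i j) = \<phi> (u i j)"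
    "\<phi> (adj A (u i j) \<ominus>\<^bsub>A\<^esub> u i j) = \<zero>\<^bsub>B\<^esub> \<longleftrightarrow> adj B (\<phi> (u i j)) = \<phi> (u i j)" if "i \<in> X" "j \<in> X" for i j
    using assms(2)[OF that]
    by (simp_all add: hom_diff hom_adj A.adj_closed B.adj_closed B.diff_eq_zero_iff)
  have 2: "\<phi> ((\<Oplus>\<^bsub>A\<^esub>j\<in>X. u i j) \<ominus>\<^bsub>A\<^esub> \<one>\<^bsub>A\<^esub>) = \<zero>\<^bsub>B\<^esub> \<longleftrightarrow> (\<Oplus>\<^bsub>B\<^esub>j\<in>X. \<phi> (u i j)) = \<one>\<^bsub>B\<^esub>"
    "\<phi> ((\<Oplus>\<^bsub>A\<^esub>j\<in>X. u j i) \<ominus>\<^bsub>A\<^esub> \<one>\<^bsub>A\<^esub>) = \<zero>\<^bsub>B\<^esub> \<longleftrightarrow> (\<Oplus>\<^bsub>B\<^esub>j\<in>X. \<phi> (u j i)) = \<one>\<^bsub>B\<^esub>" if "i \<in> X" for i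
    using assms(2) that
    by (simp_all add: hom_diff comp_def A.finsum_closed B.finsum_closed Pi_iff B.diff_eq_zero_iff)
  have 3: "(\<forall>r\<in>{f i j | i j. i \<in> X \<and> j \<in> X}. Q r) \<longleftrightarrow> (\<forall>i\<in>X. \<forall>j\<in>X. Q (f i j))"
    "(\<forall>r\<in>{h i | i. i \<in> X}. Q r) \<longleftrightarrow> (\<forall>i\<in>X. Q (h i))" for f h and Q :: "'a \<Rightarrow> bool"
    by blast+
  have "(\<forall>r\<in>magic_unitary_relations A X u. \<phi> r = \<zero>\<^bsub>B\<^esub>) \<longleftrightarrow>
      (\<forall>i\<in>X. \<forall>j\<in>X. \<phi> (u i j) \<otimes>\<^bsub>B\<^esub> \<phi> (u i j) = \<phi> (u i j)) \<and> (\<forall>i\<in>X. \<forall>j\<in>X. adj B (\<phi> (u i j)) = \<phi> (u i j)) \<and>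
      (\<forall>i\<in>X. (\<Oplus>\<^bsub>B\<^esub>j\<in>X. \<phi> (u i j)) = \<one>\<^bsub>B\<^esub>) \<and> (\<forall>i\<in>X. (\<Oplus>\<^bsub>B\<^esub>j\<in>X. \<phi> (u j i)) = \<one>\<^bsub>B\<^esub>)"
    unfolding magic_unitary_relations_def ball_Un 3 by (simp add: 1 2 cong: ball_cong)
  then show ?thesis
    unfolding B.magic_unitary_def B.projection_def using assms(2) by auto
qed

lemma intertwiner_relations_iff:
  assumes "finite V" "finite E" "\<And>v w. \<lbrakk>v \<in> V; w \<in> V\<rbrakk> \<Longrightarrow> uV v w \<in> carrier A"
    "\<And>e f. \<lbrakk>e \<in> E; f \<in> E\<rbrakk> \<Longrightarrow> uE e f \<in> carrier A"
  shows "(\<forall>r\<in>intertwiner_relations A V E M uV uE. \<phi> r = \<zero>\<^bsub>B\<^esub>) \<longleftrightarrow>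
    B.intertwines V E M (\<lambda>v w. \<phi> (uV v w)) (\<lambda>e f. \<phi> (uE e f))"
proof -
  have "\<phi> ((\<Oplus>\<^bsub>A\<^esub>e\<in>E. M v e \<odot>\<^bsub>A\<^esub> uE e f) \<ominus>\<^bsub>A\<^esub> (\<Oplus>\<^bsub>A\<^esub>w\<in>V. M w f \<odot>\<^bsub>A\<^esub> uV v w)) = \<zero>\<^bsub>B\<^esub> \<longleftrightarrow>
      (\<Oplus>\<^bsub>B\<^esub>e\<in>E. M v e \<odot>\<^bsub>B\<^esub> \<phi> (uE e f)) = (\<Oplus>\<^bsub>B\<^esub>w\<in>V. M w f \<odot>\<^bsub>B\<^esub> \<phi> (uV v w))"
    if "v \<in> V" "f \<in> E" for v f
  proof -
    have eq: "\<phi> (\<Oplus>\<^bsub>A\<^esub>e\<in>E. M v e \<odot>\<^bsub>A\<^esub> uE e f) = (\<Oplus>\<^bsub>B\<^esub>e\<in>E. M v e \<odot>\<^bsub>B\<^esub> \<phi> (uE e f))"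
      "\<phi> (\<Oplus>\<^bsub>A\<^esub>w\<in>V. M w f \<odot>\<^bsub>A\<^esub> uV v w) = (\<Oplus>\<^bsub>B\<^esub>w\<in>V. M w f \<odot>\<^bsub>B\<^esub> \<phi> (uV v w))"
      using assms that
      by (auto simp: hom_finsum A.smult_closed B.smult_closed hom_smult intro!: B.finsum_cong')
    have c: "(\<Oplus>\<^bsub>A\<^esub>e\<in>E. M v e \<odot>\<^bsub>A\<^esub> uE e f) \<in> carrier A" "(\<Oplus>\<^bsub>A\<^esub>w\<in>V. M w f \<odot>\<^bsub>A\<^esub> uV v w) \<in> carrier A"
      using assms that by (auto simp: A.smult_closed intro!: A.finsum_closed)
    show ?thesis
      unfolding hom_diff[OF c] eq[symmetric]
      by (rule B.diff_eq_zero_iff[OF hom_closed[OF c(1)] hom_closed[OF c(2)]])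
  qed
  then show ?thesis
    unfolding intertwiner_relations_def B.intertwines_def by blast
qed

end

context unital_cstar_algebra
begin

lemma magic_unitary_orthogonal:
  assumes "finite X" "magic_unitary X u" "i \<in> X" "j \<in> X" "k \<in> X" "j \<noteq> k"
  shows "u i j \<otimes> u i k = \<zero>" "u j i \<otimes> u k i = \<zero>"
  using orthogonal_of_sum_eq_one[of X "\<lambda>j. u i j" j k] orthogonal_of_sum_eq_one[of X "\<lambda>j. u j i" j k] assms
  by (auto simp: magic_unitary_def)

text \<open>Distinct entries of one column are orthogonal, so the terms of an off-diagonal entry of
  the product of u with its transpose vanish; a diagonal entry is a row sum of idempotents. The
  other product is the same statement for the transpose.\<close>

lemma magic_unitary_inverse:
  assumes X: "finite X" and u: "magic_unitary X u"
  shows "inverse_matrices A X u (\<lambda>i j. u j i)"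
proof -
  have *: "(\<Oplus>k\<in>X. u i k \<otimes> u j k) = (if i = j then \<one> else \<zero>)"
    if "magic_unitary X u" "i \<in> X" "j \<in> X" for u i j
  proof -
    have "(\<Oplus>k\<in>X. u i k \<otimes> u j k) = (\<Oplus>k\<in>X. if i = j then u i k else \<zero>)"
      using that magic_unitary_orthogonal(2)[OF X that(1) _ that(2,3)]
      by (intro finsum_cong') (auto simp: magic_unitary_closed, auto simp: magic_unitary_def projectionD)
    then show ?thesis using that by (auto simp: magic_unitary_def finsum_zero)
  qed
  show ?thesis
    unfolding inverse_matrices_def
    using *[OF u] *[OF magic_unitary_transpose[OF u]] by blast
qed

end

text \<open>The entries are self-adjoint, so the adjoint matrix is the transpose and the entrywise
  adjoint is u itself; a single pair of inverse matrices settles both unitarity and the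
  invertibility condition.\<close>

lemma magic_compact_matrix_quantum_group:
  assumes A: "unital_cstar_algebra (func_alg G)" and I: "finite (index_set G)"
    and u: "unital_star_algebra.magic_unitary (func_alg G) (index_set G) (fund G)"
    and gen: "generated_by (func_alg G) {fund G i j | i j. i \<in> index_set G \<and> j \<in> index_set G}"
    and \<Delta>: "comultiplication G \<Delta>"
  shows "compact_matrix_quantum_group G"
proof -
  interpret unital_cstar_algebra "func_alg G" by fact
  have adj: "adj (func_alg G) (fund G i j) = fund G i j" if "i \<in> index_set G" "j \<in> index_set G" for i j
    using u that by (auto simp: magic_unitary_def projectionD)
  note inv = magic_unitary_inverse[OF I u]
  have cong: "(\<Oplus>\<^bsub>func_alg G\<^esub>k\<in>index_set G. f k) = (\<Oplus>\<^bsub>func_alg G\<^esub>k\<in>index_set G. g k)"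
    if "\<And>k. k \<in> index_set G \<Longrightarrow> f k = g k" "\<And>k. k \<in> index_set G \<Longrightarrow> g k \<in> carrier (func_alg G)" for f g
    using that by (intro finsum_cong') auto
  note c = magic_unitary_closed[OF u]
  have "inverse_matrices (func_alg G) (index_set G) (fund G) (\<lambda>i j. adj (func_alg G) (fund G j i))"
    using inv unfolding inverse_matrices_def
    by (auto simp: adj c cong[of "\<lambda>k. fund G _ k \<otimes>\<^bsub>func_alg G\<^esub> adj (func_alg G) (fund G _ k)" "\<lambda>k. fund G _ k \<otimes>\<^bsub>func_alg G\<^esub> fund G _ k"]
      cong[of "\<lambda>k. adj (func_alg G) (fund G k _) \<otimes>\<^bsub>func_alg G\<^esub> fund G k _" "\<lambda>k. fund G k _ \<otimes>\<^bsub>func_alg G\<^esub> fund G k _"])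
  moreover have "inverse_matrices (func_alg G) (index_set G) (\<lambda>i j. adj (func_alg G) (fund G i j)) (\<lambda>i j. fund G j i)"
    using inv unfolding inverse_matrices_def
    by (auto simp: adj c cong[of "\<lambda>k. adj (func_alg G) (fund G _ k) \<otimes>\<^bsub>func_alg G\<^esub> fund G _ k" "\<lambda>k. fund G _ k \<otimes>\<^bsub>func_alg G\<^esub> fund G _ k"]
      cong[of "\<lambda>k. fund G k _ \<otimes>\<^bsub>func_alg G\<^esub> adj (func_alg G) (fund G k _)" "\<lambda>k. fund G k _ \<otimes>\<^bsub>func_alg G\<^esub> fund G k _"])
  ultimately show ?thesis
    unfolding compact_matrix_quantum_group_def Let_def
    using A I gen \<Delta> c by (intro conjI exI[of _ "\<lambda>i j. fund G j i"] exI[of _ \<Delta>]) auto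
qed

context cstar_tensor
begin

definition convolution :: "'x set \<Rightarrow> ('x \<Rightarrow> 'x \<Rightarrow> 'a) \<Rightarrow> ('x \<Rightarrow> 'x \<Rightarrow> 'b) \<Rightarrow>
    'x \<Rightarrow> 'x \<Rightarrow> (nat \<Rightarrow> ('a \<times> 'b \<Rightarrow>\<^sub>0 complex)) set" where
  "convolution X u v i j = (\<Oplus>\<^bsub>min_tensor A B\<^esub>k\<in>X. E (u i k) (v k j))"

text \<open>In the square of an entry the mixed terms vanish by orthogonality in a row of u. Row and
  column sums are evaluated by interchanging summations, which produces 1 in one tensor factor first
  and in the other one next.\<close>

lemma magic_unitary_convolution:
  assumes X: "finite X" and u: "A.magic_unitary X u" and v: "B.magic_unitary X v"
  shows "T.magic_unitary X (convolution X u v)"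
proof -
  let ?T = "min_tensor A B"
  note c = A.magic_unitary_closed[OF u] B.magic_unitary_closed[OF v]
  have conv: "convolution X u v i j \<in> carrier ?T" if "i \<in> X" "j \<in> X" for i j
    unfolding convolution_def using that c by (intro T.finsum_closed) (auto simp: E_closed)
  have idem: "convolution X u v i j \<otimes>\<^bsub>?T\<^esub> convolution X u v i j = convolution X u v i j" if ij: "i \<in> X" "j \<in> X" for i j
  proof -
    have "convolution X u v i j \<otimes>\<^bsub>?T\<^esub> convolution X u v i j =
        (\<Oplus>\<^bsub>?T\<^esub>k\<in>X. \<Oplus>\<^bsub>?T\<^esub>l\<in>X. E (u i k) (v k j) \<otimes>\<^bsub>?T\<^esub> E (u i l) (v l j))"
      unfolding convolution_def using ij X c
      by (intro T.finsum_smult_mult_finsum_smult) (auto simp: E_closed)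
    also have "\<dots> = (\<Oplus>\<^bsub>?T\<^esub>k\<in>X. E (u i k) (v k j))"
    proof (rule T.finsum_cong')
      fix k assume k: "k \<in> X"
      have off: "E (u i k) (v k j) \<otimes>\<^bsub>?T\<^esub> E (u i l) (v l j) = \<zero>\<^bsub>?T\<^esub>" if "l \<in> X - {k}" for l
        using that k ij c A.magic_unitary_orthogonal(1)[OF X u ij(1) k, of l]
        by (auto simp: E_mult E_zero_left)
      have "(\<Oplus>\<^bsub>?T\<^esub>l\<in>X. E (u i k) (v k j) \<otimes>\<^bsub>?T\<^esub> E (u i l) (v l j)) = E (u i k) (v k j) \<otimes>\<^bsub>?T\<^esub> E (u i k) (v k j)"
        using X k ij c off by (intro T.finsum_single) (auto simp: E_closed)
      then show "(\<Oplus>\<^bsub>?T\<^esub>l\<in>X. E (u i k) (v k j) \<otimes>\<^bsub>?T\<^esub> E (u i l) (v l j)) = E (u i k) (v k j)"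
        using k ij u v c by (simp add: E_mult A.magic_unitary_def B.magic_unitary_def A.projectionD B.projectionD)
    qed (use ij c in \<open>auto simp: E_closed\<close>)
    finally show ?thesis by (simp add: convolution_def)
  qed
  have adj: "adj ?T (convolution X u v i j) = convolution X u v i j" if ij: "i \<in> X" "j \<in> X" for i j
  proof -
    have "adj ?T (convolution X u v i j) = (\<Oplus>\<^bsub>?T\<^esub>k\<in>X. adj ?T (E (u i k) (v k j)))"
      unfolding convolution_def using ij X c by (intro T.star.adj_finsum) (auto simp: E_closed)
    also have "\<dots> = convolution X u v i j"
      unfolding convolution_def using ij c u v
      by (intro T.finsum_cong') (auto simp: E_closed E_adj A.magic_unitary_def B.magic_unitary_def A.projectionD B.projectionD)
    finally show ?thesis .
  qed
  have "(\<Oplus>\<^bsub>?T\<^esub>j\<in>X. convolution X u v i j) = \<one>\<^bsub>?T\<^esub>" if i: "i \<in> X" for i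
  proof -
    have "(\<Oplus>\<^bsub>?T\<^esub>j\<in>X. convolution X u v i j) = (\<Oplus>\<^bsub>?T\<^esub>k\<in>X. \<Oplus>\<^bsub>?T\<^esub>j\<in>X. E (u i k) (v k j))"
      unfolding convolution_def using i X c by (intro T.finsum_finsum_swap) (auto simp: E_closed)
    also have "\<dots> = (\<Oplus>\<^bsub>?T\<^esub>k\<in>X. E (u i k) \<one>\<^bsub>B\<^esub>)"
      using i X c v by (intro T.finsum_cong') (auto simp: E_finsum_right[symmetric] E_closed B.magic_unitary_def)
    also have "\<dots> = \<one>\<^bsub>?T\<^esub>"
      using i X c u by (simp add: E_finsum_left[symmetric] A.magic_unitary_def E_one)
    finally show ?thesis .
  qed
  moreover have "(\<Oplus>\<^bsub>?T\<^esub>i\<in>X. convolution X u v i j) = \<one>\<^bsub>?T\<^esub>" if j: "j \<in> X" for j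
  proof -
    have "(\<Oplus>\<^bsub>?T\<^esub>i\<in>X. convolution X u v i j) = (\<Oplus>\<^bsub>?T\<^esub>k\<in>X. \<Oplus>\<^bsub>?T\<^esub>i\<in>X. E (u i k) (v k j))"
      unfolding convolution_def using j X c by (intro T.finsum_finsum_swap) (auto simp: E_closed)
    also have "\<dots> = (\<Oplus>\<^bsub>?T\<^esub>k\<in>X. E \<one>\<^bsub>A\<^esub> (v k j))"
      using j X c u by (intro T.finsum_cong') (auto simp: E_finsum_left[symmetric] E_closed A.magic_unitary_def)
    also have "\<dots> = \<one>\<^bsub>?T\<^esub>"
      using j X c v by (simp add: E_finsum_right[symmetric] B.magic_unitary_def E_one)
    finally show ?thesis .
  qed
  ultimately show ?thesis
    using conv idem adj by (simp add: T.magic_unitary_def T.projection_def)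
qed

text \<open>The scalar matrix M is moved through both factors: it is exchanged with u in the left
  factor, its coefficients are passed across the tensor sign, and it is exchanged with v in the
  right factor.\<close>

lemma intertwines_convolution:
  assumes fin: "finite V" "finite W"
    and u: "\<And>i j. \<lbrakk>i \<in> V; j \<in> V\<rbrakk> \<Longrightarrow> uV i j \<in> carrier A" "\<And>i j. \<lbrakk>i \<in> W; j \<in> W\<rbrakk> \<Longrightarrow> uW i j \<in> carrier A"
    and v: "\<And>i j. \<lbrakk>i \<in> V; j \<in> V\<rbrakk> \<Longrightarrow> vV i j \<in> carrier B" "\<And>i j. \<lbrakk>i \<in> W; j \<in> W\<rbrakk> \<Longrightarrow> vW i j \<in> carrier B"
    and M: "A.intertwines V W M uV uW" "B.intertwines V W M vV vW"
  shows "T.intertwines V W M (convolution V uV vV) (convolution W uW vW)"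
  unfolding T.intertwines_def
proof (intro ballI)
  let ?T = "min_tensor A B"
  fix x f assume xf: "x \<in> V" "f \<in> W"
  have "(\<Oplus>\<^bsub>?T\<^esub>e\<in>W. M x e \<odot>\<^bsub>?T\<^esub> convolution W uW vW e f) = (\<Oplus>\<^bsub>?T\<^esub>e\<in>W. \<Oplus>\<^bsub>?T\<^esub>g\<in>W. E (M x e \<odot>\<^bsub>A\<^esub> uW e g) (vW g f))"
  proof (rule T.finsum_cong')
    fix e assume e: "e \<in> W"
    have "M x e \<odot>\<^bsub>?T\<^esub> convolution W uW vW e f = (\<Oplus>\<^bsub>?T\<^esub>g\<in>W. M x e \<odot>\<^bsub>?T\<^esub> E (uW e g) (vW g f))"
      unfolding convolution_def using fin u v xf e by (intro T.star.smult_finsum) (auto simp: E_closed)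
    also have "\<dots> = (\<Oplus>\<^bsub>?T\<^esub>g\<in>W. E (M x e \<odot>\<^bsub>A\<^esub> uW e g) (vW g f))"
      using u v xf e by (intro T.finsum_cong') (auto simp: E_smult_left E_closed A.smult_closed T.smult_closed)
    finally show "M x e \<odot>\<^bsub>?T\<^esub> convolution W uW vW e f = (\<Oplus>\<^bsub>?T\<^esub>g\<in>W. E (M x e \<odot>\<^bsub>A\<^esub> uW e g) (vW g f))" .
  qed (use u v xf in \<open>auto intro!: T.finsum_closed simp: E_closed A.smult_closed\<close>)
  also have "\<dots> = (\<Oplus>\<^bsub>?T\<^esub>g\<in>W. \<Oplus>\<^bsub>?T\<^esub>e\<in>W. E (M x e \<odot>\<^bsub>A\<^esub> uW e g) (vW g f))"
    using fin u v xf by (intro T.finsum_finsum_swap) (auto simp: E_closed A.smult_closed)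
  also have "\<dots> = (\<Oplus>\<^bsub>?T\<^esub>g\<in>W. E (\<Oplus>\<^bsub>A\<^esub>e\<in>W. M x e \<odot>\<^bsub>A\<^esub> uW e g) (vW g f))"
    using fin u v xf
    by (intro T.finsum_cong') (auto simp: E_finsum_left E_closed A.smult_closed intro!: A.finsum_closed E_closed)
  also have "\<dots> = (\<Oplus>\<^bsub>?T\<^esub>g\<in>W. \<Oplus>\<^bsub>?T\<^esub>w\<in>V. E (M w g \<odot>\<^bsub>A\<^esub> uV x w) (vW g f))"
  proof (rule T.finsum_cong')
    fix g assume g: "g \<in> W"
    then have "(\<Oplus>\<^bsub>A\<^esub>e\<in>W. M x e \<odot>\<^bsub>A\<^esub> uW e g) = (\<Oplus>\<^bsub>A\<^esub>w\<in>V. M w g \<odot>\<^bsub>A\<^esub> uV x w)"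
      using M(1) xf by (simp add: A.intertwines_def)
    then show "E (\<Oplus>\<^bsub>A\<^esub>e\<in>W. M x e \<odot>\<^bsub>A\<^esub> uW e g) (vW g f) = (\<Oplus>\<^bsub>?T\<^esub>w\<in>V. E (M w g \<odot>\<^bsub>A\<^esub> uV x w) (vW g f))"
      using g fin u v xf by (simp add: E_finsum_left A.smult_closed)
  qed (use u v xf in \<open>auto intro!: T.finsum_closed simp: E_closed A.smult_closed\<close>)
  also have "\<dots> = (\<Oplus>\<^bsub>?T\<^esub>w\<in>V. \<Oplus>\<^bsub>?T\<^esub>g\<in>W. E (M w g \<odot>\<^bsub>A\<^esub> uV x w) (vW g f))"
    using fin u v xf by (intro T.finsum_finsum_swap) (auto simp: E_closed A.smult_closed)
  also have "\<dots> = (\<Oplus>\<^bsub>?T\<^esub>w\<in>V. \<Oplus>\<^bsub>?T\<^esub>g\<in>W. E (uV x w) (M w g \<odot>\<^bsub>B\<^esub> vW g f))"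
    using fin u v xf by (intro T.finsum_cong' refl)
      (auto simp: E_closed B.smult_closed T.smult_closed E_smult_left E_smult_right intro!: T.finsum_closed)
  also have "\<dots> = (\<Oplus>\<^bsub>?T\<^esub>w\<in>V. E (uV x w) (\<Oplus>\<^bsub>B\<^esub>g\<in>W. M w g \<odot>\<^bsub>B\<^esub> vW g f))"
    using fin u v xf
    by (intro T.finsum_cong') (auto simp: E_finsum_right E_closed B.smult_closed intro!: B.finsum_closed E_closed)
  also have "\<dots> = (\<Oplus>\<^bsub>?T\<^esub>w\<in>V. \<Oplus>\<^bsub>?T\<^esub>z\<in>V. E (uV x w) (M z f \<odot>\<^bsub>B\<^esub> vV w z))"
  proof (rule T.finsum_cong')
    fix w assume w: "w \<in> V"
    then have "(\<Oplus>\<^bsub>B\<^esub>g\<in>W. M w g \<odot>\<^bsub>B\<^esub> vW g f) = (\<Oplus>\<^bsub>B\<^esub>z\<in>V. M z f \<odot>\<^bsub>B\<^esub> vV w z)"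
      using M(2) xf by (simp add: B.intertwines_def)
    then show "E (uV x w) (\<Oplus>\<^bsub>B\<^esub>g\<in>W. M w g \<odot>\<^bsub>B\<^esub> vW g f) = (\<Oplus>\<^bsub>?T\<^esub>z\<in>V. E (uV x w) (M z f \<odot>\<^bsub>B\<^esub> vV w z))"
      using w fin u v xf by (simp add: E_finsum_right B.smult_closed)
  qed (use u v xf in \<open>auto intro!: T.finsum_closed simp: E_closed B.smult_closed\<close>)
  also have "\<dots> = (\<Oplus>\<^bsub>?T\<^esub>z\<in>V. \<Oplus>\<^bsub>?T\<^esub>w\<in>V. E (uV x w) (M z f \<odot>\<^bsub>B\<^esub> vV w z))"
    using fin u v xf by (intro T.finsum_finsum_swap) (auto simp: E_closed B.smult_closed)
  also have "\<dots> = (\<Oplus>\<^bsub>?T\<^esub>z\<in>V. M z f \<odot>\<^bsub>?T\<^esub> convolution V uV vV x z)"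
  proof (rule T.finsum_cong')
    fix z assume z: "z \<in> V"
    have "M z f \<odot>\<^bsub>?T\<^esub> convolution V uV vV x z = (\<Oplus>\<^bsub>?T\<^esub>w\<in>V. M z f \<odot>\<^bsub>?T\<^esub> E (uV x w) (vV w z))"
      unfolding convolution_def using fin u v xf z by (intro T.star.smult_finsum) (auto simp: E_closed)
    also have "\<dots> = (\<Oplus>\<^bsub>?T\<^esub>w\<in>V. E (uV x w) (M z f \<odot>\<^bsub>B\<^esub> vV w z))"
      using u v xf z by (intro T.finsum_cong') (auto simp: E_smult_right E_closed B.smult_closed T.smult_closed)
    finally show "(\<Oplus>\<^bsub>?T\<^esub>w\<in>V. E (uV x w) (M z f \<odot>\<^bsub>B\<^esub> vV w z)) = M z f \<odot>\<^bsub>?T\<^esub> convolution V uV vV x z" by simp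
  qed (use u v xf in \<open>auto intro!: T.finsum_closed T.smult_closed simp: convolution_def E_closed\<close>)
  finally show "(\<Oplus>\<^bsub>?T\<^esub>e\<in>W. M x e \<odot>\<^bsub>?T\<^esub> convolution W uW vW e f) = (\<Oplus>\<^bsub>?T\<^esub>w\<in>V. M w f \<odot>\<^bsub>?T\<^esub> convolution V uV vV x w)" .
qed

end


section \<open>Quantum permutation groups\<close>

lemma contractive_comp:
  assumes "star_homomorphism A B f" "contractive A B f" "contractive B C g"
  shows "contractive A C (\<lambda>x. g (f x))"
proof -
  interpret star_homomorphism A B f by fact
  have "nrm C (g (f x)) \<le> nrm A x" if "x \<in> carrier A" for x
    using assms(2,3) that hom_closed[OF that] unfolding contractive_def by (meson order_trans)
  then show ?thesis by (simp add: contractive_def)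
qed

lemma star_homomorphism_comp:
  "\<lbrakk>star_homomorphism A B f; star_homomorphism B C g\<rbrakk> \<Longrightarrow> star_homomorphism A C (\<lambda>x. g (f x))"
  using star_hom_comp[of A B f C g]
  by (simp add: star_homomorphism_def star_homomorphism_axioms_def)

abbreviation permutation_relations :: "'x set \<Rightarrow> ((('x \<times> 'x) \<times> bool) list \<Rightarrow>\<^sub>0 complex) set" where
  "permutation_relations X \<equiv>
     magic_unitary_relations (free_star_algebra (X \<times> X)) X (\<lambda>i j. free_gen (i, j))"

locale quantum_permutations =
  fixes X :: "'x set"
  assumes finite_X: "finite X"
begin

sublocale universal_projections "X \<times> X" "permutation_relations X"
proof
  interpret F: unital_star_algebra "free_star_algebra (X \<times> X)" by (rule free_star_algebra)
  show "permutation_relations X \<subseteq> carrier (free_star_algebra (X \<times> X))"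
    using finite_X by (intro F.magic_unitary_relations_closed free_gen_closed) auto
next
  let ?F = "free_star_algebra (X \<times> X)"
  fix g assume "g \<in> X \<times> X"
  then obtain i j where g: "i \<in> X" "j \<in> X" "g = (i, j)" by blast
  show "free_gen g \<otimes>\<^bsub>?F\<^esub> free_gen g \<ominus>\<^bsub>?F\<^esub> free_gen g \<in> permutation_relations X"
    "adj ?F (free_gen g) \<ominus>\<^bsub>?F\<^esub> free_gen g \<in> permutation_relations X"
    by (simp only: magic_unitary_relations_def, use g in blast)+
qed

abbreviation G where "G \<equiv> quantum_permutation_group X"

lemma group_simps: "func_alg G = U" "index_set G = X" "fund G = (\<lambda>i j. gen (i, j))"
  by (simp_all add: quantum_permutation_group_def Let_def)

lemma magic: "U.magic_unitary X (\<lambda>i j. gen (i, j))"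
proof -
  interpret \<iota>: star_homomorphism F U S.\<iota> by (rule \<iota>_star_hom)
  show ?thesis
    unfolding gen_eq
    by (rule \<iota>.magic_relations_iff[THEN iffD1, OF finite_X _ ballI[OF rel_zero]]) (simp_all add: free_gen_closed)
qed

lemma universal_magic:
  assumes B: "unital_cstar_algebra B" and x: "unital_star_algebra.magic_unitary B X x"
  shows "\<exists>\<phi>. star_homomorphism U B \<phi> \<and> contractive U B \<phi> \<and> (\<forall>i\<in>X. \<forall>j\<in>X. \<phi> (gen (i, j)) = x i j)"
proof -
  interpret B: unital_cstar_algebra B by (rule B)
  have "\<exists>\<phi>. star_homomorphism U B \<phi> \<and> contractive U B \<phi> \<and> (\<forall>g\<in>X \<times> X. \<phi> (gen g) = x (fst g) (snd g))"
  proof (rule universal_property[OF B, of "\<lambda>g. x (fst g) (snd g)"])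
    show "x (fst g) (snd g) \<in> carrier B" if "g \<in> X \<times> X" for g
      using that B.magic_unitary_closed[OF x] by auto
    fix \<epsilon> assume \<epsilon>: "star_homomorphism F B \<epsilon>" "\<And>g. g \<in> X \<times> X \<Longrightarrow> \<epsilon> (free_gen g) = x (fst g) (snd g)"
    interpret \<epsilon>: star_homomorphism F B \<epsilon> by (rule \<epsilon>(1))
    have "B.magic_unitary X (\<lambda>i j. \<epsilon> (free_gen (i, j)))"
      by (rule B.magic_unitary_cong[OF x]) (simp add: \<epsilon>(2))
    then show "\<forall>r\<in>permutation_relations X. \<epsilon> r = \<zero>\<^bsub>B\<^esub>"
      by (subst \<epsilon>.magic_relations_iff[OF finite_X]) (simp_all add: free_gen_closed)
  qed
  then show ?thesis by simp
qed

sublocale T: cstar_tensor U U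
  by unfold_locales

lemma comultiplication:
  "\<exists>\<Delta>. star_homomorphism U (min_tensor U U) \<Delta> \<and> contractive U (min_tensor U U) \<Delta> \<and>
    (\<forall>i\<in>X. \<forall>j\<in>X. \<Delta> (gen (i, j)) = T.convolution X (\<lambda>i j. gen (i, j)) (\<lambda>i j. gen (i, j)) i j) \<and>
    comultiplication G \<Delta>"
proof -
  obtain \<Delta> where \<Delta>: "star_homomorphism U (min_tensor U U) \<Delta>" "contractive U (min_tensor U U) \<Delta>"
    "\<forall>i\<in>X. \<forall>j\<in>X. \<Delta> (gen (i, j)) = T.convolution X (\<lambda>i j. gen (i, j)) (\<lambda>i j. gen (i, j)) i j"
    using universal_magic[OF T.min_tensor_cstar_algebra T.magic_unitary_convolution[OF finite_X magic magic]]
    by blast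
  moreover have "comultiplication G \<Delta>"
    using \<Delta>(3) star_homomorphism.star_hom[OF \<Delta>(1)]
    by (simp add: comultiplication_def Let_def group_simps T.convolution_def)
  ultimately show ?thesis by blast
qed

lemma compact_quantum_group: "compact_matrix_quantum_group G"
proof -
  obtain \<Delta> where "comultiplication G \<Delta>"
    using comultiplication by blast
  then show ?thesis
  proof (rule magic_compact_matrix_quantum_group[rotated -1])
    show "generated_by (func_alg G) {fund G i j | i j. i \<in> index_set G \<and> j \<in> index_set G}"
      unfolding group_simps
    proof (rule generated)
      show "{gen (i, j) | i j. i \<in> X \<and> j \<in> X} \<subseteq> carrier U"
        using gen_closed by blast
    qed blast
  qed (simp_all add: group_simps finite_X magic U.unital_cstar_algebra_axioms)
qed

end


section \<open>Quantum automorphism groups of hypergraphs\<close>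

locale quantum_automorphisms =
  fixes \<Gamma> :: "('v, 'e) pre_hypergraph"
  assumes hypergraph: "hypergraph \<Gamma>"
begin

abbreviation V where "V \<equiv> verts \<Gamma>"
abbreviation E where "E \<equiv> edges \<Gamma>"

lemma finite_VE: "finite V" "finite E"
  using hypergraph by (simp_all only: hypergraph_def)

abbreviation letters where "letters \<equiv> (V \<times> V) <+> (E \<times> E)"

lemma relations_eq: "quantum_automorphism_relations \<Gamma> =
    magic_unitary_relations (free_star_algebra letters) V (\<lambda>v w. free_gen (Inl (v, w))) \<union>
    magic_unitary_relations (free_star_algebra letters) E (\<lambda>e f. free_gen (Inr (e, f))) \<union>
    intertwiner_relations (free_star_algebra letters) V E (src_incidence \<Gamma>)
      (\<lambda>v w. free_gen (Inl (v, w))) (\<lambda>e f. free_gen (Inr (e, f))) \<union>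
    intertwiner_relations (free_star_algebra letters) V E (rng_incidence \<Gamma>)
      (\<lambda>v w. free_gen (Inl (v, w))) (\<lambda>e f. free_gen (Inr (e, f)))"
  unfolding quantum_automorphism_relations_def Let_def ..

lemma universal_relations: "universal_projections letters (quantum_automorphism_relations \<Gamma>)"
proof (rule universal_projections.intro)
  interpret F: unital_star_algebra "free_star_algebra letters" by (rule free_star_algebra)
  show "quantum_automorphism_relations \<Gamma> \<subseteq> carrier (free_star_algebra letters)"
  proof -
    have c: "free_gen (Inl (v, w)) \<in> carrier (free_star_algebra letters)" if "v \<in> V" "w \<in> V" for v w
      by (intro free_gen_closed InlI SigmaI that)
    have d: "free_gen (Inr (e, f)) \<in> carrier (free_star_algebra letters)" if "e \<in> E" "f \<in> E" for e f
      by (intro free_gen_closed InrI SigmaI that)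
    show ?thesis
      unfolding relations_eq Un_subset_iff
      by (intro conjI F.magic_unitary_relations_closed[OF finite_VE(1) c]
        F.magic_unitary_relations_closed[OF finite_VE(2) d] F.intertwiner_relations_closed[OF c d])
  qed
next
  let ?F = "free_star_algebra letters"
  have V: "free_gen (Inl (v, w)) \<otimes>\<^bsub>?F\<^esub> free_gen (Inl (v, w)) \<ominus>\<^bsub>?F\<^esub> free_gen (Inl (v, w)) \<in> quantum_automorphism_relations \<Gamma>"
    "adj ?F (free_gen (Inl (v, w))) \<ominus>\<^bsub>?F\<^esub> free_gen (Inl (v, w)) \<in> quantum_automorphism_relations \<Gamma>"
    if "v \<in> V" "w \<in> V" for v w
    unfolding relations_eq by (rule UnI1, rule UnI1, rule UnI1, simp only: magic_unitary_relations_def, use that in blast)+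
  have E: "free_gen (Inr (e, f)) \<otimes>\<^bsub>?F\<^esub> free_gen (Inr (e, f)) \<ominus>\<^bsub>?F\<^esub> free_gen (Inr (e, f)) \<in> quantum_automorphism_relations \<Gamma>"
    "adj ?F (free_gen (Inr (e, f))) \<ominus>\<^bsub>?F\<^esub> free_gen (Inr (e, f)) \<in> quantum_automorphism_relations \<Gamma>"
    if "e \<in> E" "f \<in> E" for e f
    unfolding relations_eq
    by (rule UnI1, rule UnI1, rule UnI2, simp only: magic_unitary_relations_def, use that in blast)+
  fix g assume "g \<in> letters"
  then consider v w where "v \<in> V" "w \<in> V" "g = Inl (v, w)" | e f where "e \<in> E" "f \<in> E" "g = Inr (e, f)"
    by (elim PlusE SigmaE) simp_all
  then show "free_gen g \<otimes>\<^bsub>?F\<^esub> free_gen g \<ominus>\<^bsub>?F\<^esub> free_gen g \<in> quantum_automorphism_relations \<Gamma>"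
    "adj ?F (free_gen g) \<ominus>\<^bsub>?F\<^esub> free_gen g \<in> quantum_automorphism_relations \<Gamma>"
    by (cases; simp only: V E)+
qed

sublocale universal_projections letters "quantum_automorphism_relations \<Gamma>"
  by (rule universal_relations)

abbreviation H where "H \<equiv> quantum_automorphism_group \<Gamma>"
abbreviation uV where "uV v w \<equiv> gen (Inl (v, w))"
abbreviation uE where "uE e f \<equiv> gen (Inr (e, f))"

lemma group_simps: "func_alg H = U" "index_set H = V <+> E" "fund H = U.block_matrix uV uE"
  by (simp_all add: quantum_automorphism_group_def Let_def U.block_matrix_def fun_eq_iff split: sum.split)

lemma relations_iff:
  assumes "star_homomorphism F B \<epsilon>" "unital_star_algebra B"
  shows "(\<forall>r\<in>quantum_automorphism_relations \<Gamma>. \<epsilon> r = \<zero>\<^bsub>B\<^esub>) \<longleftrightarrow>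
    unital_star_algebra.magic_unitary B V (\<lambda>v w. \<epsilon> (free_gen (Inl (v, w)))) \<and>
    unital_star_algebra.magic_unitary B E (\<lambda>e f. \<epsilon> (free_gen (Inr (e, f)))) \<and>
    unital_star_algebra.intertwines B V E (src_incidence \<Gamma>)
      (\<lambda>v w. \<epsilon> (free_gen (Inl (v, w)))) (\<lambda>e f. \<epsilon> (free_gen (Inr (e, f)))) \<and>
    unital_star_algebra.intertwines B V E (rng_incidence \<Gamma>)
      (\<lambda>v w. \<epsilon> (free_gen (Inl (v, w)))) (\<lambda>e f. \<epsilon> (free_gen (Inr (e, f))))"
proof -
  interpret \<epsilon>: star_homomorphism F B \<epsilon> by (rule assms)
  have c: "free_gen (Inl (v, w)) \<in> carrier F" if "v \<in> V" "w \<in> V" for v w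
    by (intro free_gen_closed InlI SigmaI that)
  have d: "free_gen (Inr (e, f)) \<in> carrier F" if "e \<in> E" "f \<in> E" for e f
    by (intro free_gen_closed InrI SigmaI that)
  note iffs = \<epsilon>.magic_relations_iff[OF finite_VE(1), of "\<lambda>v w. free_gen (Inl (v, w))", OF c]
    \<epsilon>.magic_relations_iff[OF finite_VE(2), of "\<lambda>e f. free_gen (Inr (e, f))", OF d]
    \<epsilon>.intertwiner_relations_iff[OF finite_VE, of "\<lambda>v w. free_gen (Inl (v, w))" "\<lambda>e f. free_gen (Inr (e, f))", OF c d]
  show ?thesis
    unfolding relations_eq ball_Un by (simp only: iffs conj_assoc)
qed

lemma magic: "U.magic_unitary V uV" "U.magic_unitary E uE"
  and intertwines: "U.intertwines V E (src_incidence \<Gamma>) uV uE" "U.intertwines V E (rng_incidence \<Gamma>) uV uE"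
  using relations_iff[OF \<iota>_star_hom U.star.unital_star_algebra_axioms] rel_zero
  unfolding gen_eq by blast+

lemma universal_automorphism:
  assumes B: "unital_cstar_algebra B"
    and x: "unital_star_algebra.magic_unitary B V x" "unital_star_algebra.magic_unitary B E y"
      "unital_star_algebra.intertwines B V E (src_incidence \<Gamma>) x y"
      "unital_star_algebra.intertwines B V E (rng_incidence \<Gamma>) x y"
  shows "\<exists>\<phi>. star_homomorphism U B \<phi> \<and> contractive U B \<phi> \<and>
    (\<forall>v\<in>V. \<forall>w\<in>V. \<phi> (uV v w) = x v w) \<and> (\<forall>e\<in>E. \<forall>f\<in>E. \<phi> (uE e f) = y e f)"
proof -
  interpret B: unital_cstar_algebra B by (rule B)
  let ?u = "case_sum (\<lambda>(v, w). x v w) (\<lambda>(e, f). y e f)"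
  have "\<exists>\<phi>. star_homomorphism U B \<phi> \<and> contractive U B \<phi> \<and> (\<forall>g\<in>letters. \<phi> (gen g) = ?u g)"
  proof (rule universal_property[OF B, of ?u])
    show "?u g \<in> carrier B" if "g \<in> letters" for g
      using that B.magic_unitary_closed[OF x(1)] B.magic_unitary_closed[OF x(2)] by auto
    fix \<epsilon> assume \<epsilon>: "star_homomorphism F B \<epsilon>" "\<And>g. g \<in> letters \<Longrightarrow> \<epsilon> (free_gen g) = ?u g"
    have "\<epsilon> (free_gen (Inl (v, w))) = x v w" if "v \<in> V" "w \<in> V" for v w
      using \<epsilon>(2)[of "Inl (v, w)"] that by auto
    moreover have "\<epsilon> (free_gen (Inr (e, f))) = y e f" if "e \<in> E" "f \<in> E" for e f
      using \<epsilon>(2)[of "Inr (e, f)"] that by auto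
    ultimately show "\<forall>r\<in>quantum_automorphism_relations \<Gamma>. \<epsilon> r = \<zero>\<^bsub>B\<^esub>"
      unfolding relations_iff[OF \<epsilon>(1) B.star.unital_star_algebra_axioms]
      using B.magic_unitary_cong[OF x(1)] B.magic_unitary_cong[OF x(2)]
        B.intertwines_cong[OF x(3) B.magic_unitary_closed[OF x(1)] B.magic_unitary_closed[OF x(2)]]
        B.intertwines_cong[OF x(4) B.magic_unitary_closed[OF x(1)] B.magic_unitary_closed[OF x(2)]]
      by simp
  qed
  then show ?thesis by (simp add: Plus_def ball_Un)
qed

sublocale T: cstar_tensor U U
  by unfold_locales

text \<open>Each diagonal block is mapped to its own convolution. In the sum over the disjoint union
  of V and E that \<open>comultiplication\<close> asks for, every term through the other block has a
  zero tensor factor.\<close>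

lemma comultiplication:
  "\<exists>\<Delta>. star_homomorphism U (min_tensor U U) \<Delta> \<and> contractive U (min_tensor U U) \<Delta> \<and>
    (\<forall>v\<in>V. \<forall>w\<in>V. \<Delta> (uV v w) = T.convolution V uV uV v w) \<and>
    (\<forall>e\<in>E. \<forall>f\<in>E. \<Delta> (uE e f) = T.convolution E uE uE e f) \<and> comultiplication H \<Delta>"
proof -
  let ?T = "min_tensor U U"
  note c = U.magic_unitary_closed[OF magic(1)] U.magic_unitary_closed[OF magic(2)]
  obtain \<Delta> where \<Delta>: "star_homomorphism U ?T \<Delta>" "contractive U ?T \<Delta>"
    "\<forall>v\<in>V. \<forall>w\<in>V. \<Delta> (uV v w) = T.convolution V uV uV v w"
    "\<forall>e\<in>E. \<forall>f\<in>E. \<Delta> (uE e f) = T.convolution E uE uE e f"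
    using universal_automorphism[OF T.min_tensor_cstar_algebra
      T.magic_unitary_convolution[OF finite_VE(1) magic(1) magic(1)]
      T.magic_unitary_convolution[OF finite_VE(2) magic(2) magic(2)]
      T.intertwines_convolution[OF finite_VE c c intertwines(1) intertwines(1)]
      T.intertwines_convolution[OF finite_VE c c intertwines(2) intertwines(2)]]
    by blast
  interpret \<Delta>: star_homomorphism U ?T \<Delta> by (rule \<Delta>(1))
  have "\<Delta> (fund H i j) = (\<Oplus>\<^bsub>?T\<^esub>k\<in>V <+> E. T.E (fund H i k) (fund H k j))"
    if ij: "i \<in> V <+> E" "j \<in> V <+> E" for i j
  proof -
    have block: "fund H i j \<in> carrier U" if "i \<in> V <+> E" "j \<in> V <+> E" for i j
      using that c by (auto simp: group_simps)
    have "(\<Oplus>\<^bsub>?T\<^esub>k\<in>V <+> E. T.E (fund H i k) (fund H k j)) =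
        (\<Oplus>\<^bsub>?T\<^esub>v\<in>V. T.E (fund H i (Inl v)) (fund H (Inl v) j)) \<oplus>\<^bsub>?T\<^esub>
        (\<Oplus>\<^bsub>?T\<^esub>e\<in>E. T.E (fund H i (Inr e)) (fund H (Inr e) j))"
      using ij block finite_VE by (intro T.T.finsum_Plus) (auto intro!: T.E_closed)
    also have "\<dots> = \<Delta> (fund H i j)"
    proof -
      have zero: "(\<Oplus>\<^bsub>?T\<^esub>k\<in>K. f k) = \<zero>\<^bsub>?T\<^esub>" if "\<And>k. k \<in> K \<Longrightarrow> f k = \<zero>\<^bsub>?T\<^esub>" for K :: "'k set" and f
      proof -
        have "(\<Oplus>\<^bsub>?T\<^esub>k\<in>K. f k) = (\<Oplus>\<^bsub>?T\<^esub>k\<in>K. \<zero>\<^bsub>?T\<^esub>)" using that by (intro T.T.finsum_cong') auto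
        then show ?thesis by (simp add: T.T.finsum_zero)
      qed
      have sumV: "(\<Oplus>\<^bsub>?T\<^esub>k\<in>V. T.E (uV v k) (uV k w)) \<in> carrier ?T" if "v \<in> V" "w \<in> V" for v w
        using that c by (auto intro!: T.T.finsum_closed T.E_closed)
      have sumE: "(\<Oplus>\<^bsub>?T\<^esub>k\<in>E. T.E (uE e k) (uE k f)) \<in> carrier ?T" if "e \<in> E" "f \<in> E" for e f
        using that c by (auto intro!: T.T.finsum_closed T.E_closed)
      show ?thesis
        using ij
      proof (elim PlusE)
        fix v w assume "v \<in> V" "i = Inl v" "w \<in> V" "j = Inl w"
        then show ?thesis
          using c sumV by (simp add: group_simps \<Delta>(3) T.convolution_def T.E_zero_left zero)
      next
        fix v f assume "v \<in> V" "i = Inl v" "f \<in> E" "j = Inr f"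
        then show ?thesis
          using c by (simp add: group_simps T.E_zero_left T.E_zero_right zero)
      next
        fix e w assume "e \<in> E" "i = Inr e" "w \<in> V" "j = Inl w"
        then show ?thesis
          using c by (simp add: group_simps T.E_zero_left T.E_zero_right zero)
      next
        fix e f assume "e \<in> E" "i = Inr e" "f \<in> E" "j = Inr f"
        then show ?thesis
          using c sumE by (simp add: group_simps \<Delta>(4) T.convolution_def T.E_zero_left zero)
      qed
    qed
    finally show ?thesis by simp
  qed
  then have "comultiplication H \<Delta>"
    using \<Delta>.star_hom unfolding comultiplication_def Let_def by (simp add: group_simps)
  with \<Delta> show ?thesis by blast
qed

lemma compact_quantum_group: "compact_matrix_quantum_group H"
proof -
  note c = U.magic_unitary_closed[OF magic(1)] U.magic_unitary_closed[OF magic(2)]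
  obtain \<Delta> where "comultiplication H \<Delta>"
    using comultiplication by blast
  then show ?thesis
  proof (rule magic_compact_matrix_quantum_group[rotated -1])
    show "generated_by (func_alg H) {fund H i j | i j. i \<in> index_set H \<and> j \<in> index_set H}"
      unfolding group_simps
    proof (rule generated)
      show "{U.block_matrix uV uE i j | i j. i \<in> V <+> E \<and> j \<in> V <+> E} \<subseteq> carrier U"
        using c by auto
      show "gen ` letters \<subseteq> {U.block_matrix uV uE i j | i j. i \<in> V <+> E \<and> j \<in> V <+> E}"
      proof (intro image_subsetI)
        fix g assume "g \<in> letters"
        then consider v w where "v \<in> V" "w \<in> V" "g = Inl (v, w)" | e f where "e \<in> E" "f \<in> E" "g = Inr (e, f)"
          by auto
        then show "gen g \<in> {U.block_matrix uV uE i j | i j. i \<in> V <+> E \<and> j \<in> V <+> E}"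
        proof cases
          case 1
          then have "gen g = U.block_matrix uV uE (Inl v) (Inl w)" "Inl v \<in> V <+> E" "Inl w \<in> V <+> E" by auto
          then show ?thesis by blast
        next
          case 2
          then have "gen g = U.block_matrix uV uE (Inr e) (Inr f)" "Inr e \<in> V <+> E" "Inr f \<in> V <+> E" by auto
          then show ?thesis by blast
        qed
      qed
    qed
    show "unital_star_algebra.magic_unitary (func_alg H) (index_set H) (fund H)"
      unfolding group_simps by (rule U.magic_unitary_block[OF finite_VE magic])
  qed (simp_all add: group_simps finite_VE U.unital_cstar_algebra_axioms)
qed

text \<open>The common core of both claims, with x one of the two diagonal blocks. The last
  hypothesis is algebraic generation: it puts all polynomials into the range of \<phi>, which is
  therefore dense and hence everything. Surjectivity is then used again to obtain the square \<Phi>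
  of \<phi> on the minimal tensor products.\<close>

lemma subgroup_of_permutation_group:
  fixes Y :: "'y set"
  assumes Y: "finite Y" and x: "U.magic_unitary Y x"
    and \<Delta>H: "star_homomorphism U (min_tensor U U) \<Delta>H" "contractive U (min_tensor U U) \<Delta>H" "comultiplication H \<Delta>H"
      "\<And>i j. \<lbrakk>i \<in> Y; j \<in> Y\<rbrakk> \<Longrightarrow> \<Delta>H (x i j) = T.convolution Y x x i j"
    and gen: "\<And>S g. \<lbrakk>U.star_subalgebra S; \<And>i j. \<lbrakk>i \<in> Y; j \<in> Y\<rbrakk> \<Longrightarrow> x i j \<in> S; g \<in> letters\<rbrakk> \<Longrightarrow> gen g \<in> S"
  shows "H \<subseteq>\<^sub>q quantum_permutation_group Y"
proof -
  interpret p: quantum_permutations Y by unfold_locales (rule Y)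
  obtain \<phi> where \<phi>: "star_homomorphism p.U U \<phi>" "contractive p.U U \<phi>"
    "\<forall>i\<in>Y. \<forall>j\<in>Y. \<phi> (p.gen (i, j)) = x i j"
    using p.universal_magic[OF U.unital_cstar_algebra_axioms x] by blast
  interpret \<phi>: star_homomorphism p.U U \<phi> by (rule \<phi>(1))
  have "x i j \<in> \<phi> ` carrier p.U" if "i \<in> Y" "j \<in> Y" for i j
    using that \<phi>(3)[rule_format, of i j] p.gen_closed[of "(i, j)"] by (auto intro!: image_eqI[of _ _ "p.gen (i, j)"])
  then have range_gen: "gen g \<in> \<phi> ` carrier p.U" if "g \<in> letters" for g
    using gen[OF \<phi>.image_star_subalgebra] that by blast
  have "dense_star_hom p.U U \<phi>"
  proof unfold_locales
    fix b \<epsilon> assume b: "b \<in> carrier U" "0 < (\<epsilon> :: real)"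
    obtain a where a: "a \<in> carrier F" "nrm U (b \<ominus>\<^bsub>U\<^esub> S.\<iota> a) < \<epsilon>"
      by (rule polynomials_dense[OF b])
    have "S.\<iota> a \<in> \<phi> ` carrier p.U"
      by (rule polynomials_in_subalgebra[OF \<phi>.image_star_subalgebra range_gen a(1)])
    then show "\<exists>a\<in>carrier p.U. nrm U (b \<ominus>\<^bsub>U\<^esub> \<phi> a) < \<epsilon>"
      using a(2) by auto
  qed (rule \<phi>(2))
  then have surj: "\<phi> ` carrier p.U = carrier U"
    by (rule dense_star_hom.surjective)
  obtain \<Phi> where \<Phi>: "star_homomorphism (min_tensor p.U p.U) (min_tensor U U) \<Phi>"
    "contractive (min_tensor p.U p.U) (min_tensor U U) \<Phi>"
    "\<forall>a\<in>carrier p.U. \<forall>b\<in>carrier p.U. \<Phi> (p.T.E a b) = T.E (\<phi> a) (\<phi> b)"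
    using tensor_square_hom[OF p.U.unital_cstar_algebra_axioms U.unital_cstar_algebra_axioms \<phi>(1,2) surj] by blast
  interpret \<Phi>: star_homomorphism "min_tensor p.U p.U" "min_tensor U U" \<Phi> by (rule \<Phi>(1))
  obtain \<Delta>G where \<Delta>G: "star_homomorphism p.U (min_tensor p.U p.U) \<Delta>G" "contractive p.U (min_tensor p.U p.U) \<Delta>G"
    "\<forall>i\<in>Y. \<forall>j\<in>Y. \<Delta>G (p.gen (i, j)) = p.T.convolution Y (\<lambda>i j. p.gen (i, j)) (\<lambda>i j. p.gen (i, j)) i j"
    "comultiplication p.G \<Delta>G"
    using p.comultiplication by blast
  \<comment> \<open>Both sides are contractive homomorphisms in z, so the generators decide; there
    both yield the convolution of x with itself.\<close>
  have "\<Phi> (\<Delta>G z) = \<Delta>H (\<phi> z)" if z: "z \<in> carrier p.U" for z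
  proof (rule p.hom_eqI[OF _ _ _ _ T.min_tensor_cstar_algebra _ z])
    show "star_homomorphism p.U (min_tensor U U) (\<lambda>z. \<Phi> (\<Delta>G z))" "star_homomorphism p.U (min_tensor U U) (\<lambda>z. \<Delta>H (\<phi> z))"
      by (rule star_homomorphism_comp[OF \<Delta>G(1) \<Phi>(1)] star_homomorphism_comp[OF \<phi>(1) \<Delta>H(1)])+
    show "contractive p.U (min_tensor U U) (\<lambda>z. \<Phi> (\<Delta>G z))" "contractive p.U (min_tensor U U) (\<lambda>z. \<Delta>H (\<phi> z))"
      by (rule contractive_comp[OF \<Delta>G(1,2) \<Phi>(2)] contractive_comp[OF \<phi>(1,2) \<Delta>H(2)])+
    fix g assume "g \<in> Y \<times> Y"
    then obtain i j where ij: "i \<in> Y" "j \<in> Y" "g = (i, j)" by blast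
    note xc = U.magic_unitary_closed[OF x]
    have pc: "p.gen (i, j) \<in> carrier p.U" if "i \<in> Y" "j \<in> Y" for i j
      using that by (intro p.gen_closed) simp
    have "\<Phi> (\<Delta>G (p.gen (i, j))) = (\<Oplus>\<^bsub>min_tensor U U\<^esub>k\<in>Y. \<Phi> (p.T.E (p.gen (i, k)) (p.gen (k, j))))"
      unfolding \<Delta>G(3)[rule_format, OF ij(1,2)] p.T.convolution_def
      using ij pc by (intro \<Phi>.hom_finsum p.T.E_closed) auto
    also have "\<dots> = (\<Oplus>\<^bsub>min_tensor U U\<^esub>k\<in>Y. T.E (x i k) (x k j))"
      using ij pc xc by (intro T.T.finsum_cong') (auto simp: \<Phi>(3) \<phi>(3) T.E_closed)
    also have "\<dots> = \<Delta>H (\<phi> (p.gen (i, j)))"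
      using ij by (simp add: \<phi>(3) \<Delta>H(4) T.convolution_def)
    finally show "\<Phi> (\<Delta>G (p.gen g)) = \<Delta>H (\<phi> (p.gen g))" by (simp add: ij(3))
  qed
  then have "cqg_morphism p.G H \<phi>"
    unfolding cqg_morphism_def Let_def p.group_simps group_simps
    using \<phi>.star_hom \<Delta>G(4) \<Delta>H(3) \<Phi>.star_hom \<Phi>(3) by blast
  then show ?thesis
    unfolding quantum_subgroup_def
    using compact_quantum_group p.compact_quantum_group surj p.group_simps(1) group_simps(1) by metis
qed

text \<open>The left side is an entry of M times the edge matrix, and by the intertwining relation a
  linear combination of entries in row v of the vertex matrix. The set A stands for the edges whose
  source, or range, contains v.\<close>

lemma incidence_sum_row:
  assumes S: "U.star_subalgebra S" and M: "U.intertwines V E M uV uE"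
    and uV: "\<And>v w. \<lbrakk>v \<in> V; w \<in> V\<rbrakk> \<Longrightarrow> uV v w \<in> S"
    and v: "v \<in> V" and f: "f \<in> E" and M01: "\<And>e. M v e = (if e \<in> A then 1 else 0)"
  shows "(\<Oplus>\<^bsub>U\<^esub>e\<in>E \<inter> A. uE e f) \<in> S"
proof -
  note c = U.magic_unitary_closed[OF magic(2)]
  have "(\<Oplus>\<^bsub>U\<^esub>e\<in>E \<inter> A. uE e f) = (\<Oplus>\<^bsub>U\<^esub>e\<in>E \<inter> A. M v e \<odot>\<^bsub>U\<^esub> uE e f)"
    using c f by (intro U.finsum_cong') (auto simp: M01 U.smult_one)
  also have "\<dots> = (\<Oplus>\<^bsub>U\<^esub>e\<in>E. M v e \<odot>\<^bsub>U\<^esub> uE e f)"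
    using c f finite_VE by (intro U.star.finsum_superset[symmetric]) (auto simp: M01 U.smult_closed U.star.smult_zero_left)
  also have "\<dots> = (\<Oplus>\<^bsub>U\<^esub>w\<in>V. M w f \<odot>\<^bsub>U\<^esub> uV v w)"
    using M v f by (simp add: U.intertwines_def)
  also have "\<dots> \<in> S"
    using S uV v by (intro U.star_subalgebra_finsum) (auto simp: U.star_subalgebra_def)
  finally show ?thesis .
qed

text \<open>The same relation read from the other side: here A is the source or the range of
  f.\<close>

lemma incidence_sum_column:
  assumes S: "U.star_subalgebra S" and M: "U.intertwines V E M uV uE"
    and uE: "\<And>e f. \<lbrakk>e \<in> E; f \<in> E\<rbrakk> \<Longrightarrow> uE e f \<in> S"
    and v: "v \<in> V" and f: "f \<in> E" and M01: "\<And>w. M w f = (if w \<in> A then 1 else 0)"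
  shows "(\<Oplus>\<^bsub>U\<^esub>w\<in>V \<inter> A. uV v w) \<in> S"
proof -
  note c = U.magic_unitary_closed[OF magic(1)]
  have "(\<Oplus>\<^bsub>U\<^esub>w\<in>V \<inter> A. uV v w) = (\<Oplus>\<^bsub>U\<^esub>w\<in>V \<inter> A. M w f \<odot>\<^bsub>U\<^esub> uV v w)"
    using c v by (intro U.finsum_cong') (auto simp: M01 U.smult_one)
  also have "\<dots> = (\<Oplus>\<^bsub>U\<^esub>w\<in>V. M w f \<odot>\<^bsub>U\<^esub> uV v w)"
    using c v finite_VE by (intro U.star.finsum_superset[symmetric]) (auto simp: M01 U.smult_closed U.star.smult_zero_left)
  also have "\<dots> = (\<Oplus>\<^bsub>U\<^esub>e\<in>E. M v e \<odot>\<^bsub>U\<^esub> uE e f)"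
    using M v f by (simp add: U.intertwines_def)
  also have "\<dots> \<in> S"
    using S uE f by (intro U.star_subalgebra_finsum) (auto simp: U.star_subalgebra_def)
  finally show ?thesis .
qed

text \<open>\<open>summand_in_subalgebra\<close> is applied to column f of the edge matrix; the
  available partial sums are indexed by the edges that contain a given vertex in their source, or in
  their range.\<close>

lemma uE_in_subalgebra:
  assumes multi: "no_multi_edges \<Gamma>" and S: "U.star_subalgebra S"
    and uV: "\<And>v w. \<lbrakk>v \<in> V; w \<in> V\<rbrakk> \<Longrightarrow> uV v w \<in> S" and e: "e \<in> E" and f: "f \<in> E"
  shows "uE e f \<in> S"
proof (rule U.summand_in_subalgebra[of E "\<lambda>e. uE e f"])
  fix e' assume e': "e' \<in> E" "e' \<noteq> e"
  then have "src \<Gamma> e \<noteq> src \<Gamma> e' \<or> rng \<Gamma> e \<noteq> rng \<Gamma> e'"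
    using multi e by (auto simp: no_multi_edges_def)
  \<comment> \<open>A vertex that tells two edges apart must lie in V to index a row of the
    intertwining relation.\<close>
  moreover have "src \<Gamma> e \<subseteq> V" "src \<Gamma> e' \<subseteq> V" "rng \<Gamma> e \<subseteq> V" "rng \<Gamma> e' \<subseteq> V"
    using hypergraph e e' by (auto simp: hypergraph_def)
  ultimately consider v where "v \<in> V" "(v \<in> src \<Gamma> e) \<noteq> (v \<in> src \<Gamma> e')" | v where "v \<in> V" "(v \<in> rng \<Gamma> e) \<noteq> (v \<in> rng \<Gamma> e')"
    by blast
  then show "\<exists>Y\<subseteq>E. (\<Oplus>\<^bsub>U\<^esub>k\<in>Y. uE k f) \<in> S \<and> (e \<in> Y) \<noteq> (e' \<in> Y)"
  proof cases
    case (1 v)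
    then show ?thesis
      using incidence_sum_row[OF S intertwines(1) uV 1(1) f, of "{e. v \<in> src \<Gamma> e}"] e e'
      by (intro exI[of _ "E \<inter> {e. v \<in> src \<Gamma> e}"]) (auto simp: src_incidence_def)
  next
    case (2 v)
    then show ?thesis
      using incidence_sum_row[OF S intertwines(2) uV 2(1) f, of "{e. v \<in> rng \<Gamma> e}"] e e'
      by (intro exI[of _ "E \<inter> {e. v \<in> rng \<Gamma> e}"]) (auto simp: rng_incidence_def)
  qed
qed (use e f S magic(2) finite_VE U.star_subalgebra_diff[OF S] U.magic_unitary_orthogonal(2)[OF finite_VE(2) magic(2) f] in
    \<open>auto simp: U.magic_unitary_def U.star_subalgebra_def\<close>)

text \<open>Dually, \<open>summand_in_subalgebra\<close> is applied to row v of the vertex matrix.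
  Partial sums over the source or range of an edge separate the vertices, since two vertices
  contained in the same sources and the same ranges would be multi-edges of the dual.\<close>

lemma uV_in_subalgebra:
  assumes multi: "no_multi_edges (dual \<Gamma>)" and S: "U.star_subalgebra S"
    and uE: "\<And>e f. \<lbrakk>e \<in> E; f \<in> E\<rbrakk> \<Longrightarrow> uE e f \<in> S" and v: "v \<in> V" and w: "w \<in> V"
  shows "uV v w \<in> S"
proof (rule U.summand_in_subalgebra[of V "\<lambda>w. uV v w"])
  fix w' assume w': "w' \<in> V" "w' \<noteq> w"
  then have "{e \<in> E. w \<in> src \<Gamma> e} \<noteq> {e \<in> E. w' \<in> src \<Gamma> e} \<or> {e \<in> E. w \<in> rng \<Gamma> e} \<noteq> {e \<in> E. w' \<in> rng \<Gamma> e}"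
    using multi w unfolding no_multi_edges_def dual_def by fastforce
  then consider f where "f \<in> E" "(w \<in> src \<Gamma> f) \<noteq> (w' \<in> src \<Gamma> f)" | f where "f \<in> E" "(w \<in> rng \<Gamma> f) \<noteq> (w' \<in> rng \<Gamma> f)"
    by blast
  then show "\<exists>Y\<subseteq>V. (\<Oplus>\<^bsub>U\<^esub>k\<in>Y. uV v k) \<in> S \<and> (w \<in> Y) \<noteq> (w' \<in> Y)"
  proof cases
    case (1 f)
    then show ?thesis
      using incidence_sum_column[OF S intertwines(1) uE v 1(1), of "src \<Gamma> f"] w w'
      by (intro exI[of _ "V \<inter> src \<Gamma> f"]) (auto simp: src_incidence_def)
  next
    case (2 f)
    then show ?thesis
      using incidence_sum_column[OF S intertwines(2) uE v 2(1), of "rng \<Gamma> f"] w w'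
      by (intro exI[of _ "V \<inter> rng \<Gamma> f"]) (auto simp: rng_incidence_def)
  qed
qed (use v w S magic(1) finite_VE U.star_subalgebra_diff[OF S] U.magic_unitary_orthogonal(1)[OF finite_VE(1) magic(1) v] in
    \<open>auto simp: U.magic_unitary_def U.star_subalgebra_def\<close>)

lemma subgroup_vertices:
  assumes "no_multi_edges \<Gamma>"
  shows "H \<subseteq>\<^sub>q quantum_permutation_group V"
proof -
  obtain \<Delta> where \<Delta>: "star_homomorphism U (min_tensor U U) \<Delta>" "contractive U (min_tensor U U) \<Delta>"
    "\<forall>v\<in>V. \<forall>w\<in>V. \<Delta> (uV v w) = T.convolution V uV uV v w" "comultiplication H \<Delta>"
    using comultiplication by blast
  show ?thesis
  proof (rule subgroup_of_permutation_group[OF finite_VE(1) magic(1) \<Delta>(1,2,4) \<Delta>(3)[rule_format]])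
    fix S g assume "U.star_subalgebra S" "\<And>i j. \<lbrakk>i \<in> V; j \<in> V\<rbrakk> \<Longrightarrow> uV i j \<in> S" "g \<in> letters"
    then show "gen g \<in> S" using uE_in_subalgebra[OF assms] by auto
  qed
qed

lemma subgroup_edges:
  assumes "no_multi_edges (dual \<Gamma>)"
  shows "H \<subseteq>\<^sub>q quantum_permutation_group E"
proof -
  obtain \<Delta> where \<Delta>: "star_homomorphism U (min_tensor U U) \<Delta>" "contractive U (min_tensor U U) \<Delta>"
    "\<forall>e\<in>E. \<forall>f\<in>E. \<Delta> (uE e f) = T.convolution E uE uE e f" "comultiplication H \<Delta>"
    using comultiplication by blast
  show ?thesis
  proof (rule subgroup_of_permutation_group[OF finite_VE(2) magic(2) \<Delta>(1,2,4) \<Delta>(3)[rule_format]])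
    fix S g assume "U.star_subalgebra S" "\<And>i j. \<lbrakk>i \<in> E; j \<in> E\<rbrakk> \<Longrightarrow> uE i j \<in> S" "g \<in> letters"
    then show "gen g \<in> S" using uV_in_subalgebra[OF assms] by auto
  qed
qed

end

theorem theorem1:
  fixes \<Gamma> :: "('v, 'e) pre_hypergraph"
  assumes "hypergraph \<Gamma>"
  shows "(no_multi_edges \<Gamma> \<longrightarrow>
            quantum_automorphism_group \<Gamma> \<subseteq>\<^sub>q quantum_permutation_group (verts \<Gamma>)) \<and>
         (no_multi_edges (dual \<Gamma>) \<longrightarrow>
            quantum_automorphism_group \<Gamma> \<subseteq>\<^sub>q quantum_permutation_group (edges \<Gamma>))"
proof -
  interpret quantum_automorphisms \<Gamma> by unfold_locales (rule assms)
  show ?thesis using subgroup_vertices subgroup_edges by blast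
qed

end
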